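(* Let $H$ and $G$ be countable discrete groups and let $A\subset\mathbb{R}$ be a subset with $\operatorname{tr}_H(K_0(C^*_rH))\subset A$. Let $\Omega$ and $\Delta$ be sets, each equipped with a left $G$-action and a right $H$-action which commute with each other, such that $\Omega$ and $\Delta$ are free $H$-sets. Let $\Omega=\Omega'\cup X$ (disjoint union), and assume that $\Delta$ and $\Omega'$ are free $G$-sets and that $X$ consists of $r$ $H$-orbits, where $1\le r<\infty$. Assume there is a bijective map $\phi\colon\Delta\to\Omega$ which is equivariant for the right $H$-actions. Suppose that for every $g\in G$ the set $$R_g:=\{x\in\Delta\mid \phi(gx)\neq g\phi(x)\}$$ is contained in the union of finitely many $H$-orbits of $\Delta$. Then $$\operatorname{tr}_G(K_0(C^*_rG))\subset \tfrac{1}{r}A .$$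
   Context: For a countable discrete group $\Gamma$, $C^*_r\Gamma$ is the reduced group $C^*$-algebra, and $\operatorname{tr}_\Gamma$ is the canonical trace, extending $\sum_{\gamma}\lambda_\gamma\gamma\mapsto\lambda_1$ from $\mathbb{C}\Gamma$ to $C^*_r\Gamma$; on matrices it is the sum of the traces of the diagonal entries, and it induces a homomorphism $\operatorname{tr}_\Gamma\colon K_0(C^*_r\Gamma)\to\mathbb{R}$. $\frac1r A=\{a/r\mid a\in A\}$. *)

theory Defs
  imports "HOL-Algebra.Group" "HOL-Analysis.Analysis"
begin

text \<open>Vectors are functions on pairs (group element, matrix index). An n x n matrix over
  the reduced group C*-algebra acts on l2(G)^n = l2(G x {0..<n}).\<close>

definition l2 :: "('g,'m) monoid_scheme \<Rightarrow> nat \<Rightarrow> ('g \<times> nat \<Rightarrow> complex) set" where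
  "l2 G n = {f. (\<forall>p. f p \<noteq> 0 \<longrightarrow> fst p \<in> carrier G \<and> snd p < n)
                 \<and> (\<lambda>p. (cmod (f p))^2) summable_on UNIV}"

definition l2_inner :: "('g \<times> nat \<Rightarrow> complex) \<Rightarrow> ('g \<times> nat \<Rightarrow> complex) \<Rightarrow> complex" where
  "l2_inner f g = (\<Sum>\<^sub>\<infinity>p. cnj (f p) * g p)"

definition l2_norm :: "('g \<times> nat \<Rightarrow> complex) \<Rightarrow> real" where
  "l2_norm f = sqrt (\<Sum>\<^sub>\<infinity>p. (cmod (f p))^2)"

definition fin_matrix :: "('g,'m) monoid_scheme \<Rightarrow> nat \<Rightarrow> (nat \<Rightarrow> nat \<Rightarrow> 'g \<Rightarrow> complex) \<Rightarrow> bool" where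
  "fin_matrix G n c = (\<forall>i j. finite {g \<in> carrier G. c i j g \<noteq> 0})"

text \<open>Action of a matrix over CG via the left regular representation,
  lambda_g f (x) = f (g^-1 x).\<close>
definition conv_op :: "('g,'m) monoid_scheme \<Rightarrow> nat \<Rightarrow> (nat \<Rightarrow> nat \<Rightarrow> 'g \<Rightarrow> complex)
      \<Rightarrow> ('g \<times> nat \<Rightarrow> complex) \<Rightarrow> ('g \<times> nat \<Rightarrow> complex)" where
  "conv_op G n c f = (\<lambda>p. if fst p \<in> carrier G \<and> snd p < n then
      (\<Sum>j<n. \<Sum>g\<in>{g \<in> carrier G. c (snd p) j g \<noteq> 0}.
          c (snd p) j g * f (inv\<^bsub>G\<^esub> g \<otimes>\<^bsub>G\<^esub> fst p, j))
      else 0)"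

text \<open>T is (the action on l2(G)^n of) an element of M_n(C*_r G): a norm limit of
  matrices over CG acting via the left regular representation.\<close>
definition reduced_matrix :: "('g,'m) monoid_scheme \<Rightarrow> nat
      \<Rightarrow> (('g \<times> nat \<Rightarrow> complex) \<Rightarrow> ('g \<times> nat \<Rightarrow> complex)) \<Rightarrow> bool" where
  "reduced_matrix G n T \<longleftrightarrow> (\<forall>f\<in>l2 G n. T f \<in> l2 G n) \<and>
     (\<forall>\<epsilon>>0. \<exists>c. fin_matrix G n c \<and>
        (\<forall>f\<in>l2 G n. l2_norm (\<lambda>p. T f p - conv_op G n c f p) \<le> \<epsilon> * l2_norm f))"

definition delta_vec :: "('g,'m) monoid_scheme \<Rightarrow> nat \<Rightarrow> ('g \<times> nat \<Rightarrow> complex)" where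
  "delta_vec G i = (\<lambda>p. if p = (\<one>\<^bsub>G\<^esub>, i) then 1 else 0)"

definition mat_trace :: "('g,'m) monoid_scheme \<Rightarrow> nat
      \<Rightarrow> (('g \<times> nat \<Rightarrow> complex) \<Rightarrow> ('g \<times> nat \<Rightarrow> complex)) \<Rightarrow> complex" where
  "mat_trace G n T = (\<Sum>i<n. l2_inner (delta_vec G i) (T (delta_vec G i)))"

definition is_projection :: "('g,'m) monoid_scheme \<Rightarrow> nat
      \<Rightarrow> (('g \<times> nat \<Rightarrow> complex) \<Rightarrow> ('g \<times> nat \<Rightarrow> complex)) \<Rightarrow> bool" where
  "is_projection G n T \<longleftrightarrow> reduced_matrix G n T \<and>
     (\<forall>f\<in>l2 G n. T (T f) = T f) \<and>
     (\<forall>f\<in>l2 G n. \<forall>g\<in>l2 G n. l2_inner (T f) g = l2_inner f (T g))"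

text \<open>tr_G(K_0(C*_r G)): K_0 of the unital C*-algebra C*_r G consists of the classes
  [p] - [q] with p, q projections in some M_n(C*_r G), and tr_G([p]-[q]) = tr p - tr q.\<close>
definition trK0 :: "('g,'m) monoid_scheme \<Rightarrow> real set" where
  "trK0 G = {Re (mat_trace G n p) - Re (mat_trace G n q) | n p q.
               is_projection G n p \<and> is_projection G n q}"

definition left_action :: "('g,'m) monoid_scheme \<Rightarrow> 'w set \<Rightarrow> ('g \<Rightarrow> 'w \<Rightarrow> 'w) \<Rightarrow> bool" where
  "left_action G S act \<longleftrightarrow>
     (\<forall>g\<in>carrier G. \<forall>x\<in>S. act g x \<in> S) \<and> (\<forall>x\<in>S. act \<one>\<^bsub>G\<^esub> x = x) \<and>
     (\<forall>g\<in>carrier G. \<forall>g'\<in>carrier G. \<forall>x\<in>S. act (g \<otimes>\<^bsub>G\<^esub> g') x = act g (act g' x))"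

definition right_action :: "('h,'m) monoid_scheme \<Rightarrow> 'w set \<Rightarrow> ('w \<Rightarrow> 'h \<Rightarrow> 'w) \<Rightarrow> bool" where
  "right_action H S act \<longleftrightarrow>
     (\<forall>h\<in>carrier H. \<forall>x\<in>S. act x h \<in> S) \<and> (\<forall>x\<in>S. act x \<one>\<^bsub>H\<^esub> = x) \<and>
     (\<forall>h\<in>carrier H. \<forall>h'\<in>carrier H. \<forall>x\<in>S. act x (h \<otimes>\<^bsub>H\<^esub> h') = act (act x h) h')"

definition free_left :: "('g,'m) monoid_scheme \<Rightarrow> 'w set \<Rightarrow> ('g \<Rightarrow> 'w \<Rightarrow> 'w) \<Rightarrow> bool" where
  "free_left G S act \<longleftrightarrow> (\<forall>g\<in>carrier G. \<forall>x\<in>S. act g x = x \<longrightarrow> g = \<one>\<^bsub>G\<^esub>)"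

definition free_right :: "('h,'m) monoid_scheme \<Rightarrow> 'w set \<Rightarrow> ('w \<Rightarrow> 'h \<Rightarrow> 'w) \<Rightarrow> bool" where
  "free_right H S act \<longleftrightarrow> (\<forall>h\<in>carrier H. \<forall>x\<in>S. act x h = x \<longrightarrow> h = \<one>\<^bsub>H\<^esub>)"

definition right_orbit :: "('h,'m) monoid_scheme \<Rightarrow> ('w \<Rightarrow> 'h \<Rightarrow> 'w) \<Rightarrow> 'w \<Rightarrow> 'w set" where
  "right_orbit H act x = {act x h | h. h \<in> carrier H}"

end

theory Submission
  imports Defs
begin

text \<open>
  A projection \<open>p\<close> over the reduced algebra of \<open>G\<close> acts on \<open>\<ell>\<^sup>2(\<Omega>)\<^sup>n\<close> in two ways: through the free \<open>G\<close>-set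
  \<open>\<Omega>'\<close> (and by \<open>0\<close> on \<open>\<ell>\<^sup>2(X)\<close>), and through \<open>\<Delta>\<close> transported along \<open>\<phi>\<close>. For elements of the group ring the two
  operators \<open>A\<close> and \<open>B\<close> differ by an \<open>H\<close>-equivariant matrix supported on finitely many \<open>H\<close>-orbits. On the
  diagonal the difference is \<open>- tr p\<close> on the \<open>r\<close> orbits of \<open>X\<close> and \<open>0\<close> elsewhere, so its \<open>H\<close>-trace is \<open>- r tr p\<close>.

  To stay inside the group ring, \<open>p\<close> is replaced by the iterates under \<open>x \<mapsto> 3 x\<^sup>2 - 2 x\<^sup>3\<close> of a self-adjoint
  element near \<open>p\<close>. The defects \<open>y = x - x\<^sup>2\<close> of the iterates satisfy \<open>y' = 3 y\<^sup>2 + 4 y\<^sup>3\<close>; the trace norm of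
  \<open>y\<^sub>A - y\<^sub>B\<close> therefore tends to \<open>0\<close>, and the trace norm of \<open>A - B\<close> grows more slowly than the defects decay. This
  replaces holomorphic functional calculus in the dense subalgebra of elements with trace class difference.

  The class of the pair \<open>(A, B)\<close> is represented on the doubled space: with \<open>e = diag(1, 0)\<close> and a symmetry \<open>U\<close>
  built from \<open>B\<close> and the flip, \<open>e + U (A - B) e U\<close> is nearly idempotent and differs from \<open>e\<close> by a matrix
  supported on finitely many orbits. Iterating again and cutting down to these orbits gives a projection over
  the reduced algebra of \<open>H\<close> whose trace is an integer minus \<open>r tr p\<close>. Using the same finite set of orbits for
  \<open>p\<close> and \<open>q\<close> makes the integers cancel.
\<close>

section \<open>Near-idempotents in a normed algebra with a trace ideal\<close>

text \<open>On the functions on Omega both operators involve infinitely many H-orbits, so neither is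
  a matrix over the reduced algebra of H; only their difference, taken relative to a fixed
  idempotent, can be. The obstacle is that the trace lives on the ideal of matrices supported on
  finitely many orbits and is not controlled by the operator norm: a small error in norm may carry
  any trace, and no uniform trace norm bound on the differences of the iterates is available. Traces
  are therefore computed before any limit of operators is formed, and only numbers pass to the
  limit. Moreover the normed algebra need not be complete, so inverses and spectral projections are
  out of reach; polynomial iteration and truncated Neumann series do their work. What makes this
  succeed is that every error has the form of a defect in operator norm times a difference in trace
  norm, or is a difference of defects in trace norm. The initial precision \<open>1 / 10^13\<close>
  is a generous choice: the doubling multiplies a defect by up to 5000 and raises norms to 300, and
  the outcome must still be close enough to an idempotent to iterate.\<close>

definition step :: "'a::real_normed_algebra_1 \<Rightarrow> 'a" where
  "step x = x*x + x*x + x*x - (x*x*x + x*x*x)"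

definition defect :: "'a::real_normed_algebra_1 \<Rightarrow> 'a" where
  "defect x = x - x*x"

text \<open>Here \<open>step x = x^2 * (3 - 2*x)\<close> and
  \<open>1 - step x = (1 - x)^2 * (1 + 2*x)\<close>, with product \<open>y^2 * (3 + 4*y)\<close>:
  near an idempotent the defect is essentially squared. Coefficients are spelled out as repeated
  sums so that such noncommutative identities follow by expansion.\<close>

lemma defect_step:
  "defect (step x) = (let y = defect x in y*y + y*y + y*y + (y*y*y + y*y*y + y*y*y + y*y*y))"
  by (simp add: step_def defect_def Let_def algebra_simps)

lemma step_diff: "step x - x = defect x * (x + x - 1)"
  by (simp add: step_def defect_def algebra_simps)

text \<open>Of the quadratic decay only a factor 4 per step is kept: each of the seven summands of
  the new defect is at most \<open>norm y / 100\<close>, and 7/100 is below 1/4. The conditions on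
  \<open>d\<close> keep every iterate within distance 1 of \<open>x\<close>.\<close>

lemma norm_step_pow:
  fixes x :: "'a::real_normed_algebra_1"
  assumes "norm x \<le> K" "1 \<le> K" "norm (defect x) \<le> d" "10*K*d \<le> 1" "100*d \<le> 1"
  shows "norm (defect ((step^^k) x)) \<le> d / 4^k" (is ?P)
    and "norm ((step^^k) x - x) \<le> 7*K*d" (is ?Q)
    and "norm ((step^^Suc k) x - (step^^k) x) \<le> 5*K*d/4^k" (is ?R)
    and "norm ((step^^k) x) \<le> K+1" (is ?S)
proof -
  have d0: "0 \<le> d" using assms(3) norm_ge_zero order_trans by blast
  have Kd: "K*d \<ge> 0" using assms(2) d0 by simp
  \<comment> \<open>The drift is bounded by the partial sums of the increments
    \<open>5*K*d/4^j\<close>, with total \<open>20/3*K*d\<close>; the final bound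
    \<open>7*K*d\<close> alone would not be inductive. The factor \<open>5*K\<close> bounds the norm
    of \<open>2*x - 1\<close>, as \<open>2*(K+1) + 1\<close> is at most \<open>5*K\<close>.\<close>
  have main: "norm (defect ((step^^k) x)) \<le> d / 4^k \<and> norm ((step^^k) x - x) \<le> 20/3*(K*d)*(1 - 1/4^k)" for k
  proof (induction k)
    case 0
    then show ?case using assms by simp
  next
    case (Suc k)
    let ?x = "(step^^k) x"
    let ?y = "defect ?x"
    have y: "norm ?y \<le> d/4^k" using Suc by simp
    have "20/3*(K*d)*(1 - 1/4^k) \<le> 20/3*(K*d)*1"
      using Kd by (intro mult_left_mono) auto
    also have "\<dots> \<le> 1" using assms(4) by simp
    finally have "norm (?x - x) \<le> 1" using Suc by linarith
    then have nx: "norm ?x \<le> K+1"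
      using norm_triangle_sub[of ?x x] assms(1) by linarith
    have yd: "norm ?y \<le> d" using y d0
      by (smt (verit, best) divide_le_eq_1 le_divide_eq_1_pos one_le_power zero_less_power mult_left_le divide_le_0_iff frac_le div_by_1)
    have y1: "norm ?y \<le> 1/100" using yd assms(5) by simp
    have yy: "norm (?y*?y) \<le> norm ?y/100"
      using norm_mult_ineq[of ?y ?y] mult_left_mono[OF y1, of "norm ?y"] by simp
    have yyy: "norm (?y*?y*?y) \<le> norm ?y/100"
    proof -
      have "norm (?y*?y*?y) \<le> norm (?y*?y) * norm ?y" by (rule norm_mult_ineq)
      also have "\<dots> \<le> norm (?y*?y) * 1" using y1 by (intro mult_left_mono) auto
      finally show ?thesis using yy by simp
    qed
    have "norm (defect (step ?x)) \<le> 7 * (norm ?y / 100)"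
      unfolding defect_step Let_def
      using yy yyy
      by (smt (verit) norm_triangle_ineq)
    also have "\<dots> \<le> norm ?y/4" by simp
    also have "\<dots> \<le> d / 4^Suc k" using y by simp
    finally have 1: "norm (defect ((step^^Suc k) x)) \<le> d / 4^Suc k" by simp
    have "norm (?x + ?x - 1) \<le> 5*K"
      using norm_triangle_ineq4[of "?x+?x" 1] norm_triangle_ineq[of ?x ?x] nx assms(2) by simp
    then have "norm (step ?x - ?x) \<le> (d/4^k)*(5*K)"
      unfolding step_diff using y d0
      by (intro order_trans[OF norm_mult_ineq] mult_mono) auto
    then have "norm (step ?x - x) \<le> (d/4^k)*(5*K) + 20/3*(K*d)*(1 - 1/4^k)"
      using Suc norm_triangle_ineq[of "step ?x - ?x" "?x - x"] by (simp only: diff_add_cancel add_diff_eq) linarith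
    also have "\<dots> = 20/3*(K*d)*(1 - 1/4^Suc k)" by (simp add: field_simps)
    finally show ?case using 1 by simp
  qed
  show ?P using main by blast
  have "20/3*(K*d)*(1 - 1/4^k) \<le> 20/3*(K*d)*1"
    using Kd by (intro mult_left_mono) auto
  then have "norm ((step^^k) x - x) \<le> 7*(K*d)" using main[of k] Kd by simp
  then show q: ?Q by (simp add: mult.assoc)
  then show s: ?S using norm_triangle_sub[of "(step^^k) x" x] assms by linarith
  let ?x = "(step^^k) x"
  have "norm (?x + ?x - 1) \<le> 5*K"
    using norm_triangle_ineq4[of "?x+?x" 1] norm_triangle_ineq[of ?x ?x] s assms(2) by simp
  then have "norm (step ?x - ?x) \<le> (d/4^k)*(5*K)"
    unfolding step_diff using main[of k] d0
    by (intro order_trans[OF norm_mult_ineq] mult_mono) auto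
  then show ?R by (simp add: mult_ac)
qed

section \<open>Ideals with a trace, and the trace norm\<close>

locale trace_ideal =
  fixes E J :: "'a::real_normed_algebra_1 set" and tr :: "'a \<Rightarrow> complex"
  assumes one_E: "1 \<in> E"
    and add_E: "\<And>x y. x \<in> E \<Longrightarrow> y \<in> E \<Longrightarrow> x + y \<in> E"
    and minus_E: "\<And>x. x \<in> E \<Longrightarrow> - x \<in> E"
    and mult_E: "\<And>x y. x \<in> E \<Longrightarrow> y \<in> E \<Longrightarrow> x * y \<in> E"
    and J_E: "\<And>x. x \<in> J \<Longrightarrow> x \<in> E"
    and zero_J: "0 \<in> J"
    and add_J: "\<And>x y. x \<in> J \<Longrightarrow> y \<in> J \<Longrightarrow> x + y \<in> J"
    and mult_JE: "\<And>x y. x \<in> J \<Longrightarrow> y \<in> E \<Longrightarrow> x * y \<in> J"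
    and mult_EJ: "\<And>x y. x \<in> E \<Longrightarrow> y \<in> J \<Longrightarrow> x * y \<in> J"
    and tr_add: "\<And>x y. x \<in> J \<Longrightarrow> y \<in> J \<Longrightarrow> tr (x + y) = tr x + tr y"
    and tr_comm: "\<And>x y. x \<in> J \<Longrightarrow> y \<in> E \<Longrightarrow> tr (x * y) = tr (y * x)"
    and tr_bounded: "\<And>x. x \<in> J \<Longrightarrow> \<exists>c. \<forall>y\<in>E. cmod (tr (x * y)) \<le> c * norm y"
    and scaleR_E: "\<And>c x. x \<in> E \<Longrightarrow> c *\<^sub>R x \<in> E"
    and tr_scaleR: "\<And>c x. x \<in> J \<Longrightarrow> tr (c *\<^sub>R x) = c *\<^sub>R tr x"
begin

lemma minus_J: "x \<in> J \<Longrightarrow> - x \<in> J"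
  using mult_JE[of x "-1"] minus_E[OF one_E] by simp

lemma diff_E: "x \<in> E \<Longrightarrow> y \<in> E \<Longrightarrow> x - y \<in> E"
  using add_E[of x "-y"] minus_E by simp

lemma diff_J: "x \<in> J \<Longrightarrow> y \<in> J \<Longrightarrow> x - y \<in> J"
  using add_J[of x "-y"] minus_J by simp

lemma tr_zero: "tr 0 = 0" using tr_add[OF zero_J zero_J] by simp

lemma tr_minus: "x \<in> J \<Longrightarrow> tr (- x) = - tr x"
  using tr_add[of x "-x"] minus_J tr_zero by (simp add: add_eq_0_iff)

lemma tr_diff: "x \<in> J \<Longrightarrow> y \<in> J \<Longrightarrow> tr (x - y) = tr x - tr y"
  using tr_add[of x "-y"] minus_J tr_minus by simp

lemmas closed = one_E add_E minus_E mult_E diff_E zero_J add_J minus_J diff_J mult_JE mult_EJ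

text \<open>The trace norm, defined by duality with the operator norm instead of through absolute
  values: the norm of the functional that \<open>x\<close> induces on \<open>E\<close>.\<close>

definition tnorm :: "'a \<Rightarrow> real" where
  "tnorm x = (SUP y\<in>{y\<in>E. norm y \<le> 1}. cmod (tr (x * y)))"

lemma tnorm_bdd:
  assumes "x \<in> J" shows "bdd_above ((\<lambda>y. cmod (tr (x * y))) ` {y\<in>E. norm y \<le> 1})"
proof -
  obtain c where c: "\<forall>y\<in>E. cmod (tr (x * y)) \<le> c * norm y" using tr_bounded[OF assms] by blast
  have "cmod (tr (x * y)) \<le> \<bar>c\<bar>" if "y \<in> E" "norm y \<le> 1" for y
  proof -
    have "c * norm y \<le> \<bar>c\<bar> * 1" using that(2) by (intro mult_mono) auto
    then show ?thesis using c that(1) by fastforce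
  qed
  then show ?thesis by (intro bdd_aboveI2[of _ _ "\<bar>c\<bar>"]) auto
qed

lemma tnorm_least:
  assumes "\<And>y. y \<in> E \<Longrightarrow> norm y \<le> 1 \<Longrightarrow> cmod (tr (x * y)) \<le> c"
  shows "tnorm x \<le> c"
  unfolding tnorm_def by (rule cSUP_least) (use assms one_E norm_one in auto)

lemma tnorm_nonneg: "x \<in> J \<Longrightarrow> 0 \<le> tnorm x"
  unfolding tnorm_def
  by (rule order_trans[OF _ cSUP_upper[OF _ tnorm_bdd, of 1]]) (use one_E in auto)

lemma tr_le_tnorm_mult:
  assumes "x \<in> J" "y \<in> E" shows "cmod (tr (x * y)) \<le> tnorm x * norm y"
proof (cases "y = 0")
  case True
  then show ?thesis using tr_zero by simp
next
  case False
  define u where "u = (1 / norm y) *\<^sub>R y"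
  have u: "u \<in> E" "norm u \<le> 1" using assms False unfolding u_def by (auto intro: scaleR_E)
  have "x * y = norm y *\<^sub>R (x * u)" using False unfolding u_def by simp
  then have "cmod (tr (x * y)) = norm y * cmod (tr (x * u))"
    using tr_scaleR[OF mult_JE[OF assms(1) u(1)]] by simp
  also have "\<dots> \<le> norm y * tnorm x"
    unfolding tnorm_def
    by (intro mult_left_mono cSUP_upper2[OF tnorm_bdd[OF assms(1)], of u]) (use u in auto)
  finally show ?thesis by (simp add: mult.commute)
qed

lemma tr_le_tnorm: "x \<in> J \<Longrightarrow> cmod (tr x) \<le> tnorm x"
  using tr_le_tnorm_mult[of x 1] one_E by simp

lemma tnorm_mult_right:
  assumes "x \<in> J" "y \<in> E" shows "tnorm (x * y) \<le> tnorm x * norm y"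
proof (rule tnorm_least)
  fix c assume c: "c \<in> E" "norm c \<le> 1"
  have "cmod (tr (x * y * c)) \<le> tnorm x * norm (y * c)"
    unfolding mult.assoc by (rule tr_le_tnorm_mult) (use assms c in \<open>auto intro: closed\<close>)
  also have "tnorm x * norm (y * c) \<le> tnorm x * (norm y * 1)"
  proof (rule mult_left_mono[OF _ tnorm_nonneg[OF assms(1)]])
    show "norm (y * c) \<le> norm y * 1"
    using norm_mult_ineq[of y c] mult_left_mono[OF c(2), of "norm y"] by simp
  qed
  finally show "cmod (tr (x * y * c)) \<le> tnorm x * norm y" by simp
qed

text \<open>By cyclicity the left factor moves into the test element:
  \<open>tr (y * x * c) = tr (x * (c * y))\<close>.\<close>

lemma tnorm_mult_left:
  assumes "x \<in> J" "y \<in> E" shows "tnorm (y * x) \<le> norm y * tnorm x"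
proof (rule tnorm_least)
  fix c assume c: "c \<in> E" "norm c \<le> 1"
  have "tr (y * x * c) = tr (x * (c * y))"
    using tr_comm[of "x * c" y] assms c by (simp add: mult.assoc mult_JE)
  then have "cmod (tr (y * x * c)) \<le> tnorm x * norm (c * y)"
    using tr_le_tnorm_mult[of x "c * y"] assms c closed by simp
  also have "tnorm x * norm (c * y) \<le> tnorm x * norm y"
  proof (rule mult_left_mono[OF _ tnorm_nonneg[OF assms(1)]])
    show "norm (c * y) \<le> norm y"
      using norm_mult_ineq[of c y] mult_right_mono[OF c(2), of "norm y"] by simp
  qed
  finally show "cmod (tr (y * x * c)) \<le> norm y * tnorm x" by (simp add: mult.commute)
qed

lemma tnorm_add:
  assumes "x \<in> J" "y \<in> J" shows "tnorm (x + y) \<le> tnorm x + tnorm y"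
proof (rule tnorm_least)
  fix c assume c: "c \<in> E" "norm c \<le> 1"
  have "cmod (tr ((x + y) * c)) \<le> cmod (tr (x * c)) + cmod (tr (y * c))"
    using tr_add[of "x*c" "y*c"] assms c
    by (simp add: distrib_right closed norm_triangle_ineq)
  also have "\<dots> \<le> tnorm x * norm c + tnorm y * norm c"
    by (intro add_mono tr_le_tnorm_mult assms c)
  also have "\<dots> \<le> tnorm x * 1 + tnorm y * 1"
    by (intro add_mono mult_left_mono c tnorm_nonneg assms)
  finally show "cmod (tr ((x + y) * c)) \<le> tnorm x + tnorm y" by simp
qed

lemma tnorm_minus:
  assumes "x \<in> J" shows "tnorm (- x) = tnorm x"
proof -
  have *: "tr (- (x * y)) = - tr (x * y)" if "y \<in> E" for y
    using that assms by (intro tr_minus mult_JE)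
  show ?thesis unfolding tnorm_def by (intro SUP_cong) (auto simp: *)
qed

lemma tnorm_diff:
  assumes "x \<in> J" "y \<in> J" shows "tnorm (x - y) \<le> tnorm x + tnorm y"
  using tnorm_add[OF assms(1) minus_J[OF assms(2)]] tnorm_minus[OF assms(2)] by simp

lemma tnorm_mult_right': "x \<in> J \<Longrightarrow> y \<in> E \<Longrightarrow> norm y \<le> c \<Longrightarrow> tnorm x \<le> t \<Longrightarrow> tnorm (x * y) \<le> t * c"
  by (rule order_trans[OF tnorm_mult_right mult_mono]) (auto intro: order_trans[OF tnorm_nonneg])

lemma tnorm_mult_left': "x \<in> J \<Longrightarrow> y \<in> E \<Longrightarrow> norm y \<le> c \<Longrightarrow> tnorm x \<le> t \<Longrightarrow> tnorm (y * x) \<le> c * t"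
  by (rule order_trans[OF tnorm_mult_left mult_mono]) (auto intro: tnorm_nonneg order_trans[OF norm_ge_zero])

lemma step_E: "x \<in> E \<Longrightarrow> step x \<in> E"
  unfolding step_def by (intro closed)

lemma defect_E: "x \<in> E \<Longrightarrow> defect x \<in> E"
  unfolding defect_def by (intro closed)

lemma step_pow_E: "x \<in> E \<Longrightarrow> (step^^k) x \<in> E"
  by (induction k) (auto intro: step_E)

lemma mult_diff_J:
  assumes "a \<in> E" "b \<in> E" "c \<in> E" "d \<in> E" "a - b \<in> J" "c - d \<in> J"
  shows "a * c - b * d \<in> J"
proof -
  have "a * c - b * d = (a - b) * c + b * (c - d)" by (simp add: algebra_simps)
  then show ?thesis using assms by (simp add: closed)
qed

lemma add_diff_J: "a - b \<in> J \<Longrightarrow> c - d \<in> J \<Longrightarrow> (a + c) - (b + d) \<in> J"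
  using add_J[of "a - b" "c - d"] by (simp add: algebra_simps)

lemma diff_diff_J: "a - b \<in> J \<Longrightarrow> c - d \<in> J \<Longrightarrow> (a - c) - (b - d) \<in> J"
  using diff_J[of "a - b" "c - d"] by (simp add: algebra_simps)

lemma step_diff_J:
  assumes "a \<in> E" "b \<in> E" "a - b \<in> J" shows "step a - step b \<in> J"
  unfolding step_def
  by (intro add_diff_J diff_diff_J mult_diff_J closed assms)

lemma defect_diff_J:
  assumes "a \<in> E" "b \<in> E" "a - b \<in> J" shows "defect a - defect b \<in> J"
  unfolding defect_def
  by (intro add_diff_J diff_diff_J mult_diff_J closed assms)

lemma step_pow_diff_J:
  assumes "a \<in> E" "b \<in> E" "a - b \<in> J" shows "(step^^k) a - (step^^k) b \<in> J"
  using assms by (induction k) (auto intro: step_diff_J step_pow_E)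

text \<open>Every monomial of the new defect is telescoped into products with \<open>d\<close> in
  one place and old defects, of norm at most 1/100, in the others. The quadratic terms contribute
  3*2/100 and the cubic ones 4*3/100 of the trace norm, less than 1/2 together.\<close>

lemma tnorm_defect_step_diff:
  assumes "a \<in> E" "b \<in> E" "a - b \<in> J" "norm (defect a) \<le> 1/100" "norm (defect b) \<le> 1/100"
  shows "tnorm (defect (step a) - defect (step b)) \<le> tnorm (defect a - defect b) / 2"
proof -
  let ?y = "defect a" and ?z = "defect b"
  define d where "d = ?y - ?z"
  let ?t = "tnorm d"
  have dJ: "d \<in> J" unfolding d_def by (intro defect_diff_J assms)
  have E: "?y \<in> E" "?z \<in> E" using assms by (auto intro: defect_E)
  let ?q = "?y*d + d*?z" and ?c = "?y*(?y*d) + (?y*d*?z + d*?z*?z)"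
  have eq: "defect (step a) - defect (step b) = ?q + ?q + ?q + (?c + ?c + ?c + ?c)"
    unfolding defect_step Let_def d_def by (simp add: algebra_simps)
  have t0: "0 \<le> ?t" by (rule tnorm_nonneg[OF dJ])
  have 1: "tnorm (?y*d) \<le> ?t/100"
    using tnorm_mult_left'[OF dJ E(1) assms(4) order_refl] by simp
  have 2: "tnorm (d*?z) \<le> ?t/100"
    using tnorm_mult_right'[OF dJ E(2) assms(5) order_refl] by simp
  have 3: "tnorm (?y*(?y*d)) \<le> ?t/100"
    using tnorm_mult_left'[OF mult_EJ[OF E(1) dJ] E(1) _ 1, of 1] assms by simp
  have 4: "tnorm (?y*d*?z) \<le> ?t/100"
    using tnorm_mult_right'[OF mult_EJ[OF E(1) dJ] E(2) _ 1, of 1] assms by simp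
  have 5: "tnorm (d*?z*?z) \<le> ?t/100"
    using tnorm_mult_right'[OF mult_JE[OF dJ E(2)] E(2) _ 2, of 1] assms by simp
  have q: "?q \<in> J" and c: "?c \<in> J" using E dJ by (simp_all add: closed)
  have tq: "tnorm ?q \<le> ?t/50"
    using tnorm_add[of "?y*d" "d*?z"] 1 2 E dJ by (simp add: closed)
  have tc: "tnorm ?c \<le> 3*?t/100"
    using tnorm_add[of "?y*(?y*d)" "?y*d*?z + d*?z*?z"] tnorm_add[of "?y*d*?z" "d*?z*?z"] 3 4 5 E dJ
    by (simp add: closed)
  have "tnorm (?q + ?q + ?q + (?c + ?c + ?c + ?c)) \<le> 3*(?t/50) + 4*(3*?t/100)"
    using tnorm_add[of "?q+?q+?q" "?c+?c+?c+?c"] tnorm_add[of "?q+?q" ?q] tnorm_add[of ?q ?q]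
      tnorm_add[of "?c+?c+?c" ?c] tnorm_add[of "?c+?c" ?c] tnorm_add[of ?c ?c] tq tc q c
    by (simp add: add_J)
  also have "\<dots> \<le> ?t/2" using t0 by simp
  finally show ?thesis unfolding eq d_def .
qed

end

section \<open>Pairs of near-idempotents under iteration\<close>

context trace_ideal begin

lemma tnorm_add_le: "x \<in> J \<Longrightarrow> y \<in> J \<Longrightarrow> tnorm x \<le> c \<Longrightarrow> tnorm y \<le> d \<Longrightarrow> tnorm (x + y) \<le> c + d"
  using tnorm_add[of x y] by simp

lemma tnorm_diff_le: "x \<in> J \<Longrightarrow> y \<in> J \<Longrightarrow> tnorm x \<le> c \<Longrightarrow> tnorm y \<le> d \<Longrightarrow> tnorm (x - y) \<le> c + d"
  using tnorm_diff[of x y] by simp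

text \<open>Subtracting the two instances of \<open>step x - x = defect x * (2*x - 1)\<close> leaves
  the difference of the defects times \<open>2*a - 1\<close>, and
  \<open>2 * defect b * (a - b)\<close>. So the trace norm grows by a factor close to 1, up to an
  error governed by the defects.\<close>

lemma tnorm_step_diff:
  assumes "a \<in> E" "b \<in> E" "a - b \<in> J" "norm a \<le> K" "norm (defect b) \<le> d"
  shows "tnorm (step a - step b) \<le> tnorm (a - b) * (1 + 2*d) + tnorm (defect a - defect b) * (2*K+1)"
proof -
  let ?s = "a - b" and ?z = "defect a - defect b"
  have zJ: "?z \<in> J" by (intro defect_diff_J assms)
  have E: "defect b \<in> E" "a + a - 1 \<in> E" using assms by (auto intro!: closed defect_E)
  have eq: "step a - step b = ?s + (?z * (a + a - 1) + (defect b * ?s + defect b * ?s))"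
    by (simp add: step_def defect_def algebra_simps)
  have n: "norm (a + a - 1) \<le> 2*K+1"
    using norm_triangle_ineq4[of "a+a" 1] norm_triangle_ineq[of a a] assms by simp
  have 1: "tnorm (?z * (a + a - 1)) \<le> tnorm ?z * (2*K+1)"
    by (rule tnorm_mult_right'[OF zJ E(2) n order_refl])
  have 2: "tnorm (defect b * ?s) \<le> d * tnorm ?s"
    by (rule tnorm_mult_left'[OF assms(3) E(1) assms(5) order_refl])
  have J: "?z * (a + a - 1) \<in> J" "defect b * ?s \<in> J"
    using zJ E assms by (auto intro: mult_JE mult_EJ)
  have "tnorm (step a - step b) \<le> tnorm ?s + (tnorm ?z * (2*K+1) + (d * tnorm ?s + d * tnorm ?s))"
    unfolding eq by (intro tnorm_add_le add_J J assms(3) 1 2 order_refl)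
  then show ?thesis by (simp add: algebra_simps)
qed

text \<open>A starting point in \<open>E\<close> from which \<open>norm_step_pow\<close> lets the
  iteration contract.\<close>

definition near :: "real \<Rightarrow> real \<Rightarrow> 'a \<Rightarrow> bool" where
  "near K d x \<longleftrightarrow> x \<in> E \<and> norm x \<le> K \<and> norm (defect x) \<le> d \<and> 1 \<le> K \<and> 10*K*d \<le> 1 \<and> 100*d \<le> 1"

lemma near_pow:
  assumes "near K d x"
  shows "norm (defect ((step^^k) x)) \<le> d / 4^k" "norm ((step^^k) x - x) \<le> 7*K*d"
   "norm ((step^^Suc k) x - (step^^k) x) \<le> 5*K*d/4^k" "norm ((step^^k) x) \<le> K+1"
   "(step^^k) x \<in> E"
  using norm_step_pow[of x K d k] assms step_pow_E unfolding near_def by auto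

lemma near_d: assumes "near K d x" shows "0 \<le> d" "d/4^k \<le> 1/100"
proof -
  show "0 \<le> d" using assms norm_ge_zero order_trans unfolding near_def by blast
  then have "d/4^k \<le> d/1" by (intro divide_left_mono) auto
  then have "d/4^k \<le> d" by simp
  also have "d \<le> 1/100" using assms unfolding near_def by simp
  finally show "d/4^k \<le> 1/100" .
qed

lemma near_pow_small: "near K d x \<Longrightarrow> norm (defect ((step^^k) x)) \<le> 1/100"
  using near_pow(1)[of K d x k] near_d(2)[of K d x k] by linarith

lemma tnorm_defect_pow_diff:
  assumes "near K d a" "near K d b" "a - b \<in> J"
  shows "tnorm (defect ((step^^k) a) - defect ((step^^k) b)) \<le> tnorm (defect a - defect b) / 2^k"
proof (induction k)
  case 0
  then show ?case by simp
next
  case (Suc k)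
  have "tnorm (defect (step ((step^^k) a)) - defect (step ((step^^k) b)))
     \<le> tnorm (defect ((step^^k) a) - defect ((step^^k) b)) / 2"
    using assms unfolding near_def
    by (intro tnorm_defect_step_diff near_pow_small[OF assms(1)] near_pow_small[OF assms(2)] step_pow_E step_pow_diff_J) auto
  then show ?case using Suc by simp
qed

text \<open>The trace norm is multiplied by at most 3/2 and then increased by at most half of the
  constant, so it no more than doubles. That constant contains \<open>4*K+6\<close>, twice the
  factor \<open>2*(K+1)+1\<close> of the increment, to make the increment fit into this
  half.\<close>

lemma tnorm_pow_diff:
  assumes "near K d a" "near K d b" "a - b \<in> J"
  shows "tnorm ((step^^k) a - (step^^k) b)
    \<le> (tnorm (a - b) + tnorm (defect a - defect b) * (4*K+6)) * 2^k"
proof (induction k)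
  case 0
  have "tnorm (defect a - defect b) \<ge> 0" "K \<ge> 0"
    using assms unfolding near_def by (auto intro!: tnorm_nonneg defect_diff_J)
  then show ?case by simp
next
  case (Suc k)
  let ?a = "(step^^k) a" and ?b = "(step^^k) b"
  let ?z = "tnorm (defect a - defect b)" and ?c = "tnorm (a - b)"
  let ?C = "?c + ?z * (4*K+6)"
  have E: "a \<in> E" "b \<in> E" "K \<ge> 0" using assms unfolding near_def by auto
  have z0: "?z \<ge> 0" "?c \<ge> 0" using assms E by (auto intro!: tnorm_nonneg defect_diff_J)
  have "tnorm (step ?a - step ?b) \<le> tnorm (?a - ?b) * (1 + 2*(d/4^k)) + tnorm (defect ?a - defect ?b) * (2*(K+1)+1)"
    by (rule tnorm_step_diff[OF near_pow(5)[OF assms(1)] near_pow(5)[OF assms(2)]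
          step_pow_diff_J[OF E(1,2) assms(3)] near_pow(4)[OF assms(1)] near_pow(1)[OF assms(2)]])
  also have "\<dots> \<le> (?C * 2^k) * (3/2) + ?z * (2*(K+1)+1)"
  proof (rule add_mono[OF mult_mono mult_right_mono])
    show "1 + 2*(d/4^k) \<le> 3/2" using near_d(2)[OF assms(1), of k] by linarith
    have "?z/2^k \<le> ?z" using z0 divide_left_mono[of 1 "2^k" ?z] by simp
    then show "tnorm (defect ?a - defect ?b) \<le> ?z"
      using tnorm_defect_pow_diff[OF assms, of k] by linarith
    show "tnorm (?a - ?b) \<le> ?C * 2^k" by (rule Suc)
    show "0 \<le> ?C * 2^k" using z0 E by (intro mult_nonneg_nonneg add_nonneg_nonneg) simp_all
    show "0 \<le> 1 + 2*(d/4^k)" using near_d(1)[OF assms(1)] by simp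
    show "0 \<le> 2*(K+1)+1" using E by simp
  qed
  finally have 1: "tnorm (step ?a - step ?b) \<le> (?C * 2^k) * (3/2) + ?z * (2*(K+1)+1)" .
  have 2: "?z * (2*(K+1)+1) \<le> ?C * (1/2) * 2^k"
  proof -
    have "?z * (2*(K+1)+1) = ?z * (4*K+6) * (1/2)" by (simp add: algebra_simps)
    also have "\<dots> \<le> ?C * (1/2)" using z0 by (intro mult_right_mono) auto
    also have "\<dots> = ?C * (1/2) * 1" by (simp only: mult_1_right)
    also have "\<dots> \<le> ?C * (1/2) * 2^k"
    proof (rule mult_left_mono)
      have "0 \<le> ?z * (4*K+6)" using z0 E by (intro mult_nonneg_nonneg) auto
      then show "0 \<le> ?C * (1/2)" using z0(2) by (intro mult_nonneg_nonneg[OF add_nonneg_nonneg]) simp_all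
    qed simp
    finally show ?thesis .
  qed
  have "tnorm (step ?a - step ?b) \<le> ?C * 2^k * (3/2) + ?C * (1/2) * 2^k"
    by (rule order_trans[OF 1 add_left_mono[OF 2]])
  moreover have "c * 2^k * (3/2) + c * (1/2) * 2^k = c * 2^Suc k" for c :: real by simp
  ultimately show ?case by (simp only: funpow.simps o_apply)
qed

text \<open>The decay \<open>4^k\<close> of the defects in operator norm beats the growth
  \<open>2^k\<close> of the difference in trace norm. All later error terms are bounded by these two
  sequences.\<close>

lemma pair_limits:
  assumes "near K d a" "near K d b" "a - b \<in> J"
  shows "(\<lambda>k. tnorm (defect ((step^^k) a) - defect ((step^^k) b))) \<longlonglongrightarrow> 0" (is ?A)
    and "(\<lambda>k. d/4^k * tnorm ((step^^k) a - (step^^k) b)) \<longlonglongrightarrow> 0" (is ?B)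
proof -
  have E: "a \<in> E" "b \<in> E" using assms unfolding near_def by auto
  have lim: "(\<lambda>k. c / 2^k) \<longlonglongrightarrow> (0::real)" for c
    by (rule LIMSEQ_divide_realpow_zero) simp
  show ?A
    by (rule tendsto_sandwich[OF _ _ tendsto_const lim[of "tnorm (defect a - defect b)"]])
      (use tnorm_defect_pow_diff[OF assms] E assms in
        \<open>simp_all add: always_eventually tnorm_nonneg defect_diff_J step_pow_E step_pow_diff_J\<close>)
  define C where "C = tnorm (a - b) + tnorm (defect a - defect b) * (4*K+6)"
  have "d/4^k * tnorm ((step^^k) a - (step^^k) b) \<le> d * C / 2^k" for k
  proof -
    have "d/4^k * tnorm ((step^^k) a - (step^^k) b) \<le> d/4^k * (C * 2^k)"
      using tnorm_pow_diff[OF assms, of k] near_d(1)[OF assms(1)] unfolding C_def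
      by (intro mult_left_mono) auto
    also have "\<dots> = d * C / 2^k"
      by (simp add: field_simps flip: power_mult_distrib)
    finally show ?thesis .
  qed
  then show ?B
    by (intro tendsto_sandwich[OF _ _ tendsto_const lim[of "d*C"]])
      (use near_d(1)[OF assms(1)] E assms in
        \<open>simp_all add: always_eventually tnorm_nonneg step_pow_diff_J\<close>)
qed

text \<open>With an inverse of \<open>w\<close> at hand, \<open>w * a * w^-1\<close> would be
  \<open>b\<close> up to an error. In its place stands a truncated Neumann series:
  \<open>(1-w)^m * w = (1-w)^m - (1-w)^(m+1)\<close> makes the traces of
  \<open>(1-w)^m * (a - b)\<close> telescope, each difference costing at most \<open>2^-m\<close>
  times the error, while the remaining term tends to 0. The factor 2 is the sum of that
  series.\<close>

lemma tr_diff_le_intertwiner: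
  assumes E: "a \<in> E" "b \<in> E" and s: "a - b \<in> J" and w: "w \<in> E" "w - 1 \<in> J" "norm (1 - w) \<le> 1/2"
    and J: "w * a - b * w \<in> J"
  shows "cmod (tr (a - b)) \<le> 2 * tnorm (w * a - b * w)"
proof -
  let ?e = "w * a - b * w" and ?s = "a - b"
  let ?r = "\<lambda>m. (1 - w)^m"
  have rE: "?r m \<in> E" for m by (induction m) (use w in \<open>auto intro!: closed\<close>)
  have wJ: "1 - w \<in> J" using minus_J[OF w(2)] by simp
  have rJ: "?r (Suc m) \<in> J" for m using wJ rE by (simp add: mult_JE)
  have rw: "?r m * w = w * ?r m" for m
    by (induction m) (simp_all add: algebra_simps)
  have rn: "norm (?r m) \<le> (1/2)^m" for m
    by (rule order_trans[OF norm_power_ineq power_mono]) (use w in auto)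
  \<comment> \<open>Cyclicity needs a factor in \<open>J\<close>. For positive \<open>m\<close> this
    is the power of \<open>1 - w\<close>; for \<open>m = 0\<close> neither \<open>b * w\<close> nor
    \<open>w * b\<close> need lie in \<open>J\<close>, so the commutator is taken with
    \<open>w - 1\<close>.\<close>
  have comm: "tr (?r m * (b * w - w * b)) = 0 \<and> ?r m * (b * w - w * b) \<in> J" for m
  proof (cases m)
    case 0
    have eq: "b * w - w * b = b * (w - 1) - (w - 1) * b" by (simp add: algebra_simps)
    have "tr (b * w - w * b) = 0" unfolding eq
      using tr_diff[of "b * (w - 1)" "(w - 1) * b"] tr_comm[OF w(2) E(2)] w(2) E
      by (simp add: closed)
    then show ?thesis using 0 w E unfolding eq by (simp add: closed)
  next
    case (Suc k)
    have "?r m * (b * w - w * b) = ?r m * b * w - w * ?r m * b"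
      by (simp add: right_diff_distrib mult.assoc flip: rw)
    moreover have "?r m * b \<in> J" using Suc rJ E by (auto intro: mult_JE)
    ultimately show ?thesis
      using tr_diff[of "?r m * b * w" "w * (?r m * b)"] tr_comm[of "?r m * b" w] w
        mult_JE[of "?r m * b" w] mult_EJ[of w "?r m * b"] diff_J[of "?r m * b * w" "w * (?r m * b)"]
      by (simp add: mult.assoc)
  qed
  have step: "cmod (tr (?r m * ?s) - tr (?r (Suc m) * ?s)) \<le> (1/2)^m * tnorm ?e" for m
  proof -
    have sJ: "?r k * ?s \<in> J" for k using rE s by (auto intro: mult_EJ)
    have r: "?r (Suc m) = ?r m - ?r m * w" using rw[of m] by (simp add: algebra_simps)
    have "p * ?s - (p - p * w) * ?s = p * ?e + p * (b * w - w * b)" for p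
      by (simp add: algebra_simps)
    then have "?r m * ?s - ?r (Suc m) * ?s = ?r m * ?e + ?r m * (b * w - w * b)"
      unfolding r .
    then have "tr (?r m * ?s) - tr (?r (Suc m) * ?s) = tr (?r m * ?e)"
      using tr_diff[OF sJ[of m] sJ[of "Suc m"]] comm[of m] tr_add[of "?r m * ?e"] J rE[of m]
      by (simp add: mult_EJ)
    also have "cmod \<dots> \<le> tnorm (?r m * ?e)" using J rE by (auto intro!: tr_le_tnorm mult_EJ)
    also have "\<dots> \<le> (1/2)^m * tnorm ?e" by (rule tnorm_mult_left'[OF J rE rn order_refl])
    finally show ?thesis .
  qed
  have main: "cmod (tr ?s) \<le> cmod (tr (?r m * ?s)) + 2 * (1 - (1/2)^m) * tnorm ?e" for m
  proof (induction m)
    case 0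
    then show ?case by simp
  next
    case (Suc m)
    have "cmod (tr (?r m * ?s)) \<le> cmod (tr (?r (Suc m) * ?s)) + (1/2)^m * tnorm ?e"
      using step[of m] norm_triangle_sub[of "tr (?r m * ?s)" "tr (?r (Suc m) * ?s)"] by linarith
    then show ?case using Suc by (simp add: algebra_simps)
  qed
  have le: "cmod (tr ?s) \<le> (1/2)^m * tnorm ?s + 2 * tnorm ?e" for m
  proof -
    have "cmod (tr (?r m * ?s)) \<le> tnorm (?r m * ?s)"
      using s rE by (auto intro!: tr_le_tnorm mult_EJ)
    also have "\<dots> \<le> (1/2)^m * tnorm ?s" by (rule tnorm_mult_left'[OF s rE rn order_refl])
    finally have "cmod (tr (?r m * ?s)) \<le> (1/2)^m * tnorm ?s" .
    moreover have "2 * (1 - (1/2)^m) * tnorm ?e \<le> 2 * 1 * tnorm ?e"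
      using tnorm_nonneg[OF J] by (intro mult_right_mono) auto
    ultimately show ?thesis using main[of m] by linarith
  qed
  have "(\<lambda>m. (1/2)^m * tnorm ?s + 2 * tnorm ?e) \<longlonglongrightarrow> 0 * tnorm ?s + 2 * tnorm ?e"
    by (intro tendsto_intros LIMSEQ_realpow_zero) auto
  then have "(\<lambda>m. (1/2)^m * tnorm ?s + 2 * tnorm ?e) \<longlonglongrightarrow> 2 * tnorm ?e" by simp
  then show ?thesis by (rule LIMSEQ_le_const) (use le in blast)
qed

text \<open>The element \<open>w = b a + (1 - b) (1 - a)\<close> intertwines \<open>a\<close> and \<open>b\<close> up to their defects.\<close>

lemma tr_diff_le_defects:
  assumes e: "e \<in> E" "e * e = e" and a: "a - e \<in> J" and b: "b - e \<in> J"
    and K: "norm b \<le> K" and d: "norm (defect b) \<le> d" and small: "2*d + (2*K+1) * norm (a - b) \<le> 1/2"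
  shows "cmod (tr (a - b)) \<le> 2 * ((2*K+1) * tnorm (defect a - defect b) + 2 * (d * tnorm (a - b)))"
proof -
  have E: "a \<in> E" "b \<in> E"
    using add_E[OF J_E[OF a] e(1)] add_E[OF J_E[OF b] e(1)] by simp_all
  have sJ: "a - b \<in> J" using diff_J[OF a b] by simp
  have zJ: "defect a - defect b \<in> J" by (intro defect_diff_J E sJ)
  let ?s = "a - b" and ?z = "defect a - defect b"
  define w where "w = 1 - a - b + (b * a + b * a)"
  have wE: "w \<in> E" unfolding w_def using E by (simp add: closed)
  \<comment> \<open>Modulo \<open>J\<close> both \<open>a\<close> and \<open>b\<close> are the
    idempotent \<open>e\<close>, and \<open>w\<close> becomes
    \<open>1 - 2*e + 2*e*e = 1\<close>.\<close>
  have "w - 1 = (b * a - e * e) + (b * a - e * e) - (a - e) - (b - e)"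
    unfolding w_def using e(2) by (simp add: algebra_simps)
  then have wJ: "w - 1 \<in> J" using mult_diff_J[OF E(2) e(1) E(1) e(1) b a] a b by (simp add: closed)
  have "1 - w = defect b + defect b + (?s - (b * ?s + b * ?s))"
    unfolding w_def defect_def by (simp add: algebra_simps)
  then have "norm (1 - w) \<le> norm (defect b) + norm (defect b) + (norm ?s + (norm (b * ?s) + norm (b * ?s)))"
    by (simp only:) (intro norm_triangle_mono norm_triangle_le_diff add_mono order_refl norm_triangle_ineq)
  also have "norm (b * ?s) \<le> K * norm ?s"
    by (rule order_trans[OF norm_mult_ineq mult_right_mono]) (use K in auto)
  finally have wn: "norm (1 - w) \<le> 1/2" using d small by (simp add: algebra_simps)
  have eq: "w * a - b * w = ?z + ((defect b * ?s + defect b * ?s) - (b * ?z + b * ?z))"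
    unfolding w_def defect_def by (simp add: algebra_simps)
  have dE: "defect b \<in> E" by (intro defect_E E)
  have J: "w * a - b * w \<in> J" unfolding eq using zJ sJ dE E by (simp add: closed)
  have 1: "tnorm (defect b * ?s) \<le> d * tnorm ?s"
    by (rule tnorm_mult_left'[OF sJ dE d order_refl])
  have 2: "tnorm (b * ?z) \<le> K * tnorm ?z"
    by (rule tnorm_mult_left'[OF zJ E(2) K order_refl])
  have J': "defect b * ?s \<in> J" "b * ?z \<in> J" using zJ sJ dE E by (auto intro: mult_EJ)
  have "tnorm (w * a - b * w) \<le> tnorm ?z + (2*(d * tnorm ?s) + 2 * (K * tnorm ?z))"
    unfolding eq mult_2
    by (intro tnorm_add_le tnorm_diff_le add_J diff_J J' zJ 1 2 order_refl)
  then show ?thesis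
    using tr_diff_le_intertwiner[OF E sJ wE wJ wn J] by (simp add: algebra_simps)
qed

text \<open>This plays the role of homotopy invariance: near-idempotents that are close in norm have
  asymptotically equal traces, even if their own traces relative to \<open>e\<close> differ. The
  term \<open>14*K*d\<close> is the drift of both iterates, \<open>7*K*d\<close> each, and
  \<open>2*K+3\<close> is \<open>2*K+1\<close> for the enlarged norm bound
  \<open>K+1\<close>.\<close>

lemma tr_step_pow_diff_tendsto_0:
  assumes e: "e \<in> E" "e * e = e" and a: "near K d a" "a - e \<in> J" and b: "near K d b" "b - e \<in> J"
    and small: "2*d + (2*K+3) * (norm (a - b) + 14*K*d) \<le> 1/2"
  shows "(\<lambda>k. tr ((step^^k) a - (step^^k) b)) \<longlonglongrightarrow> 0"
proof -
  let ?a = "\<lambda>k. (step^^k) a" and ?b = "\<lambda>k. (step^^k) b"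
  have sJ: "a - b \<in> J" using diff_J[OF a(2) b(2)] by simp
  have pe: "(step^^k) e = e" for k using e(2) by (induction k) (simp_all add: step_def)
  have K: "K \<ge> 1" using a unfolding near_def by simp
  have *: "cmod (tr (?a k - ?b k)) \<le> 2 * ((2*(K+1)+1) * tnorm (defect (?a k) - defect (?b k)) + 2 * (d/4^k * tnorm (?a k - ?b k)))" for k
  proof (rule tr_diff_le_defects[OF e])
    show "?a k - e \<in> J" "?b k - e \<in> J"
      using step_pow_diff_J[OF _ e(1), of a k] step_pow_diff_J[OF _ e(1), of b k] a b
      unfolding near_def by (auto simp: pe)
    show "norm (?b k) \<le> K+1" "norm (defect (?b k)) \<le> d/4^k"
      using near_pow[OF b(1)] by auto
    have "norm (?a k - ?b k) \<le> norm (?a k - a) + norm (a - b) + norm (?b k - b)"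
      by norm
    also have "\<dots> \<le> norm (a - b) + 14*K*d"
      using near_pow(2)[OF a(1), of k] near_pow(2)[OF b(1), of k] by simp
    finally have "(2*K+3) * norm (?a k - ?b k) \<le> (2*K+3) * (norm (a - b) + 14*K*d)"
      using K by (intro mult_left_mono) auto
    moreover have "2*(d/4^k) \<le> 2*d" using near_d(1)[OF a(1)] divide_left_mono[of 1 "4^k" d] by simp
    moreover have K3: "2*(K+1)+1 = 2*K+3" by simp
    ultimately show "2*(d/4^k) + (2*(K+1)+1) * norm (?a k - ?b k) \<le> 1/2"
      unfolding K3 using small by linarith
  qed
  have "(\<lambda>k. 2 * ((2*(K+1)+1) * tnorm (defect (?a k) - defect (?b k)) + 2 * (d/4^k * tnorm (?a k - ?b k))))
    \<longlonglongrightarrow> 2 * ((2*(K+1)+1) * 0 + 2 * 0)"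
    by (intro tendsto_intros pair_limits[OF a(1) b(1) sJ])
  then have lim: "(\<lambda>k. 2 * ((2*(K+1)+1) * tnorm (defect (?a k) - defect (?b k)) + 2 * (d/4^k * tnorm (?a k - ?b k)))) \<longlonglongrightarrow> 0"
    by (simp only: mult_zero_right add_0)
  show ?thesis
    by (rule Lim_null_comparison[OF always_eventually[OF allI[OF *]] lim])
qed

text \<open>The number \<open>t\<close> stands for the trace, relative to \<open>e\<close>, of the
  limiting idempotent, which itself is not constructed. Since \<open>e\<close> has defect 0, the
  trace norm of the defect is halved at each step, and the traces of the increments
  \<open>defect x * (2*x - 1)\<close> are dominated by a geometric series.\<close>

lemma tr_step_pow_tendsto:
  assumes e: "e \<in> E" "e * e = e" and a: "near K d a" "a - e \<in> J"
  obtains t where "(\<lambda>k. tr ((step^^k) a - e)) \<longlonglongrightarrow> t"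
    "cmod (t - tr (a - e)) \<le> 2 * (2*K+3) * tnorm (defect a)"
proof -
  let ?a = "\<lambda>k. (step^^k) a"
  have pe: "(step^^k) e = e" for k using e(2) by (induction k) (simp_all add: step_def)
  have de: "defect e = 0" using e by (simp add: defect_def)
  have aE: "a \<in> E" using a unfolding near_def by simp
  have aJ: "?a k - e \<in> J" for k using step_pow_diff_J[OF aE e(1) a(2), of k] by (simp add: pe)
  have dJ: "defect (?a k) \<in> J" for k
    using defect_diff_J[OF step_pow_E[OF aE] e(1) aJ] de by simp
  let ?y = "tnorm (defect a)"
  have y: "tnorm (defect (?a k)) \<le> ?y / 2^k" for k
  proof (induction k)
    case (Suc k)
    have "tnorm (defect (step (?a k)) - defect (step e)) \<le> tnorm (defect (?a k) - defect e)/2"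
      by (rule tnorm_defect_step_diff[OF step_pow_E[OF aE] e(1) aJ])
        (use near_pow_small[OF a(1)] de in simp_all)
    moreover have "step e = e" using pe[of 1] by simp
    ultimately show ?case using Suc de by simp
  qed simp
  define u where "u = (\<lambda>k. tr (?a (Suc k) - e) - tr (?a k - e))"
  have u: "cmod (u k) \<le> (2*K+3) * ?y * (1/2)^k" for k
  proof -
    have "u k = tr (step (?a k) - ?a k)" unfolding u_def
      using tr_diff[OF aJ[of "Suc k"] aJ[of k]] by simp
    also have "\<dots> = tr (defect (?a k) * (?a k + ?a k - 1))" by (simp add: step_diff)
    also have "cmod \<dots> \<le> tnorm (defect (?a k)) * norm (?a k + ?a k - 1)"
      using step_pow_E[OF aE] by (intro tr_le_tnorm_mult dJ) (simp add: closed)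
    also have "\<dots> \<le> (?y/2^k) * (2*K+3)"
    proof (intro mult_mono y)
      show "norm (?a k + ?a k - 1) \<le> 2*K+3"
        using norm_triangle_ineq4[of "?a k + ?a k" 1] norm_triangle_ineq[of "?a k" "?a k"] near_pow(4)[OF a(1), of k] by simp
    qed (use tnorm_nonneg[OF dJ[of 0]] in auto)
    finally show ?thesis by (simp add: power_divide mult_ac)
  qed
  have g: "(\<lambda>k. (2*K+3) * ?y * (1/2)^k) sums ((2*K+3) * ?y * (1/(1 - 1/2)))"
    by (intro sums_mult geometric_sums) simp
  have sn: "summable (\<lambda>k. cmod (u k))"
    by (rule summable_comparison_test'[OF sums_summable[OF g]]) (use u in auto)
  then have su: "summable u" by (rule summable_norm_cancel)
  have "cmod (suminf u) \<le> (\<Sum>k. cmod (u k))" by (rule summable_norm[OF sn])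
  also have "\<dots> \<le> (2*K+3) * ?y * (1/(1 - 1/2))"
    unfolding sums_unique[OF g] by (rule suminf_le[OF u sn sums_summable[OF g]])
  finally have le: "cmod (suminf u) \<le> 2 * (2*K+3) * ?y" by (simp add: algebra_simps)
  have "(\<lambda>n. \<Sum>k<n. u k) \<longlonglongrightarrow> suminf u" by (rule summable_LIMSEQ[OF su])
  moreover have "(\<Sum>k<n. u k) = tr (?a n - e) - tr (a - e)" for n
    unfolding u_def by (subst sum_lessThan_telescope) simp
  ultimately have "(\<lambda>n. tr (?a n - e) - tr (a - e) + tr (a - e)) \<longlonglongrightarrow> suminf u + tr (a - e)"
    by (intro tendsto_add tendsto_const) simp
  then show thesis using that[of "suminf u + tr (a - e)"] le by simp
qed

end

section \<open>The doubling construction\<close>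

text \<open>On two copies of a space, \<open>e\<close> is the projection onto the first copy and
  \<open>\<sigma>\<close> the flip; the relation between them says
  \<open>\<sigma> * e = (1 - e) * \<sigma>\<close>.\<close>

locale doubling = trace_ideal E J tr
  for E J :: "'a::real_normed_algebra_1 set" and tr :: "'a \<Rightarrow> complex" +
  fixes e \<sigma> :: 'a
  assumes e_E: "e \<in> E" and \<sigma>_E: "\<sigma> \<in> E"
    and e_idem: "e * e = e" and \<sigma>_inv: "\<sigma> * \<sigma> = 1" and \<sigma>_e: "\<sigma> * e = \<sigma> - e * \<sigma>"
    and norm_e: "norm e \<le> 1" and norm_\<sigma>: "norm \<sigma> \<le> 1"
begin

definition commuting :: "'a \<Rightarrow> bool" where
  "commuting A \<longleftrightarrow> e * A = A * e \<and> \<sigma> * A = A * \<sigma>"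

text \<open>For an idempotent \<open>B\<close> commuting with \<open>\<sigma>\<close> its square is
  \<open>B + (1 - B) = 1\<close>: it flips the two copies on the complement of \<open>B\<close>
  only.\<close>

definition mix :: "'a \<Rightarrow> 'a" where
  "mix B = B + (1 - B) * \<sigma>"

text \<open>For commuting idempotents this is \<open>U * diag(A, 1 - B) * U\<close> with
  \<open>U = mix B\<close>, the standard representative of [A] - [B] relative to [e], because
  \<open>U\<close> carries \<open>diag(B, 1 - B)\<close> to \<open>e\<close>. Writing it as
  \<open>e\<close> plus a correction makes the difference from \<open>e\<close> lie in
  \<open>J\<close> exactly, also when \<open>B\<close> is only nearly idempotent.\<close>

definition dbl :: "'a \<Rightarrow> 'a \<Rightarrow> 'a" where
  "dbl A B = e + mix B * (A - B) * e * mix B"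

lemma commuting_simps:
  assumes "commuting A"
  shows "e * A = A * e" "e * (A * x) = A * (e * x)" "\<sigma> * A = A * \<sigma>" "\<sigma> * (A * x) = A * (\<sigma> * x)"
  using assms unfolding commuting_def by (simp_all flip: mult.assoc)

lemma word_simps:
  "e * e = e" "e * (e * x) = e * x" "\<sigma> * \<sigma> = 1" "\<sigma> * (\<sigma> * x) = x"
  "\<sigma> * e = \<sigma> - e * \<sigma>" "\<sigma> * (e * x) = \<sigma> * x - e * (\<sigma> * x)"
  using e_idem \<sigma>_inv \<sigma>_e by (simp_all add: left_diff_distrib flip: mult.assoc)

lemma commuting_step: "commuting A \<Longrightarrow> commuting (step A)"
  unfolding commuting_def[of "step A"] unfolding step_def
  using commuting_simps[of A] by (simp add: algebra_simps)

lemma commuting_step_pow: "commuting A \<Longrightarrow> commuting ((step^^k) A)"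
  by (induction k) (simp_all add: commuting_step)

text \<open>An exact identity with a defect in every term, from which both the operator norm and the
  trace norm can be estimated. The last two summands measure how far \<open>mix B\<close> is from
  carrying \<open>diag(B, 1 - B)\<close> to \<open>e\<close> when \<open>B\<close> is not
  idempotent.\<close>

lemma defect_dbl:
  assumes "commuting A" "commuting B"
  shows "defect (dbl A B) = mix B * ((defect A - defect B) + ((A - B) * (defect B * (A - B)) + (A - B) * (defect B * (A - B)))) * e * mix B
    + (defect B * ((1 - \<sigma>) * (1 - e - e)) * (A - B) * e * mix B
      + mix B * (A - B) * e * (defect B * ((1 - e - e) * (1 - \<sigma>))))"
proof -
  let ?U = "mix B" and ?Y = "defect B"
  define D where "D = A - B"
  define Q where "Q = B * e + (1 - B) * (1 - e)"
  define k where "k = ?Y * ((1 - e - e) * (1 - \<sigma>))"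
  define k' where "k' = ?Y * ((1 - \<sigma>) * (1 - e - e))"
  have cD: "commuting D" using assms unfolding commuting_def D_def by (simp add: algebra_simps)
  note c = commuting_simps[OF cD] commuting_simps[OF assms(2)] word_simps
  \<comment> \<open>If \<open>B\<close> is idempotent, the symmetry \<open>mix B\<close> conjugates \<open>Q = diag(B, 1 - B)\<close> into \<open>e = diag(1, 0)\<close>.\<close>
  have 1: "e * ?U = ?U * Q - k'"
    unfolding mix_def Q_def k'_def defect_def by (simp add: algebra_simps c)
  have 2: "?U * e = Q * ?U - k"
    unfolding mix_def Q_def k_def defect_def by (simp add: algebra_simps c)
  have 3: "Q * (D * e) = B * D * e" "D * e * Q = D * B * e"
    unfolding Q_def by (simp_all add: algebra_simps c)
  have 4: "D * e * (?U * ?U) * (D * e) = (D * D - (D * (?Y * D) + D * (?Y * D))) * e"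
    unfolding mix_def defect_def by (simp add: algebra_simps c)
  have 5: "B * D + D * B + D * D - D = defect B - defect A"
    unfolding D_def defect_def by (simp add: algebra_simps)
  have l: "e * (?U * (D * e) * ?U) = ?U * (B * D * e) * ?U - k' * (D * e) * ?U"
  proof -
    have "e * (?U * (D * e) * ?U) = (e * ?U) * (D * e) * ?U" by (simp add: mult.assoc)
    also have "\<dots> = ?U * (Q * (D * e)) * ?U - k' * (D * e) * ?U"
      unfolding 1 by (simp add: left_diff_distrib mult.assoc)
    finally show ?thesis unfolding 3 .
  qed
  have r: "?U * (D * e) * ?U * e = ?U * (D * B * e) * ?U - ?U * (D * e) * k"
  proof -
    have "?U * (D * e) * ?U * e = ?U * (D * e) * (?U * e)" by (simp add: mult.assoc)
    also have "\<dots> = ?U * (D * e * Q) * ?U - ?U * (D * e) * k"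
      unfolding 2 by (simp add: right_diff_distrib mult.assoc)
    finally show ?thesis unfolding 3 .
  qed
  have m: "(?U * (D * e) * ?U) * (?U * (D * e) * ?U) = ?U * ((D * D - (D * (?Y * D) + D * (?Y * D))) * e) * ?U"
    unfolding 4[symmetric] by (simp add: mult.assoc)
  let ?F = "?U * (D * e) * ?U"
  have "defect (e + ?F) = ?F - (e * ?F + ?F * e + ?F * ?F)"
    by (simp add: defect_def algebra_simps e_idem)
  also have "\<dots> = - (?U * ((B * D + D * B + D * D - D) * e) * ?U)
      + ?U * ((D * (?Y * D) + D * (?Y * D)) * e) * ?U + (k' * (D * e) * ?U + ?U * (D * e) * k)"
    unfolding l r m by (simp add: algebra_simps)
  also have "\<dots> = ?U * ((defect A - defect B + (D * (?Y * D) + D * (?Y * D))) * e) * ?U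
      + (k' * (D * e) * ?U + ?U * (D * e) * k)"
    unfolding 5 by (simp add: algebra_simps)
  finally show ?thesis
    unfolding dbl_def D_def[symmetric] k_def k'_def by (simp add: mult.assoc)
qed

lemma mix_E: "B \<in> E \<Longrightarrow> mix B \<in> E"
  unfolding mix_def using \<sigma>_E by (simp add: closed)

lemma norm_mix: assumes "norm B \<le> 3" shows "norm (mix B) \<le> 7"
proof -
  have "norm ((1 - B) * \<sigma>) \<le> 4 * 1"
    using norm_triangle_ineq4[of 1 B] assms norm_\<sigma>
    by (intro order_trans[OF norm_mult_ineq mult_mono]) auto
  then show ?thesis unfolding mix_def using norm_triangle_ineq[of B] assms by (smt (verit))
qed

lemma norm_mult_le: "norm x \<le> a \<Longrightarrow> norm y \<le> b \<Longrightarrow> norm (x * y) \<le> a * b" for x y :: 'a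
  by (rule order_trans[OF norm_mult_ineq mult_mono]) (auto intro: order_trans[OF norm_ge_zero])

lemma norm_add_le: "norm x \<le> a \<Longrightarrow> norm y \<le> b \<Longrightarrow> norm (x + y) \<le> a + b" for x y :: 'a
  using norm_triangle_ineq[of x y] by simp

lemma norm_diff_le: "norm x \<le> a \<Longrightarrow> norm y \<le> b \<Longrightarrow> norm (x - y) \<le> a + b" for x y :: 'a
  using norm_triangle_ineq4[of x y] by simp

lemma norm_refl: "norm (1 - e - e) \<le> 3" "norm (1 - \<sigma>) \<le> 2"
  using norm_diff_le[OF norm_diff_le[of 1 1 e 1] norm_e] norm_diff_le[of 1 1 \<sigma> 1] norm_e norm_\<sigma> by auto

lemma dbl_J: "A \<in> E \<Longrightarrow> B \<in> E \<Longrightarrow> A - B \<in> J \<Longrightarrow> dbl A B - e \<in> J"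
  unfolding dbl_def using mix_E[of B] e_E by (simp add: mult_JE mult_EJ)

text \<open>The estimates add up to 295 for the norm and \<open>4130*d\<close> for the defect,
  rounded to 300 and \<open>5000*d\<close>.\<close>

lemma dbl_near:
  assumes "A \<in> E" "B \<in> E" "A - B \<in> J" "commuting A" "commuting B"
    and n: "norm A \<le> 3" "norm B \<le> 3" and d: "norm (defect A) \<le> d" "norm (defect B) \<le> d"
    and small: "10^12 * d \<le> 1"
  shows "near 300 (5000*d) (dbl A B)"
proof -
  have d0: "0 \<le> d" using d norm_ge_zero order_trans by blast
  have D: "norm (A - B) \<le> 6" using norm_diff_le[OF n] by simp
  note U = norm_mix[OF n(2)]
  have "norm (dbl A B) \<le> 1 + 7 * 6 * 1 * 7"
    unfolding dbl_def by (intro norm_add_le norm_mult_le U D norm_e)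
  moreover have "norm (defect (dbl A B)) \<le>
    7 * ((d + d) + (6 * (d * 6) + 6 * (d * 6))) * 1 * 7 + (d * (2 * 3) * 6 * 1 * 7 + 7 * 6 * 1 * (d * (3 * 2)))"
    unfolding defect_dbl[OF assms(4,5)]
    by (intro norm_add_le norm_mult_le norm_diff_le U D norm_e norm_refl d)
  moreover have "dbl A B \<in> E" using add_E[OF J_E[OF dbl_J[OF assms(1-3)]] e_E] by simp
  ultimately show ?thesis using small d0 unfolding near_def by simp
qed

lemma tnorm_defect_dbl:
  assumes "A \<in> E" "B \<in> E" "A - B \<in> J" "commuting A" "commuting B"
    and n: "norm A \<le> 3" "norm B \<le> 3" and d: "norm (defect B) \<le> d"
  shows "tnorm (defect (dbl A B)) \<le> 49 * tnorm (defect A - defect B) + 2000 * (d * tnorm (A - B))"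
proof -
  have d0: "0 \<le> d" using d norm_ge_zero order_trans by blast
  let ?t = "tnorm (A - B)" and ?z = "tnorm (defect A - defect B)"
  have t0: "0 \<le> ?t" by (rule tnorm_nonneg[OF assms(3)])
  have D: "norm (A - B) \<le> 6" using norm_diff_le[OF n] by simp
  note U = norm_mix[OF n(2)] and UE = mix_E[OF assms(2)]
  have zJ: "defect A - defect B \<in> J" by (intro defect_diff_J assms)
  have dE: "defect B \<in> E" by (intro defect_E assms)
  have kE: "(1 - \<sigma>) * (1 - e - e) \<in> E" "(1 - e - e) * (1 - \<sigma>) \<in> E"
    using e_E \<sigma>_E by (simp_all add: closed)
  have dD: "defect B * (A - B) \<in> J" by (intro mult_EJ dE assms)
  have dD': "(A - B) * (defect B * (A - B)) \<in> J" by (rule mult_JE[OF assms(3) J_E[OF dD]])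
  have k1: "defect B * ((1 - \<sigma>) * (1 - e - e)) \<in> E" "defect B * ((1 - e - e) * (1 - \<sigma>)) \<in> E"
    by (intro mult_E dE kE)+
  have tdD: "tnorm ((A - B) * (defect B * (A - B))) \<le> 6 * (d * ?t)"
    by (rule tnorm_mult_left'[OF dD J_E[OF assms(3)] D tnorm_mult_left'[OF assms(3) dE d order_refl]])
  have k2: "norm (defect B * ((1 - \<sigma>) * (1 - e - e))) \<le> d * (2 * 3)" "norm (defect B * ((1 - e - e) * (1 - \<sigma>))) \<le> d * (3 * 2)"
    by (intro norm_mult_le norm_refl d)+
  let ?M = "(defect A - defect B) + ((A - B) * (defect B * (A - B)) + (A - B) * (defect B * (A - B)))"
  have MJ: "?M \<in> J" by (intro add_J zJ dD')
  have tM: "tnorm ?M \<le> ?z + (6 * (d * ?t) + 6 * (d * ?t))"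
    by (intro tnorm_add_le add_J zJ dD' tdD order_refl)
  have 1: "tnorm (mix B * ?M * e * mix B) \<le> 7 * (?z + (6 * (d * ?t) + 6 * (d * ?t))) * 1 * 7"
    by (intro tnorm_mult_right' tnorm_mult_left' mult_JE mult_EJ MJ UE e_E tM norm_e U)
  have 2: "tnorm (defect B * ((1 - \<sigma>) * (1 - e - e)) * (A - B) * e * mix B) \<le> (d * (2 * 3)) * ?t * 1 * 7"
    by (intro tnorm_mult_right' tnorm_mult_left' mult_JE mult_EJ[OF k1(1)] assms(3) UE e_E k1 k2 norm_e U order_refl)
  have 3: "tnorm (mix B * (A - B) * e * (defect B * ((1 - e - e) * (1 - \<sigma>)))) \<le> 7 * ?t * 1 * (d * (3 * 2))"
    by (rule tnorm_mult_right'[OF _ k1(2) k2(2)])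
      (intro tnorm_mult_right' tnorm_mult_left' mult_JE mult_EJ assms(3) UE e_E norm_e U order_refl)+
  have "tnorm (defect (dbl A B)) \<le> 7 * (?z + (6 * (d * ?t) + 6 * (d * ?t))) * 1 * 7
     + ((d * (2 * 3)) * ?t * 1 * 7 + 7 * ?t * 1 * (d * (3 * 2)))"
    unfolding defect_dbl[OF assms(4,5)]
    by (intro tnorm_add_le[OF _ _ 1 tnorm_add_le[OF _ _ 2 3]])
      (use MJ UE e_E k1 assms(3) in \<open>simp_all add: mult_JE mult_EJ add_J del: mult.assoc\<close>)
  also have "\<dots> = 49 * ?z + 672 * (d * ?t)" by (simp add: algebra_simps)
  also have "\<dots> \<le> 49 * ?z + 2000 * (d * ?t)" using d0 t0 by (simp add: mult_right_mono)
  finally show ?thesis .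
qed

text \<open>By cyclicity the trace is that of \<open>(A - B) * e * U^2\<close> with
  \<open>U = mix B\<close>, and \<open>U^2 - 1 = 2 * defect B * (\<sigma> - 1)\<close>.\<close>

lemma tr_dbl:
  assumes "A \<in> E" "B \<in> E" "A - B \<in> J" "commuting A" "commuting B" and d: "norm (defect B) \<le> d"
  shows "cmod (tr (dbl A B - e) - tr ((A - B) * e)) \<le> 4 * (d * tnorm (A - B))"
proof -
  let ?D = "A - B" and ?Y = "defect B" and ?t = "tnorm (A - B)"
  note c = commuting_simps[OF assms(5)] word_simps
  have YE: "?Y \<in> E" by (intro defect_E assms)
  have DJ: "?D * e \<in> J" by (intro mult_JE assms e_E)
  have UE: "mix B \<in> E" by (rule mix_E[OF assms(2)])
  have "tr (dbl A B - e) = tr (mix B * (?D * e * mix B))" by (simp add: dbl_def mult.assoc)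
  also have "\<dots> = tr (?D * e * (mix B * mix B))"
    using tr_comm[of "?D * e * mix B" "mix B"] mult_JE[OF DJ UE] UE by (simp add: mult.assoc)
  also have "mix B * mix B = 1 + (?Y + ?Y) * (\<sigma> - 1)"
    unfolding mix_def defect_def by (simp add: algebra_simps c)
  also have "?D * e * (1 + (?Y + ?Y) * (\<sigma> - 1)) = ?D * e + ?D * e * ((?Y + ?Y) * (\<sigma> - 1))"
    by (simp add: distrib_left)
  also have "tr \<dots> = tr (?D * e) + tr (?D * e * ((?Y + ?Y) * (\<sigma> - 1)))"
    using assms(3) e_E YE \<sigma>_E by (intro tr_add mult_JE mult_E add_E diff_E one_E)
  finally have "tr (dbl A B - e) - tr (?D * e) = tr (?D * e * ((?Y + ?Y) * (\<sigma> - 1)))" by simp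
  also have "cmod \<dots> \<le> tnorm (?D * e * ((?Y + ?Y) * (\<sigma> - 1)))"
    using assms(3) e_E YE \<sigma>_E by (intro tr_le_tnorm mult_JE mult_E add_E diff_E one_E)
  also have "\<dots> \<le> (?t * 1) * ((d + d) * 2)"
  proof (rule tnorm_mult_right'[OF DJ])
    show "(?Y + ?Y) * (\<sigma> - 1) \<in> E" using YE \<sigma>_E by (intro mult_E add_E diff_E one_E)
    show "norm ((?Y + ?Y) * (\<sigma> - 1)) \<le> (d + d) * 2"
      using norm_refl(2) by (intro norm_mult_le norm_add_le d) (simp add: norm_minus_commute)
    show "tnorm (?D * e) \<le> ?t * 1" by (intro tnorm_mult_right' assms e_E norm_e order_refl)
  qed
  finally show ?thesis by (simp add: algebra_simps)
qed

lemma norm_dbl_diff: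
  assumes "norm A \<le> 3" "norm B \<le> 3" "norm A' \<le> 3" "norm B' \<le> 3" "norm (A - A') \<le> h" "norm (B - B') \<le> h"
  shows "norm (dbl A B - dbl A' B') \<le> 266 * h"
proof -
  let ?U = "mix B" and ?V = "mix B'"
  note U = norm_mix[OF assms(2)] and V = norm_mix[OF assms(4)]
  have D: "norm (A - B) \<le> 6" "norm (A' - B') \<le> 6" using norm_diff_le assms by fastforce+
  have "?U - ?V = (B - B') * (1 - \<sigma>)" unfolding mix_def by (simp add: algebra_simps)
  then have UV: "norm (?U - ?V) \<le> h * 2" using norm_mult_le[OF assms(6) norm_refl(2)] by simp
  have DD: "norm ((A - A') - (B - B')) \<le> h + h" by (intro norm_diff_le assms)
  have "dbl A B - dbl A' B' = (?U - ?V) * (A - B) * e * ?U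
      + (?V * ((A - A') - (B - B')) * e * ?U + ?V * (A' - B') * e * (?U - ?V))"
    unfolding dbl_def by (simp add: algebra_simps)
  also have "norm \<dots> \<le> (h * 2) * 6 * 1 * 7 + (7 * (h + h) * 1 * 7 + 7 * 6 * 1 * (h * 2))"
    by (intro norm_add_le norm_mult_le U V D UV DD norm_e)
  finally show ?thesis by simp
qed

text \<open>The double \<open>X 0\<close> of \<open>A\<close> and \<open>B\<close> has a small
  defect in operator norm, but nothing makes it small in trace norm, so its limiting trace
  \<open>t 0\<close> cannot be read off from \<open>X 0\<close>. Hence the k-th iterates are doubled
  as well: the limiting traces \<open>t k\<close> all agree because \<open>X k\<close> stays close
  to \<open>X 0\<close>, and \<open>t k\<close> differs from the trace of
  \<open>(A_k - B_k) * e\<close> by an error that tends to 0.\<close>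

theorem tr_step_pow_dbl_tendsto:
  assumes A: "near (3/2) d A" "commuting A" and B: "near (3/2) d B" "commuting B" and J: "A - B \<in> J"
    and small: "10^12 * d \<le> 1"
    and L: "(\<lambda>k. tr (((step^^k) A - (step^^k) B) * e)) \<longlonglongrightarrow> L"
  shows "(\<lambda>k. tr ((step^^k) (dbl A B) - e)) \<longlonglongrightarrow> L"
proof -
  let ?A = "\<lambda>k. (step^^k) A" and ?B = "\<lambda>k. (step^^k) B"
  let ?X = "\<lambda>k. dbl (?A k) (?B k)"
  have d0: "0 \<le> d" by (rule near_d(1)[OF A(1)])
  have dk: "d/4^k \<le> d" for k using d0 divide_left_mono[of 1 "4^k" d] by simp
  have E: "A \<in> E" "B \<in> E" using A B unfolding near_def by auto
  have Ek: "?A k \<in> E" "?B k \<in> E" "?A k - ?B k \<in> J" for k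
    using E J by (auto intro: step_pow_E step_pow_diff_J)
  have ck: "commuting (?A k)" "commuting (?B k)" for k
    using A B by (auto intro: commuting_step_pow)
  have nk: "norm (?A k) \<le> 3" "norm (?B k) \<le> 3" for k
    using near_pow(4)[OF A(1), of k] near_pow(4)[OF B(1), of k] by auto
  have defk: "norm (defect (?A k)) \<le> d" "norm (defect (?B k)) \<le> d" for k
    using near_pow(1)[OF A(1), of k] near_pow(1)[OF B(1), of k] dk[of k] by linarith+
  have Xn: "near 300 (5000*d) (?X k)" for k
    by (rule dbl_near[OF Ek ck nk defk small])
  have XJ: "?X k - e \<in> J" for k by (rule dbl_J[OF Ek])
  have "\<exists>t. (\<lambda>j. tr ((step^^j) (?X k) - e)) \<longlonglongrightarrow> t \<and>
     cmod (t - tr (?X k - e)) \<le> 2 * (2*300+3) * tnorm (defect (?X k))" for k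
    using tr_step_pow_tendsto[OF e_E e_idem Xn XJ] by metis
  then obtain t where t: "\<And>k. (\<lambda>j. tr ((step^^j) (?X k) - e)) \<longlonglongrightarrow> t k"
     "\<And>k. cmod (t k - tr (?X k - e)) \<le> 2 * (2*300+3) * tnorm (defect (?X k))" by metis
  \<comment> \<open>Each of the two iterates drifts by at most \<open>7*(3/2)*d\<close>, which is
    below \<open>11*d\<close>, and the double moves by at most 266 times as much.\<close>
  have teq: "t k = t 0" for k
  proof -
    have "norm (?X k - ?X 0) \<le> 266 * (11 * d)"
      using near_pow(2)[OF A(1), of k] near_pow(2)[OF B(1), of k] d0 nk[of 0]
      by (intro norm_dbl_diff nk) auto
    then have "(\<lambda>j. tr ((step^^j) (?X k) - (step^^j) (?X 0))) \<longlonglongrightarrow> 0"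
      using small d0 by (intro tr_step_pow_diff_tendsto_0[OF e_E e_idem Xn XJ Xn XJ]) simp
    moreover have "tr ((step^^j) (?X k) - (step^^j) (?X 0)) = tr ((step^^j) (?X k) - e) - tr ((step^^j) (?X 0) - e)" for j
    proof -
      have "(step^^j) (?X k) - e \<in> J" for k
      proof - 
        have "(step^^j) e = e" by (induction j) (simp_all add: step_def e_idem)
        then show ?thesis
          using step_pow_diff_J[OF _ e_E XJ, of k j] Xn[of k] unfolding near_def by simp
      qed
      from tr_diff[OF this[of k] this[of 0]] show ?thesis by (simp only: diff_diff_eq2 diff_add_cancel)
    qed
    ultimately have "(\<lambda>j. tr ((step^^j) (?X k) - e) - tr ((step^^j) (?X 0) - e)) \<longlonglongrightarrow> 0" by simp
    then show ?thesis
      using tendsto_diff[OF t(1)[of k] t(1)[of 0]] LIMSEQ_unique by fastforce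
  qed
  note pl = pair_limits[OF A(1) B(1) J]
  have "(\<lambda>k. 49 * tnorm (defect (?A k) - defect (?B k)) + 2000 * (d/4^k * tnorm (?A k - ?B k))) \<longlonglongrightarrow> 49 * 0 + 2000 * 0"
    by (intro tendsto_intros pl)
  then have lim0: "(\<lambda>k. 2 * (2*300+3) * (49 * tnorm (defect (?A k) - defect (?B k)) + 2000 * (d/4^k * tnorm (?A k - ?B k)))) \<longlonglongrightarrow> 0"
    by (intro tendsto_mult_right_zero) simp
  have "cmod (t 0 - tr (?X k - e)) \<le> 2 * (2*300+3) * (49 * tnorm (defect (?A k) - defect (?B k)) + 2000 * (d/4^k * tnorm (?A k - ?B k)))" for k
    using t(2)[of k] tnorm_defect_dbl[OF Ek ck nk near_pow(1)[OF B(1)], of k] unfolding teq[of k]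
    by (smt (verit) mult_left_mono)
  then have l1: "(\<lambda>k. t 0 - tr (?X k - e)) \<longlonglongrightarrow> 0"
    by (intro Lim_null_comparison[OF always_eventually[OF allI] lim0])
  have lim1: "(\<lambda>k. 4 * (d/4^k * tnorm (?A k - ?B k))) \<longlonglongrightarrow> 0"
    by (rule tendsto_mult_right_zero[OF pl(2)])
  have "cmod (tr (?X k - e) - tr ((?A k - ?B k) * e)) \<le> 4 * (d/4^k * tnorm (?A k - ?B k))" for k
    by (rule tr_dbl[OF Ek ck near_pow(1)[OF B(1)]])
  then have l2: "(\<lambda>k. tr (?X k - e) - tr ((?A k - ?B k) * e)) \<longlonglongrightarrow> 0"
    by (intro Lim_null_comparison[OF always_eventually[OF allI] lim1])
  have "(\<lambda>k. t 0) \<longlonglongrightarrow> 0 + 0 + L"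
    using tendsto_add[OF tendsto_add[OF l1 l2] L] by simp
  then have "t 0 = L" by (simp add: LIMSEQ_const_iff)
  then show ?thesis using t(1)[of 0] by simp
qed

end

section \<open>Row- and column-finite bounded matrices\<close>

text \<open>An operator norm bound on square-summable families, tested on finite sections so that no
  infinite sums enter.\<close>

definition mbound :: "('j \<Rightarrow> 'j \<Rightarrow> complex) \<Rightarrow> real \<Rightarrow> bool" where
  "mbound M c \<longleftrightarrow> 0 \<le> c \<and> (\<forall>S T u. finite S \<longrightarrow> finite T \<longrightarrow>
     L2_set (\<lambda>s. cmod (\<Sum>t\<in>T. M s t * u t)) S \<le> c * L2_set (\<lambda>t. cmod (u t)) T)"

lemma mboundI:
  assumes "0 \<le> c" "\<And>S T u. finite S \<Longrightarrow> finite T \<Longrightarrow>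
     L2_set (\<lambda>s. cmod (\<Sum>t\<in>T. M s t * u t)) S \<le> c * L2_set (\<lambda>t. cmod (u t)) T"
  shows "mbound M c"
  using assms unfolding mbound_def by blast

lemma mboundD:
  "mbound M c \<Longrightarrow> finite S \<Longrightarrow> finite T \<Longrightarrow>
     L2_set (\<lambda>s. cmod (\<Sum>t\<in>T. M s t * u t)) S \<le> c * L2_set (\<lambda>t. cmod (u t)) T"
  unfolding mbound_def by blast

lemma mbound_add:
  fixes M :: "'j \<Rightarrow> 'j \<Rightarrow> complex"
  assumes "mbound M c" "mbound N d" shows "mbound (\<lambda>s t. M s t + N s t) (c + d)"
proof (rule mboundI)
  show "0 \<le> c + d" using assms unfolding mbound_def by simp
next
  fix S T :: "'j set" and u :: "'j \<Rightarrow> complex" assume fin: "finite S" "finite T"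
  have "L2_set (\<lambda>s. cmod (\<Sum>t\<in>T. (M s t + N s t) * u t)) S
     \<le> L2_set (\<lambda>s. cmod (\<Sum>t\<in>T. M s t * u t) + cmod (\<Sum>t\<in>T. N s t * u t)) S"
    by (intro L2_set_mono) (auto simp: distrib_right sum.distrib norm_triangle_ineq)
  also have "\<dots> \<le> L2_set (\<lambda>s. cmod (\<Sum>t\<in>T. M s t * u t)) S + L2_set (\<lambda>s. cmod (\<Sum>t\<in>T. N s t * u t)) S"
    by (rule L2_set_triangle_ineq)
  also have "\<dots> \<le> c * L2_set (\<lambda>t. cmod (u t)) T + d * L2_set (\<lambda>t. cmod (u t)) T"
    by (intro add_mono mboundD assms fin)
  finally show "L2_set (\<lambda>s. cmod (\<Sum>t\<in>T. (M s t + N s t) * u t)) S \<le> (c + d) * L2_set (\<lambda>t. cmod (u t)) T"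
    by (simp add: distrib_right)
qed

lemma mbound_scale:
  fixes M :: "'j \<Rightarrow> 'j \<Rightarrow> complex"
  assumes "mbound M c" shows "mbound (\<lambda>s t. a * M s t) (cmod a * c)"
proof (rule mboundI)
  show "0 \<le> cmod a * c" using assms unfolding mbound_def by simp
next
  fix S T :: "'j set" and u :: "'j \<Rightarrow> complex" assume fin: "finite S" "finite T"
  have "L2_set (\<lambda>s. cmod (\<Sum>t\<in>T. a * M s t * u t)) S = cmod a * L2_set (\<lambda>s. cmod (\<Sum>t\<in>T. M s t * u t)) S"
    by (simp add: L2_set_right_distrib mult.assoc norm_mult flip: sum_distrib_left)
  also have "\<dots> \<le> cmod a * (c * L2_set (\<lambda>t. cmod (u t)) T)"
    by (intro mult_left_mono mboundD assms fin) auto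
  finally show "L2_set (\<lambda>s. cmod (\<Sum>t\<in>T. a * M s t * u t)) S \<le> cmod a * c * L2_set (\<lambda>t. cmod (u t)) T"
    by (simp add: mult.assoc)
qed

text \<open>A crude Schur test: Cauchy-Schwarz along the rows costs a factor \<open>m\<close> in the
  squared norm, and counting nonzero entries along the columns costs another.\<close>

lemma mbound_schur:
  fixes M :: "'j \<Rightarrow> 'j \<Rightarrow> complex"
  assumes K: "\<And>s t. cmod (M s t) \<le> K"
    and row: "\<And>s. finite {t. M s t \<noteq> 0}" "\<And>s. card {t. M s t \<noteq> 0} \<le> m"
    and col: "\<And>t. finite {s. M s t \<noteq> 0}" "\<And>t. card {s. M s t \<noteq> 0} \<le> m"
  shows "mbound M (K * real m)"
proof (rule mboundI)
  have K0: "0 \<le> K" using K norm_ge_zero order_trans by blast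
  then show "0 \<le> K * real m" by simp
  fix S T :: "'j set" and u :: "'j \<Rightarrow> complex" assume fin: "finite S" "finite T"
  let ?n = "\<lambda>s t. if M s t \<noteq> 0 then (1::real) else 0"
  have bound: "(cmod (\<Sum>t\<in>T. M s t * u t))\<^sup>2 \<le> K\<^sup>2 * m * (\<Sum>t\<in>T. ?n s t * (cmod (u t))\<^sup>2)" for s
  proof -
    let ?N = "{t\<in>T. M s t \<noteq> 0}"
    have "cmod (\<Sum>t\<in>T. M s t * u t) = cmod (\<Sum>t\<in>?N. M s t * u t)"
      by (intro arg_cong[of _ _ cmod] sum.mono_neutral_right) (auto simp: fin)
    also have "\<dots> \<le> (\<Sum>t\<in>?N. K * cmod (u t))"
      by (intro sum_norm_le) (auto simp: norm_mult intro!: mult_right_mono K)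
    also have "\<dots> = K * (\<Sum>t\<in>?N. \<bar>1\<bar> * \<bar>cmod (u t)\<bar>)" by (simp add: sum_distrib_left)
    also have "\<dots> \<le> K * (L2_set (\<lambda>_. 1) ?N * L2_set (\<lambda>t. cmod (u t)) ?N)"
      by (intro mult_left_mono L2_set_mult_ineq K0)
    finally have "(cmod (\<Sum>t\<in>T. M s t * u t))\<^sup>2 \<le> (K * (L2_set (\<lambda>_. 1) ?N * L2_set (\<lambda>t. cmod (u t)) ?N))\<^sup>2"
      by (intro power_mono) auto
    also have "\<dots> = K\<^sup>2 * real (card ?N) * (\<Sum>t\<in>?N. (cmod (u t))\<^sup>2)"
      unfolding L2_set_def by (simp add: power_mult_distrib sum_nonneg)
    also have "\<dots> \<le> K\<^sup>2 * real m * (\<Sum>t\<in>?N. (cmod (u t))\<^sup>2)"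
    proof -
      have "card ?N \<le> m" using card_mono[OF row(1)[of s], of ?N] row(2)[of s] by fastforce
      then show ?thesis by (intro mult_right_mono mult_left_mono sum_nonneg) auto
    qed
    also have "(\<Sum>t\<in>?N. (cmod (u t))\<^sup>2) = (\<Sum>t\<in>T. ?n s t * (cmod (u t))\<^sup>2)"
      unfolding sum.inter_filter[OF fin(2)] by (intro sum.cong) auto
    finally show ?thesis .
  qed
  have "(\<Sum>s\<in>S. (cmod (\<Sum>t\<in>T. M s t * u t))\<^sup>2) \<le> (\<Sum>s\<in>S. K\<^sup>2 * m * (\<Sum>t\<in>T. ?n s t * (cmod (u t))\<^sup>2))"
    by (intro sum_mono bound)
  also have "\<dots> = K\<^sup>2 * m * (\<Sum>t\<in>T. (\<Sum>s\<in>S. ?n s t) * (cmod (u t))\<^sup>2)"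
  proof -
    have "(\<Sum>s\<in>S. \<Sum>t\<in>T. ?n s t * (cmod (u t))\<^sup>2) = (\<Sum>t\<in>T. (\<Sum>s\<in>S. ?n s t) * (cmod (u t))\<^sup>2)"
      by (subst sum.swap) (simp only: sum_distrib_right)
    then show ?thesis by (simp only: sum_distrib_left[symmetric])
  qed
  also have "\<dots> \<le> K\<^sup>2 * m * (\<Sum>t\<in>T. real m * (cmod (u t))\<^sup>2)"
  proof (intro mult_left_mono sum_mono mult_right_mono)
    fix t
    have "(\<Sum>s\<in>S. ?n s t) = real (card {s\<in>S. M s t \<noteq> 0})"
      by (simp add: fin flip: sum.inter_filter)
    also have "\<dots> \<le> real m"
      using card_mono[OF col(1)[of t], of "{s\<in>S. M s t \<noteq> 0}"] col(2)[of t] by fastforce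
    finally show "(\<Sum>s\<in>S. ?n s t) \<le> real m" .
  qed auto
  also have "\<dots> = (K * m)\<^sup>2 * (\<Sum>t\<in>T. (cmod (u t))\<^sup>2)"
    by (simp add: power2_eq_square sum_distrib_left mult_ac)
  finally have "sqrt (\<Sum>s\<in>S. (cmod (\<Sum>t\<in>T. M s t * u t))\<^sup>2) \<le> sqrt ((K * m)\<^sup>2 * (\<Sum>t\<in>T. (cmod (u t))\<^sup>2))"
    by (rule real_sqrt_le_mono)
  then show "L2_set (\<lambda>s. cmod (\<Sum>t\<in>T. M s t * u t)) S \<le> K * real m * L2_set (\<lambda>t. cmod (u t)) T"
    unfolding L2_set_def using K0 by (simp add: real_sqrt_mult)
qed

text \<open>Duality: if \<open>w\<close> is the image of \<open>u\<close> under the adjoint, then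
  the squared norm of \<open>w\<close> is the pairing of \<open>M w\<close> with \<open>u\<close>,
  hence at most \<open>c\<close> times the norms of \<open>w\<close> and \<open>u\<close>; one norm
  of \<open>w\<close> cancels.\<close>

lemma mbound_adj:
  fixes M :: "'j \<Rightarrow> 'j \<Rightarrow> complex"
  assumes "mbound M c" shows "mbound (\<lambda>s t. cnj (M t s)) c"
proof (rule mboundI)
  show "0 \<le> c" using assms unfolding mbound_def by simp
  fix S T :: "'j set" and u :: "'j \<Rightarrow> complex" assume fin: "finite S" "finite T"
  define w where "w s = (\<Sum>t\<in>T. cnj (M t s) * u t)" for s
  let ?W = "L2_set (\<lambda>s. cmod (w s)) S" and ?u = "L2_set (\<lambda>t. cmod (u t)) T"
  have "complex_of_real (?W\<^sup>2) = (\<Sum>s\<in>S. cnj (w s) * w s)"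
    unfolding L2_set_def by (simp add: sum_nonneg complex_norm_square[symmetric] mult.commute)
  also have "\<dots> = (\<Sum>s\<in>S. \<Sum>t\<in>T. cnj (w s) * (cnj (M t s) * u t))"
    unfolding w_def by (simp add: sum_distrib_left)
  also have "\<dots> = (\<Sum>t\<in>T. cnj (\<Sum>s\<in>S. M t s * w s) * u t)"
    by (subst sum.swap) (simp add: sum_distrib_left mult_ac)
  finally have "?W\<^sup>2 = cmod (\<Sum>t\<in>T. cnj (\<Sum>s\<in>S. M t s * w s) * u t)"
    by (metis norm_of_real abs_of_nonneg zero_le_power2)
  also have "\<dots> \<le> (\<Sum>t\<in>T. \<bar>cmod (\<Sum>s\<in>S. M t s * w s)\<bar> * \<bar>cmod (u t)\<bar>)"
    by (rule sum_norm_le) (simp only: norm_mult complex_mod_cnj abs_norm_cancel order_refl)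
  also have "\<dots> \<le> L2_set (\<lambda>t. cmod (\<Sum>s\<in>S. M t s * w s)) T * ?u"
    by (rule L2_set_mult_ineq)
  also have "\<dots> \<le> c * ?W * ?u"
    by (intro mult_right_mono mboundD[OF assms] fin) auto
  finally have "?W * ?W \<le> ?W * (c * ?u)" by (simp add: power2_eq_square mult_ac)
  then have "?W \<le> c * ?u \<or> ?W = 0"
    using mult_left_le_imp_le[of ?W ?W "c * ?u"] by (metis L2_set_nonneg order_le_less)
  then show "L2_set (\<lambda>s. cmod (\<Sum>t\<in>T. cnj (M t s) * u t)) S \<le> c * ?u"
    using \<open>0 \<le> c\<close> unfolding w_def by auto
qed

text \<open>Finite rows turn products and the application to arbitrary functions into finite sums;
  finite columns let adjoints stay in the type. The price is that the resulting normed algebra need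
  not be complete.\<close>

typedef 'j bmat = "{M :: 'j \<Rightarrow> 'j \<Rightarrow> complex. (\<forall>s. finite {t. M s t \<noteq> 0}) \<and> (\<forall>t. finite {s. M s t \<noteq> 0})
    \<and> (\<exists>c. mbound M c)}" morphisms ent Bmat
proof
  show "(\<lambda>_ _. 0) \<in> {M :: 'j \<Rightarrow> 'j \<Rightarrow> complex. (\<forall>s. finite {t. M s t \<noteq> 0}) \<and> (\<forall>t. finite {s. M s t \<noteq> 0})
    \<and> (\<exists>c. mbound M c)}"
    using mbound_schur[of "\<lambda>_ _. 0" 0 0] by auto
qed

setup_lifting type_definition_bmat

lemma ent_row: "finite {t. ent M s t \<noteq> 0}" and ent_col: "finite {s. ent M s t \<noteq> 0}"
  using ent[of M] by auto

lemma bmat_eqI: "(\<And>s t. ent M s t = ent N s t) \<Longrightarrow> M = N"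
  using ent_inject[of M N] by blast

text \<open>Column finiteness of \<open>N\<close> makes the image of a vector supported on
  \<open>T\<close> supported on a finite set \<open>K\<close>, to which the bound for
  \<open>M\<close> applies. The product enters through its sums over all large enough finite sets,
  so that the lemma can serve in the very definition of multiplication.\<close>

lemma mbound_mult:
  fixes M :: "'j \<Rightarrow> 'j \<Rightarrow> complex"
  assumes "mbound M c" "mbound N d" "\<And>t. finite {k. N k t \<noteq> 0}"
    and P: "\<And>s t K. finite K \<Longrightarrow> {k. N k t \<noteq> 0} \<subseteq> K \<Longrightarrow> P s t = (\<Sum>k\<in>K. M s k * N k t)"
  shows "mbound P (c * d)"
proof (rule mboundI)
  show cd: "0 \<le> c * d" using assms unfolding mbound_def by simp
  fix S T :: "'j set" and u :: "'j \<Rightarrow> complex" assume fin: "finite S" "finite T"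
  define K where "K = (\<Union>t\<in>T. {k. N k t \<noteq> 0})"
  have K: "finite K" unfolding K_def using fin assms(3) by auto
  have "(\<Sum>t\<in>T. P s t * u t) = (\<Sum>k\<in>K. M s k * (\<Sum>t\<in>T. N k t * u t))" for s
  proof -
    have "(\<Sum>t\<in>T. P s t * u t) = (\<Sum>t\<in>T. (\<Sum>k\<in>K. M s k * N k t) * u t)"
      by (intro sum.cong refl arg_cong2[of _ _ _ _ "(*)"] P K) (auto simp: K_def)
    also have "\<dots> = (\<Sum>k\<in>K. M s k * (\<Sum>t\<in>T. N k t * u t))"
      by (simp add: sum_distrib_left sum_distrib_right mult.assoc) (rule sum.swap)
    finally show ?thesis .
  qed
  then have "L2_set (\<lambda>s. cmod (\<Sum>t\<in>T. P s t * u t)) S \<le> c * L2_set (\<lambda>k. cmod (\<Sum>t\<in>T. N k t * u t)) K"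
    using mboundD[OF assms(1) fin(1) K] by simp
  also have "\<dots> \<le> c * (d * L2_set (\<lambda>t. cmod (u t)) T)"
    using assms(1) by (intro mult_left_mono mboundD[OF assms(2)] K fin) (simp add: mbound_def)
  finally show "L2_set (\<lambda>s. cmod (\<Sum>t\<in>T. P s t * u t)) S \<le> c * d * L2_set (\<lambda>t. cmod (u t)) T"
    by (simp add: mult.assoc)
qed

instantiation bmat :: (type) ring_1
begin

lift_definition zero_bmat :: "'a bmat" is "\<lambda>_ _. 0"
  using mbound_schur[of "\<lambda>_ _. 0" 0 0] by auto

lift_definition one_bmat :: "'a bmat" is "\<lambda>s t. if s = t then 1 else 0"
proof -
  have "{t. (if s = t then 1 else 0) \<noteq> (0::complex)} = {s}"
    "{t. (if t = s then 1 else 0) \<noteq> (0::complex)} = {s}" for s :: 'a by auto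
  then show "(\<forall>s::'a. finite {t. (if s = t then 1 else 0) \<noteq> (0::complex)}) \<and>
    (\<forall>t::'a. finite {s. (if s = t then 1 else 0) \<noteq> (0::complex)}) \<and> (\<exists>c. mbound (\<lambda>s t::'a. if s = t then 1 else 0) c)"
    using mbound_schur[of "\<lambda>s t::'a. if s = t then 1 else 0" 1 1] by force
qed

lift_definition plus_bmat :: "'a bmat \<Rightarrow> 'a bmat \<Rightarrow> 'a bmat" is "\<lambda>M N s t. M s t + N s t"
proof -
  fix M N :: "'a \<Rightarrow> 'a \<Rightarrow> complex"
  assume M: "(\<forall>s. finite {t. M s t \<noteq> 0}) \<and> (\<forall>t. finite {s. M s t \<noteq> 0}) \<and> (\<exists>c. mbound M c)"
    and N: "(\<forall>s. finite {t. N s t \<noteq> 0}) \<and> (\<forall>t. finite {s. N s t \<noteq> 0}) \<and> (\<exists>c. mbound N c)"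
  have "finite {t. M s t + N s t \<noteq> 0}" for s
    by (rule finite_subset[of _ "{t. M s t \<noteq> 0} \<union> {t. N s t \<noteq> 0}"]) (use M N in auto)
  moreover have "finite {s. M s t + N s t \<noteq> 0}" for t
    by (rule finite_subset[of _ "{s. M s t \<noteq> 0} \<union> {s. N s t \<noteq> 0}"]) (use M N in auto)
  ultimately show "(\<forall>s. finite {t. M s t + N s t \<noteq> 0}) \<and> (\<forall>t. finite {s. M s t + N s t \<noteq> 0}) \<and> (\<exists>c. mbound (\<lambda>s t. M s t + N s t) c)"
    using M N mbound_add by blast
qed

lift_definition uminus_bmat :: "'a bmat \<Rightarrow> 'a bmat" is "\<lambda>M s t. - M s t"
proof -
  fix M :: "'a \<Rightarrow> 'a \<Rightarrow> complex"
  assume M: "(\<forall>s. finite {t. M s t \<noteq> 0}) \<and> (\<forall>t. finite {s. M s t \<noteq> 0}) \<and> (\<exists>c. mbound M c)"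
  then show "(\<forall>s. finite {t. - M s t \<noteq> 0}) \<and> (\<forall>t. finite {s. - M s t \<noteq> 0}) \<and> (\<exists>c. mbound (\<lambda>s t. - M s t) c)"
    using mbound_scale[of M _ "-1"] by auto
qed

definition minus_bmat :: "'a bmat \<Rightarrow> 'a bmat \<Rightarrow> 'a bmat" where
  "minus_bmat M N = M + - N"

lift_definition times_bmat :: "'a bmat \<Rightarrow> 'a bmat \<Rightarrow> 'a bmat"
  is "\<lambda>M N s t. \<Sum>k\<in>{k. M s k \<noteq> 0}. M s k * N k t"
proof -
  fix M N :: "'a \<Rightarrow> 'a \<Rightarrow> complex"
  assume M: "(\<forall>s. finite {t. M s t \<noteq> 0}) \<and> (\<forall>t. finite {s. M s t \<noteq> 0}) \<and> (\<exists>c. mbound M c)"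
    and N: "(\<forall>s. finite {t. N s t \<noteq> 0}) \<and> (\<forall>t. finite {s. N s t \<noteq> 0}) \<and> (\<exists>c. mbound N c)"
  let ?P = "\<lambda>s t. \<Sum>k\<in>{k. M s k \<noteq> 0}. M s k * N k t"
  have nz: "\<exists>k. M s k \<noteq> 0 \<and> N k t \<noteq> 0" if "?P s t \<noteq> 0" for s t
    using sum.not_neutral_contains_not_neutral[OF that] by auto
  have h1: "finite {t. ?P s t \<noteq> 0}" for s
  proof (rule finite_subset)
    show "{t. ?P s t \<noteq> 0} \<subseteq> (\<Union>k\<in>{k. M s k \<noteq> 0}. {t. N k t \<noteq> 0})" using nz by blast
  qed (use M N in simp)
  have h2: "finite {s. ?P s t \<noteq> 0}" for t
  proof (rule finite_subset)
    show "{s. ?P s t \<noteq> 0} \<subseteq> (\<Union>k\<in>{k. N k t \<noteq> 0}. {s. M s k \<noteq> 0})" using nz by blast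
  qed (use M N in simp)
  have h3: "\<exists>c. mbound ?P c"
  proof -
    obtain c d where cd: "mbound M c" "mbound N d" using M N by blast
    have "?P s t = (\<Sum>k\<in>K. M s k * N k t)" if "finite K" "{k. N k t \<noteq> 0} \<subseteq> K" for s t K
      by (rule sum.mono_neutral_cong) (use that M in auto)
    then have "mbound ?P (c * d)" using mbound_mult[OF cd, of ?P] N by simp
    then show ?thesis ..
  qed
  show "(\<forall>s. finite {t. ?P s t \<noteq> 0}) \<and> (\<forall>t. finite {s. ?P s t \<noteq> 0}) \<and> (\<exists>c. mbound ?P c)"
    by (intro conjI allI h1 h2 h3)
qed

lemma ent_mult_sum:
  "finite K \<Longrightarrow> {k. ent M s k \<noteq> 0 \<and> ent N k t \<noteq> 0} \<subseteq> K \<Longrightarrow> ent (M * N) s t = (\<Sum>k\<in>K. ent M s k * ent N k t)"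
  unfolding times_bmat.rep_eq using ent_row[of M s] by (intro sum.mono_neutral_cong) auto

instance
proof
  fix a b c :: "'a bmat"
  show "a + b + c = a + (b + c)" "a + b = b + a" "0 + a = a" "- a + a = 0" "a - b = a + - b"
    by (rule bmat_eqI; simp add: plus_bmat.rep_eq zero_bmat.rep_eq uminus_bmat.rep_eq minus_bmat_def)+
  show "(0::'a bmat) \<noteq> 1"
    by transfer (metis zero_neq_one)
  show "1 * a = a"
    by (rule bmat_eqI) (subst ent_mult_sum[of "{_}"], auto simp: one_bmat.rep_eq split: if_splits)
  show "a * 1 = a"
    by (rule bmat_eqI) (subst ent_mult_sum[of "{_}"], auto simp: one_bmat.rep_eq split: if_splits)
  show "(a + b) * c = a * c + b * c"
  proof (rule bmat_eqI)
    fix s t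
    let ?K = "{k. ent a s k \<noteq> 0} \<union> {k. ent b s k \<noteq> 0}"
    have K: "finite ?K" by (intro finite_UnI ent_row)
    show "ent ((a + b) * c) s t = ent (a * c + b * c) s t"
      unfolding plus_bmat.rep_eq
      by (subst (1 2 3) ent_mult_sum[OF K]) (auto simp: plus_bmat.rep_eq distrib_right sum.distrib)
  qed
  show "a * (b + c) = a * b + a * c"
  proof (rule bmat_eqI)
    fix s t
    let ?K = "{k. ent a s k \<noteq> 0}"
    have K: "finite ?K" by (rule ent_row)
    show "ent (a * (b + c)) s t = ent (a * b + a * c) s t"
      unfolding plus_bmat.rep_eq
      by (subst (1 2 3) ent_mult_sum[OF K]) (auto simp: plus_bmat.rep_eq distrib_left sum.distrib)
  qed
  show "a * b * c = a * (b * c)"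
  proof (rule bmat_eqI)
    fix s t
    define L where "L = {l. ent a s l \<noteq> 0}"
    define K where "K = (\<Union>l\<in>L. {k. ent b l k \<noteq> 0})"
    have L: "finite L" unfolding L_def by (rule ent_row)
    have K: "finite K" unfolding K_def by (intro finite_UN_I L ent_row)
    have ab: "ent (a * b) s k = (\<Sum>l\<in>L. ent a s l * ent b l k)" for k
      by (rule ent_mult_sum[OF L]) (auto simp: L_def)
    have bc: "ent (b * c) l t = (\<Sum>k\<in>K. ent b l k * ent c k t)" if "l \<in> L" for l
      by (rule ent_mult_sum[OF K]) (use that in \<open>auto simp: K_def\<close>)
    have "ent (a * b * c) s t = (\<Sum>k\<in>K. ent (a * b) s k * ent c k t)"
    proof (rule ent_mult_sum[OF K], rule subsetI)
      fix k assume "k \<in> {k. ent (a * b) s k \<noteq> 0 \<and> ent c k t \<noteq> 0}"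
      then have "(\<Sum>l\<in>L. ent a s l * ent b l k) \<noteq> 0" using ab by auto
      then obtain l where "l \<in> L" "ent a s l * ent b l k \<noteq> 0" by (rule sum.not_neutral_contains_not_neutral)
      then show "k \<in> K" unfolding K_def by auto
    qed
    also have "\<dots> = (\<Sum>l\<in>L. ent a s l * (\<Sum>k\<in>K. ent b l k * ent c k t))"
      unfolding ab by (simp add: sum_distrib_left sum_distrib_right mult.assoc) (rule sum.swap)
    also have "\<dots> = (\<Sum>l\<in>L. ent a s l * ent (b * c) l t)" using bc by simp
    also have "\<dots> = ent (a * (b * c)) s t"
      by (rule ent_mult_sum[OF L, symmetric]) (auto simp: L_def)
    finally show "ent (a * b * c) s t = ent (a * (b * c)) s t" .
  qed
qed

end

lemma ent_simps [simp]:
  "ent 0 s t = 0" "ent (M + N) s t = ent M s t + ent N s t" "ent (- M) s t = - ent M s t"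
  "ent (M - N) s t = ent M s t - ent N s t" "ent 1 s t = (if s = t then 1 else 0)"
  by (simp_all only: zero_bmat.rep_eq plus_bmat.rep_eq uminus_bmat.rep_eq one_bmat.rep_eq minus_bmat_def diff_conv_add_uminus)

instantiation bmat :: (type) real_vector
begin

lift_definition scaleR_bmat :: "real \<Rightarrow> 'a bmat \<Rightarrow> 'a bmat" is "\<lambda>r M s t. complex_of_real r * M s t"
proof -
  fix r and M :: "'a \<Rightarrow> 'a \<Rightarrow> complex"
  assume M: "(\<forall>s. finite {t. M s t \<noteq> 0}) \<and> (\<forall>t. finite {s. M s t \<noteq> 0}) \<and> (\<exists>c. mbound M c)"
  then show "(\<forall>s. finite {t. complex_of_real r * M s t \<noteq> 0}) \<and> (\<forall>t. finite {s. complex_of_real r * M s t \<noteq> 0})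
      \<and> (\<exists>c. mbound (\<lambda>s t. complex_of_real r * M s t) c)"
    using mbound_scale[of M _ "complex_of_real r"] by auto
qed

instance
proof
  fix x y :: "'a bmat" and a b :: real
  show "a *\<^sub>R (x + y) = a *\<^sub>R x + a *\<^sub>R y" "(a + b) *\<^sub>R x = a *\<^sub>R x + b *\<^sub>R x"
    "a *\<^sub>R b *\<^sub>R x = (a * b) *\<^sub>R x" "1 *\<^sub>R x = x"
    by (rule bmat_eqI; simp add: scaleR_bmat.rep_eq algebra_simps)+
qed

end

lemma ent_scaleR [simp]: "ent (r *\<^sub>R M) s t = complex_of_real r * ent M s t"
  by (simp add: scaleR_bmat.rep_eq)

instantiation bmat :: (type) real_normed_algebra_1
begin

definition norm_bmat :: "'a bmat \<Rightarrow> real" where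
  "norm_bmat M = Inf {c. mbound (ent M) c}"

definition dist_bmat :: "'a bmat \<Rightarrow> 'a bmat \<Rightarrow> real" where
  "dist_bmat M N = norm (M - N)"

definition sgn_bmat :: "'a bmat \<Rightarrow> 'a bmat" where
  "sgn_bmat M = M /\<^sub>R norm M"

definition uniformity_bmat :: "('a bmat \<times> 'a bmat) filter" where
  "uniformity_bmat = (INF e\<in>{0<..}. principal {(x, y). dist x y < e})"

definition open_bmat :: "'a bmat set \<Rightarrow> bool" where
  "open_bmat U \<longleftrightarrow> (\<forall>x\<in>U. eventually (\<lambda>(x', y). x' = x \<longrightarrow> y \<in> U) uniformity)"

lemma norm_bmat_le: "mbound (ent M) c \<Longrightarrow> norm M \<le> c"
  unfolding norm_bmat_def by (rule cInf_lower) (auto intro!: bdd_belowI[of _ 0] simp: mbound_def)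

text \<open>The infimum is attained because every defining inequality is a closed condition on the
  bound.\<close>

lemma mbound_norm: "mbound (ent M) (norm M)"
proof (rule mboundI)
  have ex: "{c. mbound (ent M) c} \<noteq> {}" using ent[of M] by auto
  show "0 \<le> norm M" unfolding norm_bmat_def
    by (rule cInf_greatest[OF ex]) (auto simp: mbound_def)
  fix S T :: "'a set" and u :: "'a \<Rightarrow> complex" assume fin: "finite S" "finite T"
  let ?y = "L2_set (\<lambda>s. cmod (\<Sum>t\<in>T. ent M s t * u t)) S" and ?x = "L2_set (\<lambda>t. cmod (u t)) T"
  have le: "?y \<le> c * ?x" if "mbound (ent M) c" for c by (rule mboundD[OF that fin])
  show "?y \<le> norm M * ?x"
  proof (cases "?x = 0")
    case True
    then show ?thesis using le ex by auto
  next
    case False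
    then have x: "?x > 0" using L2_set_nonneg[of "\<lambda>t. cmod (u t)" T] by linarith
    have "?y / ?x \<le> norm M" unfolding norm_bmat_def
      by (rule cInf_greatest[OF ex]) (use le x in \<open>auto simp: divide_le_eq\<close>)
    then show ?thesis using x by (simp add: divide_le_eq)
  qed
qed

lemma norm_ent: "cmod (ent M s t) \<le> norm M"
  using mboundD[OF mbound_norm, of "{s}" "{t}" M "\<lambda>_. 1"] by (simp add: L2_set_def)

instance
proof
  fix x y z :: "'a bmat" and a b :: real
  show "dist x y = norm (x - y)" by (rule dist_bmat_def)
  show "sgn x = x /\<^sub>R norm x" by (rule sgn_bmat_def)
  show "uniformity = (INF e\<in>{0<..}. principal {(x, y :: 'a bmat). dist x y < e})"
    by (rule uniformity_bmat_def)
  show "open U = (\<forall>x\<in>U. \<forall>\<^sub>F (x', y) in uniformity. x' = x \<longrightarrow> y \<in> U)" for U :: "'a bmat set"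
    by (rule open_bmat_def)
  show "a *\<^sub>R x * y = a *\<^sub>R (x * y)"
  proof (rule bmat_eqI)
    fix s t
    have K: "finite {k. ent x s k \<noteq> 0}" by (rule ent_row)
    show "ent (a *\<^sub>R x * y) s t = ent (a *\<^sub>R (x * y)) s t"
      unfolding scaleR_bmat.rep_eq
      by (subst (1 2) ent_mult_sum[OF K]) (auto simp: scaleR_bmat.rep_eq sum_distrib_left mult_ac)
  qed
  show "x * a *\<^sub>R y = a *\<^sub>R (x * y)"
  proof (rule bmat_eqI)
    fix s t
    have K: "finite {k. ent x s k \<noteq> 0}" by (rule ent_row)
    show "ent (x * a *\<^sub>R y) s t = ent (a *\<^sub>R (x * y)) s t"
      unfolding scaleR_bmat.rep_eq
      by (subst (1 2) ent_mult_sum[OF K]) (auto simp: scaleR_bmat.rep_eq sum_distrib_left mult_ac)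
  qed
  show "norm (x + y) \<le> norm x + norm y"
    by (rule norm_bmat_le) (use mbound_add[OF mbound_norm mbound_norm] in \<open>simp add: plus_bmat.rep_eq\<close>)
  have sc: "norm (a *\<^sub>R x) \<le> \<bar>a\<bar> * norm x" for a and x :: "'a bmat"
    by (rule norm_bmat_le) (use mbound_scale[OF mbound_norm, of "complex_of_real a" x] in \<open>simp add: scaleR_bmat.rep_eq\<close>)
  show "norm (a *\<^sub>R x) = \<bar>a\<bar> * norm x"
  proof (cases "a = 0")
    case True
    then show ?thesis using sc[of 0 x] mbound_norm[of "0 *\<^sub>R x"] unfolding mbound_def by simp
  next
    case False
    have "x = inverse a *\<^sub>R (a *\<^sub>R x)"
      by (rule bmat_eqI) (use False in \<open>simp add: scaleR_bmat.rep_eq\<close>)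
    then have "norm x \<le> \<bar>inverse a\<bar> * norm (a *\<^sub>R x)" using sc by metis
    then have "\<bar>a\<bar> * norm x \<le> norm (a *\<^sub>R x)" using False by (simp add: field_simps)
    then show ?thesis using sc[of a x] by simp
  qed
  show "(norm x = 0) = (x = 0)"
  proof
    assume "norm x = 0"
    then show "x = 0" using norm_ent[of x] by (intro bmat_eqI) simp
  next
    assume "x = 0"
    then have "mbound (ent x) 0" using mbound_schur[of "ent x" 0 0] by simp
    then show "norm x = 0" using norm_bmat_le[of x 0] mbound_norm[of x] unfolding mbound_def by simp
  qed
  show "norm (x * y) \<le> norm x * norm y"
    by (rule norm_bmat_le, rule mbound_mult[OF mbound_norm mbound_norm ent_col]) (auto intro: ent_mult_sum)
  show "norm (1 :: 'a bmat) = 1"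
  proof (rule antisym)
    have "{t. (if s = t then 1 else 0) \<noteq> (0::complex)} = {s}"
      "{t. (if t = s then 1 else 0) \<noteq> (0::complex)} = {s}" for s :: 'a by auto
    then have "mbound (ent (1 :: 'a bmat)) 1"
      using mbound_schur[of "ent (1 :: 'a bmat)" 1 1] by simp
    then show "norm (1 :: 'a bmat) \<le> 1" by (rule norm_bmat_le)
    show "1 \<le> norm (1 :: 'a bmat)" using norm_ent[of 1 undefined undefined] by simp
  qed
qed

end

lift_definition adj :: "'a bmat \<Rightarrow> 'a bmat" is "\<lambda>M s t. cnj (M t s)"
  using mbound_adj by fastforce

lemma ent_adj [simp]: "ent (adj M) s t = cnj (ent M t s)"
  by (simp add: adj.rep_eq)

lemma adj_mult: "adj (M * N) = adj N * adj M"
proof (rule bmat_eqI)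
  fix s t
  have K: "finite {k. ent N k s \<noteq> 0}" by (rule ent_col)
  show "ent (adj (M * N)) s t = ent (adj N * adj M) s t"
    unfolding ent_adj
    by (subst (1 2) ent_mult_sum[OF K]) (auto simp: mult.commute)
qed

lemma adj_add: "adj (M + N) = adj M + adj N" and adj_diff: "adj (M - N) = adj M - adj N"
  and adj_one: "adj 1 = 1" and adj_adj: "adj (adj M) = M"
  by (rule bmat_eqI; simp)+

section \<open>Equivariant matrices and their trace\<close>

text \<open>On each class of \<open>\<kappa>\<close> the map \<open>\<gamma>\<close> is injective,
  so the block there is a relabelled submatrix of \<open>M\<close>; the squared norms over the
  blocks add up.\<close>

lemma mbound_bpull:
  fixes M :: "'b \<Rightarrow> 'b \<Rightarrow> complex" and \<kappa> :: "'a \<Rightarrow> 'k" and \<gamma> :: "'a \<Rightarrow> 'b"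
  assumes inj: "inj_on (\<lambda>x. (\<kappa> x, \<gamma> x)) S" and M: "mbound M c"
  shows "mbound (\<lambda>x y. if x \<in> S \<and> y \<in> S \<and> \<kappa> x = \<kappa> y then M (\<gamma> x) (\<gamma> y) else 0) c"
proof (rule mboundI)
  show c0: "0 \<le> c" using M unfolding mbound_def by simp
  fix A T :: "'a set" and u :: "'a \<Rightarrow> complex" assume fin: "finite A" "finite T"
  define P where "P = (\<lambda>x y. if x \<in> S \<and> y \<in> S \<and> \<kappa> x = \<kappa> y then M (\<gamma> x) (\<gamma> y) else 0)"
  define f where "f x = (\<Sum>y\<in>T. P x y * u y)" for x
  define Ak where "Ak k = {x\<in>A \<inter> S. \<kappa> x = k}" for k
  define Tk where "Tk k = {x\<in>T \<inter> S. \<kappa> x = k}" for k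
  have blk: "(\<Sum>x\<in>Ak k. (cmod (f x))\<^sup>2) \<le> c\<^sup>2 * (\<Sum>y\<in>Tk k. (cmod (u y))\<^sup>2)" for k
  proof -
    have finA: "finite (Ak k)" and finT: "finite (Tk k)" unfolding Ak_def Tk_def using fin by auto
    have iA: "inj_on \<gamma> (Ak k)" and iT: "inj_on \<gamma> (Tk k)"
      using inj unfolding Ak_def Tk_def inj_on_def by auto
    define v where "v q = u (inv_into (Tk k) \<gamma> q)" for q
    have v: "v (\<gamma> y) = u y" if "y \<in> Tk k" for y unfolding v_def using iT that by simp
    have f: "f x = (\<Sum>q\<in>\<gamma> ` Tk k. M (\<gamma> x) q * v q)" if "x \<in> Ak k" for x
    proof -
      have "f x = (\<Sum>y\<in>Tk k. M (\<gamma> x) (\<gamma> y) * u y)"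
        unfolding f_def P_def
        by (rule sum.mono_neutral_cong_right) (use that fin in \<open>auto simp: Tk_def Ak_def\<close>)
      then show ?thesis by (simp add: sum.reindex[OF iT] v)
    qed
    have "L2_set (\<lambda>p. cmod (\<Sum>q\<in>\<gamma> ` Tk k. M p q * v q)) (\<gamma> ` Ak k) \<le> c * L2_set (\<lambda>q. cmod (v q)) (\<gamma> ` Tk k)"
      by (rule mboundD[OF M]) (use finA finT in auto)
    then have "(L2_set (\<lambda>p. cmod (\<Sum>q\<in>\<gamma> ` Tk k. M p q * v q)) (\<gamma> ` Ak k))\<^sup>2 \<le> (c * L2_set (\<lambda>q. cmod (v q)) (\<gamma> ` Tk k))\<^sup>2"
      by (intro power_mono) auto
    then show ?thesis
      unfolding L2_set_def power_mult_distrib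
      by (simp add: sum_nonneg sum.reindex[OF iA] sum.reindex[OF iT] v f)
  qed
  let ?K = "\<kappa> ` (A \<inter> S) \<union> \<kappa> ` (T \<inter> S)"
  have "(\<Sum>x\<in>A. (cmod (f x))\<^sup>2) = (\<Sum>x\<in>A \<inter> S. (cmod (f x))\<^sup>2)"
    by (rule sum.mono_neutral_right) (use fin in \<open>auto simp: f_def P_def\<close>)
  also have "\<dots> = (\<Sum>k\<in>?K. \<Sum>x\<in>Ak k. (cmod (f x))\<^sup>2)"
    unfolding Ak_def by (rule sum.group[symmetric]) (use fin in auto)
  also have "\<dots> \<le> (\<Sum>k\<in>?K. c\<^sup>2 * (\<Sum>y\<in>Tk k. (cmod (u y))\<^sup>2))" by (intro sum_mono blk)
  also have "\<dots> = c\<^sup>2 * (\<Sum>y\<in>T \<inter> S. (cmod (u y))\<^sup>2)"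
    unfolding Tk_def sum_distrib_left[symmetric]
    by (rule arg_cong[of _ _ "(*) (c\<^sup>2)"], rule sum.group) (use fin in auto)
  also have "\<dots> \<le> c\<^sup>2 * (\<Sum>y\<in>T. (cmod (u y))\<^sup>2)"
    by (intro mult_left_mono sum_mono2) (use fin in auto)
  finally have "sqrt (\<Sum>x\<in>A. (cmod (f x))\<^sup>2) \<le> sqrt (c\<^sup>2 * (\<Sum>y\<in>T. (cmod (u y))\<^sup>2))"
    by (rule real_sqrt_le_mono)
  then show "L2_set (\<lambda>s. cmod (\<Sum>t\<in>T. (if s \<in> S \<and> t \<in> S \<and> \<kappa> s = \<kappa> t then M (\<gamma> s) (\<gamma> t) else 0) * u t)) A
      \<le> c * L2_set (\<lambda>t. cmod (u t)) T"
    unfolding L2_set_def f_def P_def using c0 by (simp add: real_sqrt_mult)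
qed

text \<open>The block-diagonal matrix on \<open>S\<close> with one copy of \<open>M\<close>, read through \<open>\<gamma>\<close>, for each value of \<open>\<kappa>\<close>.\<close>

definition bpull :: "'a set \<Rightarrow> ('a \<Rightarrow> 'k) \<Rightarrow> ('a \<Rightarrow> 'b) \<Rightarrow> 'b bmat \<Rightarrow> 'a bmat" where
  "bpull S \<kappa> \<gamma> M = Bmat (\<lambda>x y. if x \<in> S \<and> y \<in> S \<and> \<kappa> x = \<kappa> y then ent M (\<gamma> x) (\<gamma> y) else 0)"

context
  fixes S :: "'a set" and \<kappa> :: "'a \<Rightarrow> 'k" and \<gamma> :: "'a \<Rightarrow> 'b"
  assumes inj: "inj_on (\<lambda>x. (\<kappa> x, \<gamma> x)) S"
begin

lemma ent_bpull: "ent (bpull S \<kappa> \<gamma> M) x y = (if x \<in> S \<and> y \<in> S \<and> \<kappa> x = \<kappa> y then ent M (\<gamma> x) (\<gamma> y) else 0)"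
proof -
  let ?P = "\<lambda>x y. if x \<in> S \<and> y \<in> S \<and> \<kappa> x = \<kappa> y then ent M (\<gamma> x) (\<gamma> y) else 0"
  have row: "finite {y. ?P x y \<noteq> 0}" for x
  proof (rule inj_on_finite)
    show "inj_on \<gamma> {y. ?P x y \<noteq> 0}" using inj unfolding inj_on_def by (auto split: if_splits)
    show "\<gamma> ` {y. ?P x y \<noteq> 0} \<subseteq> {q. ent M (\<gamma> x) q \<noteq> 0}" by auto
  qed (rule ent_row)
  have col: "finite {y. ?P y x \<noteq> 0}" for x
  proof (rule inj_on_finite)
    show "inj_on \<gamma> {y. ?P y x \<noteq> 0}" using inj unfolding inj_on_def by (auto split: if_splits)
    show "\<gamma> ` {y. ?P y x \<noteq> 0} \<subseteq> {q. ent M q (\<gamma> x) \<noteq> 0}" by auto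
  qed (rule ent_col)
  have "\<exists>c. mbound ?P c" using mbound_bpull[OF inj mbound_norm] by blast
  then have "?P \<in> {M. (\<forall>s. finite {t. M s t \<noteq> 0}) \<and> (\<forall>t. finite {s. M s t \<noteq> 0}) \<and> (\<exists>c. mbound M c)}"
    unfolding mem_Collect_eq by (intro conjI allI row col)
  from Bmat_inverse[OF this] show ?thesis unfolding bpull_def by simp
qed

lemma norm_bpull: "norm (bpull S \<kappa> \<gamma> M) \<le> norm M"
proof -
  have "ent (bpull S \<kappa> \<gamma> M) = (\<lambda>x y. if x \<in> S \<and> y \<in> S \<and> \<kappa> x = \<kappa> y then ent M (\<gamma> x) (\<gamma> y) else 0)"
    by (intro ext) (rule ent_bpull)
  then show ?thesis using norm_bmat_le[of "bpull S \<kappa> \<gamma> M" "norm M"] mbound_bpull[OF inj mbound_norm[of M]] by simp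
qed

lemma bpull_add: "bpull S \<kappa> \<gamma> (M + N) = bpull S \<kappa> \<gamma> M + bpull S \<kappa> \<gamma> N"
  and bpull_diff: "bpull S \<kappa> \<gamma> (M - N) = bpull S \<kappa> \<gamma> M - bpull S \<kappa> \<gamma> N"
  and bpull_adj: "bpull S \<kappa> \<gamma> (adj M) = adj (bpull S \<kappa> \<gamma> M)"
  by (rule bmat_eqI; simp add: ent_bpull)+

text \<open>The hypothesis keeps the middle index of the product inside the image of the class;
  otherwise summands of \<open>M * N\<close> would have no counterpart among the pulled-back
  entries.\<close>

lemma bpull_mult:
  assumes M: "\<And>x p. x \<in> S \<Longrightarrow> ent M (\<gamma> x) p \<noteq> 0 \<Longrightarrow> \<exists>y\<in>S. \<kappa> y = \<kappa> x \<and> \<gamma> y = p"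
  shows "bpull S \<kappa> \<gamma> (M * N) = bpull S \<kappa> \<gamma> M * bpull S \<kappa> \<gamma> N"
proof (rule bmat_eqI)
  fix x y
  let ?b = "bpull S \<kappa> \<gamma>"
  let ?K = "{k. ent (?b M) x k \<noteq> 0}"
  have "ent (?b M * ?b N) x y = (\<Sum>k\<in>?K. ent (?b M) x k * ent (?b N) k y)"
    by (rule ent_mult_sum[OF ent_row]) auto
  also have "\<dots> = ent (?b (M * N)) x y"
  proof (cases "x \<in> S \<and> y \<in> S \<and> \<kappa> x = \<kappa> y")
    case True
    have i: "inj_on \<gamma> ?K" using inj unfolding inj_on_def by (auto simp: ent_bpull split: if_splits)
    have "(\<Sum>k\<in>?K. ent (?b M) x k * ent (?b N) k y) = (\<Sum>k\<in>?K. ent M (\<gamma> x) (\<gamma> k) * ent N (\<gamma> k) (\<gamma> y))"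
      by (rule sum.cong) (use True in \<open>auto simp: ent_bpull split: if_splits\<close>)
    also have "\<dots> = (\<Sum>q\<in>\<gamma> ` ?K. ent M (\<gamma> x) q * ent N q (\<gamma> y))"
      by (simp add: sum.reindex[OF i])
    also have "\<gamma> ` ?K = {q. ent M (\<gamma> x) q \<noteq> 0}"
    proof
      show "\<gamma> ` ?K \<subseteq> {q. ent M (\<gamma> x) q \<noteq> 0}" by (auto simp: ent_bpull split: if_splits)
      show "{q. ent M (\<gamma> x) q \<noteq> 0} \<subseteq> \<gamma> ` ?K"
      proof
        fix q assume q: "q \<in> {q. ent M (\<gamma> x) q \<noteq> 0}"
        then obtain z where "z \<in> S" "\<kappa> z = \<kappa> x" "\<gamma> z = q" using M[of x q] True by auto
        then show "q \<in> \<gamma> ` ?K" using True q by (intro image_eqI[of _ _ z]) (simp_all add: ent_bpull)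
      qed
    qed
    also have "(\<Sum>q\<in>{q. ent M (\<gamma> x) q \<noteq> 0}. ent M (\<gamma> x) q * ent N q (\<gamma> y)) = ent (M * N) (\<gamma> x) (\<gamma> y)"
      by (rule ent_mult_sum[OF ent_row, symmetric]) auto
    finally show ?thesis using True by (simp add: ent_bpull)
  next
    case False
    then show ?thesis by (auto simp: ent_bpull intro!: sum.neutral)
  qed
  finally show "ent (?b (M * N)) x y = ent (?b M * ?b N) x y" by simp
qed

end

section \<open>Free right actions with chosen representatives, and the algebra of equivariant
  matrices\<close>

locale right_transversal = group H for H :: "('h, 'm) monoid_scheme" (structure) +
  fixes C :: "'j set" and act :: "'j \<Rightarrow> 'h \<Rightarrow> 'j" and R :: "'j set"
  assumes act_closed: "\<And>x h. x \<in> C \<Longrightarrow> h \<in> carrier H \<Longrightarrow> act x h \<in> C"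
    and act_one: "\<And>x. x \<in> C \<Longrightarrow> act x \<one> = x"
    and act_mult: "\<And>x h k. x \<in> C \<Longrightarrow> h \<in> carrier H \<Longrightarrow> k \<in> carrier H \<Longrightarrow> act x (h \<otimes> k) = act (act x h) k"
    and R_C: "R \<subseteq> C"
    and decomp: "\<And>x. x \<in> C \<Longrightarrow> \<exists>s\<in>R. \<exists>h\<in>carrier H. act s h = x"
    and unique: "\<And>s s' h h'. s \<in> R \<Longrightarrow> s' \<in> R \<Longrightarrow> h \<in> carrier H \<Longrightarrow> h' \<in> carrier H \<Longrightarrow>
        act s h = act s' h' \<Longrightarrow> s = s' \<and> h = h'"
begin

definition rp :: "'j \<Rightarrow> 'j" where "rp x = (SOME s. s \<in> R \<and> (\<exists>h\<in>carrier H. act s h = x))"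
definition cf :: "'j \<Rightarrow> 'h" where "cf x = (SOME h. h \<in> carrier H \<and> act (rp x) h = x)"

lemma rp: assumes "x \<in> C" shows "rp x \<in> R" "cf x \<in> carrier H" "act (rp x) (cf x) = x"
proof -
  have 1: "rp x \<in> R \<and> (\<exists>h\<in>carrier H. act (rp x) h = x)"
    unfolding rp_def by (rule someI_ex) (use decomp[OF assms] in blast)
  then have "\<exists>h. h \<in> carrier H \<and> act (rp x) h = x" by blast
  then have "cf x \<in> carrier H \<and> act (rp x) (cf x) = x"
    unfolding cf_def by (rule someI_ex)
  with 1 show "rp x \<in> R" "cf x \<in> carrier H" "act (rp x) (cf x) = x" by auto
qed

lemma rp_C: "x \<in> C \<Longrightarrow> rp x \<in> C" using rp R_C by blast

lemma rp_act: assumes "s \<in> R" "h \<in> carrier H" shows "rp (act s h) = s" "cf (act s h) = h"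
proof -
  have "act s h \<in> C" using assms R_C act_closed by blast
  from rp[OF this] unique[of "rp (act s h)" s "cf (act s h)" h] assms
  show "rp (act s h) = s" "cf (act s h) = h" by auto
qed

lemma rp_R: "s \<in> R \<Longrightarrow> rp s = s"
  using rp_act[of s \<one>] act_one R_C by auto

lemma rp_act_C: assumes "x \<in> C" "h \<in> carrier H" shows "rp (act x h) = rp x" "cf (act x h) = cf x \<otimes> h"
proof -
  have "act x h = act (rp x) (cf x \<otimes> h)"
    using act_mult[of "rp x" "cf x" h] rp[OF assms(1)] rp_C[OF assms(1)] assms by simp
  then show "rp (act x h) = rp x" "cf (act x h) = cf x \<otimes> h"
    using rp_act[of "rp x" "cf x \<otimes> h"] rp[OF assms(1)] assms by auto
qed

lemma act_inv: "x \<in> C \<Longrightarrow> h \<in> carrier H \<Longrightarrow> act (act x h) (inv h) = x"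
  and act_inv': "x \<in> C \<Longrightarrow> h \<in> carrier H \<Longrightarrow> act (act x (inv h)) h = x"
  using act_mult[of x h "inv h"] act_mult[of x "inv h" h] act_one by auto

text \<open>Matrices are indexed by the whole type rather than by \<open>C\<close>. The part outside
  \<open>C\<close> is left free and merely kept apart from \<open>C\<close>, so that the unit of the
  matrix type belongs to this algebra.\<close>

definition Eq :: "'j bmat set" where
  "Eq = {M. (\<forall>s t. ent M s t \<noteq> 0 \<longrightarrow> (s \<in> C \<longleftrightarrow> t \<in> C)) \<and>
     (\<forall>s\<in>C. \<forall>t\<in>C. \<forall>h\<in>carrier H. ent M (act s h) (act t h) = ent M s t)}"

text \<open>Bounding the row orbits suffices: the row of a representative is finite, so by
  equivariance only finitely many column orbits occur as well.\<close>

definition Fin :: "'j bmat set" where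
  "Fin = {M\<in>Eq. \<exists>F. finite F \<and> (\<forall>s t. ent M s t \<noteq> 0 \<longrightarrow> s \<in> C \<and> rp s \<in> F)}"

text \<open>One diagonal entry per orbit; by equivariance the choice of representatives does not
  matter. For elements of \<open>Fin\<close> the index set is finite, whereas an infinite one would
  give the default value 0.\<close>

definition tr :: "'j bmat \<Rightarrow> complex" where
  "tr M = (\<Sum>s\<in>{s\<in>R. ent M s s \<noteq> 0}. ent M s s)"

lemma EqI:
  assumes "\<And>s t. ent M s t \<noteq> 0 \<Longrightarrow> s \<in> C \<longleftrightarrow> t \<in> C"
    "\<And>s t h. s \<in> C \<Longrightarrow> t \<in> C \<Longrightarrow> h \<in> carrier H \<Longrightarrow> ent M (act s h) (act t h) = ent M s t"
  shows "M \<in> Eq"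
  using assms unfolding Eq_def by blast

lemma EqD:
  assumes "M \<in> Eq"
  shows "ent M s t \<noteq> 0 \<Longrightarrow> s \<in> C \<longleftrightarrow> t \<in> C"
    "s \<in> C \<Longrightarrow> t \<in> C \<Longrightarrow> h \<in> carrier H \<Longrightarrow> ent M (act s h) (act t h) = ent M s t"
  using assms unfolding Eq_def by blast+

lemma Eq_shift:
  assumes "M \<in> Eq" "s \<in> C" "k \<in> C" "h \<in> carrier H"
  shows "ent M (act s h) k = ent M s (act k (inv h))" "ent M k (act s h) = ent M (act k (inv h)) s"
  using EqD(2)[OF assms(1), of s "act k (inv h)" h] EqD(2)[OF assms(1), of "act k (inv h)" s h]
    act_inv'[of k h] act_closed[of k "inv h"] assms by auto

lemma ent_mult_nonzero:
  assumes "ent (M * N) s t \<noteq> 0" shows "\<exists>k. ent M s k \<noteq> 0 \<and> ent N k t \<noteq> 0"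
proof -
  have "ent (M * N) s t = (\<Sum>k\<in>{k. ent M s k \<noteq> 0}. ent M s k * ent N k t)"
    by (rule ent_mult_sum[OF ent_row]) auto
  with assms have "(\<Sum>k\<in>{k. ent M s k \<noteq> 0}. ent M s k * ent N k t) \<noteq> 0" by simp
  then obtain k where "ent M s k * ent N k t \<noteq> 0" by (rule sum.not_neutral_contains_not_neutral)
  then show ?thesis by auto
qed

lemma Eq_mult:
  assumes "M \<in> Eq" "N \<in> Eq" shows "M * N \<in> Eq"
proof (rule EqI)
  fix s t assume nz: "ent (M * N) s t \<noteq> 0"
  obtain k where "ent M s k \<noteq> 0" "ent N k t \<noteq> 0" using ent_mult_nonzero[OF nz] by blast
  then show "s \<in> C \<longleftrightarrow> t \<in> C" using EqD(1)[OF assms(1)] EqD(1)[OF assms(2)] by simp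
next
  fix s t h assume st: "s \<in> C" "t \<in> C" and h: "h \<in> carrier H"
  let ?K = "{k. ent M s k \<noteq> 0}"
  have KC: "k \<in> C" if "k \<in> ?K" for k using that EqD(1)[OF assms(1), of s k] st by auto
  have i: "inj_on (\<lambda>k. act k h) ?K"
    by (rule inj_on_inverseI[of _ "\<lambda>k. act k (inv h)"]) (use KC act_inv h in blast)
  have "ent (M * N) (act s h) (act t h) = (\<Sum>k\<in>(\<lambda>k. act k h) ` ?K. ent M (act s h) k * ent N k (act t h))"
  proof (rule ent_mult_sum)
    show "finite ((\<lambda>k. act k h) ` ?K)" by (intro finite_imageI ent_row)
    show "{k. ent M (act s h) k \<noteq> 0 \<and> ent N k (act t h) \<noteq> 0} \<subseteq> (\<lambda>k. act k h) ` ?K"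
    proof
      fix k assume "k \<in> {k. ent M (act s h) k \<noteq> 0 \<and> ent N k (act t h) \<noteq> 0}"
      then have k: "ent M (act s h) k \<noteq> 0" by simp
      then have kC: "k \<in> C" using EqD(1)[OF assms(1) k] act_closed[OF st(1) h] by simp
      then have "ent M s (act k (inv h)) \<noteq> 0" using k Eq_shift(1)[OF assms(1) st(1) kC h] by simp
      then show "k \<in> (\<lambda>k. act k h) ` ?K"
        using act_inv'[OF kC h] by (intro image_eqI[of _ _ "act k (inv h)"]) auto
    qed
  qed
  also have "\<dots> = (\<Sum>k\<in>?K. ent M s k * ent N k t)"
    unfolding sum.reindex[OF i] o_def
    by (intro sum.cong refl arg_cong2[of _ _ _ _ "(*)"] EqD(2)[OF assms(1)] EqD(2)[OF assms(2)] st h KC)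
  also have "\<dots> = ent (M * N) s t"
    by (rule ent_mult_sum[OF ent_row, symmetric]) auto
  finally show "ent (M * N) (act s h) (act t h) = ent (M * N) s t" .
qed

lemma Fin_Eq: "M \<in> Fin \<Longrightarrow> M \<in> Eq" unfolding Fin_def by blast

lemma Fin_rows:
  assumes "M \<in> Fin"
  shows "\<exists>F. finite F \<and> F \<subseteq> R \<and> (\<forall>s t. ent M s t \<noteq> 0 \<longrightarrow> s \<in> C \<and> t \<in> C \<and> rp s \<in> F)"
proof -
  obtain F where F: "finite F" "\<And>s t. ent M s t \<noteq> 0 \<Longrightarrow> s \<in> C \<and> rp s \<in> F"
    using assms unfolding Fin_def by blast
  show ?thesis
  proof (intro exI[of _ "F \<inter> R"] conjI allI impI)
    fix s t assume st: "ent M s t \<noteq> 0"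
    then show "s \<in> C" "t \<in> C" "rp s \<in> F \<inter> R"
      using F(2)[OF st] EqD(1)[OF Fin_Eq[OF assms] st] rp(1)[of s] by simp_all
  qed (use F(1) in auto)
qed

lemma tr_sum:
  assumes "finite F" "F \<subseteq> R" "\<And>s. s \<in> R \<Longrightarrow> ent M s s \<noteq> 0 \<Longrightarrow> s \<in> F"
  shows "tr M = (\<Sum>s\<in>F. ent M s s)"
  unfolding tr_def by (rule sum.mono_neutral_left) (use assms in auto)

text \<open>An entry of \<open>N\<close> in a column \<open>k\<close> whose orbit is represented in
  \<open>F\<close> is moved by equivariance to the column of the representative. Those columns are
  finitely many and finite, which leaves finitely many row orbits.\<close>

lemma Fin_mult_left:
  assumes "N \<in> Eq" "M \<in> Fin" shows "N * M \<in> Fin"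
proof -
  obtain F where F: "finite F" "F \<subseteq> R" "\<And>s t. ent M s t \<noteq> 0 \<Longrightarrow> s \<in> C \<and> t \<in> C \<and> rp s \<in> F"
    using Fin_rows[OF assms(2)] by blast
  let ?G = "rp ` (\<Union>f\<in>F. {s. ent N s f \<noteq> 0})"
  have "finite ?G" by (intro finite_imageI finite_UN_I F ent_col)
  moreover have "s \<in> C \<and> rp s \<in> ?G" if nz: "ent (N * M) s t \<noteq> 0" for s t
  proof -
    obtain k where k: "ent N s k \<noteq> 0" "ent M k t \<noteq> 0" using ent_mult_nonzero[OF nz] by blast
    have kC: "k \<in> C" "rp k \<in> F" using F(3)[OF k(2)] by auto
    then have sC: "s \<in> C" using EqD(1)[OF assms(1) k(1)] by simp
    have "ent N (act s (inv cf k)) (rp k) \<noteq> 0"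
      using Eq_shift(2)[OF assms(1) rp_C[OF kC(1)] sC rp(2)[OF kC(1)]] rp(3)[OF kC(1)] k by simp
    moreover have "rp (act s (inv cf k)) = rp s" using rp_act_C(1)[OF sC] rp(2)[OF kC(1)] by simp
    ultimately show ?thesis using sC kC(2)
      by (intro conjI image_eqI[of _ rp "act s (inv cf k)"] UN_I[of "rp k"]) simp_all
  qed
  ultimately show ?thesis unfolding Fin_def using Eq_mult[OF assms(1) Fin_Eq[OF assms(2)]] by blast
qed

lemma Fin_mult_right:
  assumes "M \<in> Fin" "N \<in> Eq" shows "M * N \<in> Fin"
proof -
  obtain F where F: "finite F" "F \<subseteq> R" "\<And>s t. ent M s t \<noteq> 0 \<Longrightarrow> s \<in> C \<and> t \<in> C \<and> rp s \<in> F"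
    using Fin_rows[OF assms(1)] by blast
  have "s \<in> C \<and> rp s \<in> F" if "ent (M * N) s t \<noteq> 0" for s t
    using ent_mult_nonzero[OF that] F(3) by blast
  then show ?thesis unfolding Fin_def using Eq_mult[OF Fin_Eq[OF assms(1)] assms(2)] F(1) by blast
qed

lemma Fin_add:
  assumes "M \<in> Fin" "N \<in> Fin" shows "M + N \<in> Fin" "tr (M + N) = tr M + tr N"
proof -
  obtain F where F: "finite F" "F \<subseteq> R" "\<And>s t. ent M s t \<noteq> 0 \<Longrightarrow> s \<in> C \<and> t \<in> C \<and> rp s \<in> F"
    using Fin_rows[OF assms(1)] by blast
  obtain G where G: "finite G" "G \<subseteq> R" "\<And>s t. ent N s t \<noteq> 0 \<Longrightarrow> s \<in> C \<and> t \<in> C \<and> rp s \<in> G"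
    using Fin_rows[OF assms(2)] by blast
  have nz: "ent M s t \<noteq> 0 \<or> ent N s t \<noteq> 0" if "ent (M + N) s t \<noteq> 0" for s t using that by auto
  have "M + N \<in> Eq"
    using nz F(3) G(3) EqD(2)[OF Fin_Eq[OF assms(1)]] EqD(2)[OF Fin_Eq[OF assms(2)]]
    by (intro EqI) (blast, simp)
  moreover have "finite (F \<union> G)" using F G by simp
  ultimately show "M + N \<in> Fin" unfolding Fin_def using nz F(3) G(3) by blast
  have FG: "finite (F \<union> G)" "F \<union> G \<subseteq> R" using F G by auto
  have 1: "tr M = (\<Sum>s\<in>F \<union> G. ent M s s)"
    by (rule tr_sum[OF FG]) (use F(3) rp_R in fastforce)
  have 2: "tr N = (\<Sum>s\<in>F \<union> G. ent N s s)"
    by (rule tr_sum[OF FG]) (use G(3) rp_R in fastforce)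
  have 3: "tr (M + N) = (\<Sum>s\<in>F \<union> G. ent (M + N) s s)"
    by (rule tr_sum[OF FG]) (use nz F(3) G(3) rp_R in \<open>metis UnI1 UnI2\<close>)
  show "tr (M + N) = tr M + tr N" unfolding 1 2 3 by (simp add: sum.distrib)
qed

text \<open>Both traces are sums over pairs of a representative \<open>s\<close> and an arbitrary
  index \<open>k\<close>. Translating such a pair until \<open>k\<close> becomes a representative
  and then exchanging its entries is the involution \<open>i\<close>; by equivariance the summands
  correspond.\<close>

lemma tr_mult_comm:
  assumes M: "M \<in> Fin" and N: "N \<in> Eq" shows "tr (M * N) = tr (N * M)"
proof -
  \<comment> \<open>The hypothesis covers both orders of the product: the finite set of relevant
    representatives comes from the rows of \<open>M\<close> in one case and from translated columns
    of \<open>N\<close> in the other.\<close>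
  have key: "finite {(s, k). s \<in> R \<and> ent M s k * ent N k s \<noteq> 0} \<and>
     tr (M * N) = (\<Sum>(s, k)\<in>{(s, k). s \<in> R \<and> ent M s k * ent N k s \<noteq> 0}. ent M s k * ent N k s)"
    if ex: "\<exists>F. finite F \<and> F \<subseteq> R \<and> (\<forall>s k. s \<in> R \<longrightarrow> ent M s k \<noteq> 0 \<longrightarrow> ent N k s \<noteq> 0 \<longrightarrow> s \<in> F)" for M N
  proof -
    let ?P = "{(s, k). s \<in> R \<and> ent M s k * ent N k s \<noteq> 0}"
    obtain F where F: "finite F" "F \<subseteq> R" "\<And>s k. s \<in> R \<Longrightarrow> ent M s k \<noteq> 0 \<Longrightarrow> ent N k s \<noteq> 0 \<Longrightarrow> s \<in> F"
      using ex by blast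
    have sub: "?P \<subseteq> Sigma F (\<lambda>s. {k. ent M s k \<noteq> 0})" using F(3) by auto
    have fin: "finite (Sigma F (\<lambda>s. {k. ent M s k \<noteq> 0}))" by (intro finite_SigmaI F ent_row)
    have "tr (M * N) = (\<Sum>s\<in>F. ent (M * N) s s)"
    proof (rule tr_sum[OF F(1,2)])
      fix s assume s: "s \<in> R" "ent (M * N) s s \<noteq> 0"
      show "s \<in> F" using ent_mult_nonzero[OF s(2)] F(3)[OF s(1)] by blast
    qed
    also have "\<dots> = (\<Sum>s\<in>F. \<Sum>k\<in>{k. ent M s k \<noteq> 0}. ent M s k * ent N k s)"
      by (intro sum.cong refl ent_mult_sum[OF ent_row]) auto
    also have "\<dots> = (\<Sum>(s, k)\<in>Sigma F (\<lambda>s. {k. ent M s k \<noteq> 0}). ent M s k * ent N k s)"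
      by (rule sum.Sigma) (auto intro: F ent_row)
    also have "\<dots> = (\<Sum>(s, k)\<in>?P. ent M s k * ent N k s)"
      by (rule sum.mono_neutral_right[OF fin sub]) (use F(2) in auto)
    finally show ?thesis using finite_subset[OF sub fin] by blast
  qed
  obtain F where F: "finite F" "F \<subseteq> R" "\<And>s t. ent M s t \<noteq> 0 \<Longrightarrow> s \<in> C \<and> t \<in> C \<and> rp s \<in> F"
    using Fin_rows[OF M] by blast
  have E: "M \<in> Eq" by (rule Fin_Eq[OF M])
  let ?G = "rp ` (\<Union>f\<in>F. {s. ent N s f \<noteq> 0})"
  have 1: "tr (M * N) = (\<Sum>(s, k)\<in>{(s, k). s \<in> R \<and> ent M s k * ent N k s \<noteq> 0}. ent M s k * ent N k s)"
  proof (intro conjunct2[OF key] exI[of _ F] conjI allI impI F)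
    fix s k assume "s \<in> R" "ent M s k \<noteq> 0"
    then show "s \<in> F" using F(3)[of s k] rp_R[of s] by simp
  qed
  have G': "s \<in> ?G" if "s \<in> R" "ent N s k \<noteq> 0" "ent M k s \<noteq> 0" for s k
  proof -
    have kC: "k \<in> C" "rp k \<in> F" using F(3)[OF that(3)] by auto
    have sC: "s \<in> C" using that(1) R_C by blast
    have "ent N (act s (inv cf k)) (rp k) \<noteq> 0"
      using Eq_shift(2)[OF N rp_C[OF kC(1)] sC rp(2)[OF kC(1)]] rp(3)[OF kC(1)] that by simp
    moreover have "rp (act s (inv cf k)) = s" using rp_act(1)[OF that(1)] rp(2)[OF kC(1)] by simp
    ultimately show ?thesis using kC(2)
      by (intro image_eqI[of _ rp "act s (inv cf k)"] UN_I[of "rp k"]) simp_all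
  qed
  have "finite (?G \<inter> R)" by (intro finite_Int disjI1 finite_imageI finite_UN_I F ent_col)
  then have 2: "tr (N * M) = (\<Sum>(s, k)\<in>{(s, k). s \<in> R \<and> ent N s k * ent M k s \<noteq> 0}. ent N s k * ent M k s)"
    using G' by (intro conjunct2[OF key] exI[of _ "?G \<inter> R"] conjI allI impI IntI) auto
  define i where "i = (\<lambda>(s, k). (rp k, act s (inv cf k)))"
  have ii: "i (i (s, k)) = (s, k)" if "s \<in> R" "k \<in> C" for s k
  proof -
    have c: "cf k \<in> carrier H" "rp k \<in> R" using rp[OF that(2)] by auto
    have "rp (act s (inv cf k)) = s" "cf (act s (inv cf k)) = inv cf k"
      using rp_act[OF that(1)] c by auto
    then show ?thesis unfolding i_def using c rp(3)[OF that(2)] by simp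
  qed
  have iv: "ent N (rp k) (act s (inv cf k)) * ent M (act s (inv cf k)) (rp k) = ent M s k * ent N k s"
    and iv': "ent M (rp k) (act s (inv cf k)) * ent N (act s (inv cf k)) (rp k) = ent N s k * ent M k s"
    if "s \<in> R" "k \<in> C" for s k
    using Eq_shift[OF N rp_C[OF that(2)] _ rp(2)[OF that(2)], of s]
      Eq_shift[OF E rp_C[OF that(2)] _ rp(2)[OF that(2)], of s] rp(3)[OF that(2)] that R_C
    by (auto simp: mult.commute)
  have kC: "k \<in> C" if "s \<in> R" "ent N s k \<noteq> 0" for s k
    using EqD(1)[OF N that(2)] that R_C by blast
  have kC': "k \<in> C" if "s \<in> R" "ent M s k \<noteq> 0" for s k
    using EqD(1)[OF E that(2)] that R_C by blast
  show ?thesis unfolding 1 2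
  proof (rule sum.reindex_bij_witness[of _ i i])
    fix a assume "a \<in> {(s, k). s \<in> R \<and> ent M s k * ent N k s \<noteq> 0}"
    then obtain s k where a: "a = (s, k)" "s \<in> R" "ent M s k * ent N k s \<noteq> 0" by blast
    then have k: "k \<in> C" using kC'[of s k] by simp
    show "i (i a) = a" using ii[OF a(2) k] a(1) by simp
    show "i a \<in> {(s, k). s \<in> R \<and> ent N s k * ent M k s \<noteq> 0}"
      unfolding a(1) i_def prod.case mem_Collect_eq iv[OF a(2) k] using a(3) rp(1)[OF k] by blast
    show "(case i a of (s, k) \<Rightarrow> ent N s k * ent M k s) = (case a of (s, k) \<Rightarrow> ent M s k * ent N k s)"
      using iv[OF a(2) k] unfolding a(1) i_def by simp
  next
    fix a assume "a \<in> {(s, k). s \<in> R \<and> ent N s k * ent M k s \<noteq> 0}"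
    then obtain s k where a: "a = (s, k)" "s \<in> R" "ent N s k * ent M k s \<noteq> 0" by blast
    then have k: "k \<in> C" using kC[of s k] by simp
    show "i (i a) = a" using ii[OF a(2) k] a(1) by simp
    show "i a \<in> {(s, k). s \<in> R \<and> ent M s k * ent N k s \<noteq> 0}"
      unfolding a(1) i_def prod.case mem_Collect_eq iv'[OF a(2) k] using a(3) rp(1)[OF k] by blast
  qed
qed

lemma tr_mult_bounded:
  assumes M: "M \<in> Fin" shows "\<exists>c. \<forall>y\<in>Eq. cmod (tr (M * y)) \<le> c * norm y"
proof -
  obtain F where F: "finite F" "F \<subseteq> R" "\<And>s t. ent M s t \<noteq> 0 \<Longrightarrow> s \<in> C \<and> t \<in> C \<and> rp s \<in> F"
    using Fin_rows[OF M] by blast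
  have "cmod (tr (M * y)) \<le> real (card F) * norm M * norm y" for y
  proof -
    have "tr (M * y) = (\<Sum>s\<in>F. ent (M * y) s s)"
    proof (rule tr_sum[OF F(1,2)])
      fix s assume s: "s \<in> R" "ent (M * y) s s \<noteq> 0"
      show "s \<in> F" using ent_mult_nonzero[OF s(2)] F(3) rp_R[OF s(1)] by fastforce
    qed
    also have "cmod \<dots> \<le> (\<Sum>s\<in>F. norm M * norm y)"
      by (rule sum_norm_le) (rule order_trans[OF norm_ent norm_mult_ineq])
    finally show ?thesis by (simp add: mult.assoc)
  qed
  then show ?thesis by blast
qed

sublocale trace_ideal Eq Fin tr
proof
  show "1 \<in> Eq"
  proof (rule EqI)
    fix s t h assume "s \<in> C" "t \<in> C" "h \<in> carrier H"
    then have "s = t" if "act s h = act t h"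
      using arg_cong[OF that, of "\<lambda>x. act x (inv h)"] by (simp add: act_inv)
    then show "ent 1 (act s h) (act t h) = ent 1 s t" by auto
  qed (auto split: if_splits)
  show "x + y \<in> Eq" if "x \<in> Eq" "y \<in> Eq" for x y
  proof (rule EqI)
    fix s t assume "ent (x + y) s t \<noteq> 0"
    then have "ent x s t \<noteq> 0 \<or> ent y s t \<noteq> 0" by auto
    then show "s \<in> C \<longleftrightarrow> t \<in> C" using EqD(1) that by blast
  qed (use EqD(2) that in simp)
  show "- x \<in> Eq" if "x \<in> Eq" for x
    by (rule EqI) (use EqD[OF that] in auto)
  show "c *\<^sub>R x \<in> Eq" if "x \<in> Eq" for c x
    by (rule EqI) (use EqD[OF that] in auto)
  show "tr (c *\<^sub>R x) = c *\<^sub>R tr x" for c x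
    unfolding tr_def by (cases "c = 0") (auto simp: sum_distrib_left scaleR_conv_of_real[where 'a=complex])
  show "0 \<in> Fin" unfolding Fin_def by (auto intro: EqI)
qed (auto intro: Eq_mult Fin_Eq Fin_add Fin_mult_left Fin_mult_right tr_mult_comm tr_mult_bounded)

end

section \<open>Square-summable functions\<close>

definition sq :: "('g \<times> nat \<Rightarrow> complex) \<Rightarrow> bool" where
  "sq f \<longleftrightarrow> (\<lambda>p. (cmod (f p))\<^sup>2) summable_on UNIV"

lemma l2_sq: "f \<in> l2 G n \<Longrightarrow> sq f"
  unfolding l2_def sq_def by simp

lemma L2_set_le_l2_norm:
  assumes "sq f" "finite S" shows "L2_set (\<lambda>p. cmod (f p)) S \<le> l2_norm f"
  unfolding L2_set_def l2_norm_def
  by (rule real_sqrt_le_mono, rule finite_sum_le_infsum) (use assms in \<open>auto simp: sq_def\<close>)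

lemma l2_norm_nonneg: "0 \<le> l2_norm f"
  unfolding l2_norm_def by (auto intro: infsum_nonneg)

lemma cmod_le_l2_norm: "sq f \<Longrightarrow> cmod (f p) \<le> l2_norm f"
  using L2_set_le_l2_norm[of f "{p}"] by (simp add: L2_set_def)

lemma l2_norm_leI:
  assumes "0 \<le> c" "\<And>S. finite S \<Longrightarrow> L2_set (\<lambda>p. cmod (f p)) S \<le> c"
  shows "sq f" "l2_norm f \<le> c"
proof -
  have le: "(\<Sum>p\<in>S. (cmod (f p))\<^sup>2) \<le> c\<^sup>2" if "finite S" for S
    using assms(2)[OF that] assms(1) unfolding L2_set_def
    by (metis real_sqrt_le_iff real_sqrt_unique abs_of_nonneg real_sqrt_abs)
  show sq: "sq f" unfolding sq_def
    by (rule nonneg_bdd_above_summable_on) (use le in \<open>auto intro!: bdd_aboveI2[of _ _ "c\<^sup>2"]\<close>)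
  have "(\<Sum>\<^sub>\<infinity>p. (cmod (f p))\<^sup>2) \<le> c\<^sup>2"
    by (rule infsum_le_finite_sums) (use sq le in \<open>auto simp: sq_def\<close>)
  then show "l2_norm f \<le> c"
    unfolding l2_norm_def using assms(1) by (simp add: real_le_lsqrt)
qed

lemma l2_norm_add:
  assumes "sq f" "sq g" shows "sq (\<lambda>p. f p + g p)" "l2_norm (\<lambda>p. f p + g p) \<le> l2_norm f + l2_norm g"
proof -
  have "L2_set (\<lambda>p. cmod (f p + g p)) S \<le> l2_norm f + l2_norm g" if "finite S" for S
  proof -
    have "L2_set (\<lambda>p. cmod (f p + g p)) S \<le> L2_set (\<lambda>p. cmod (f p) + cmod (g p)) S"
      by (intro L2_set_mono norm_triangle_ineq) auto
    also have "\<dots> \<le> L2_set (\<lambda>p. cmod (f p)) S + L2_set (\<lambda>p. cmod (g p)) S" by (rule L2_set_triangle_ineq)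
    also have "\<dots> \<le> l2_norm f + l2_norm g" by (intro add_mono L2_set_le_l2_norm assms that)
    finally show ?thesis .
  qed
  then show "sq (\<lambda>p. f p + g p)" "l2_norm (\<lambda>p. f p + g p) \<le> l2_norm f + l2_norm g"
    using l2_norm_leI[of "l2_norm f + l2_norm g" "\<lambda>p. f p + g p"] l2_norm_nonneg[of f] l2_norm_nonneg[of g] by auto
qed

lemma l2_norm_minus: "sq f \<Longrightarrow> sq (\<lambda>p. - f p)" "l2_norm (\<lambda>p. - f p) = l2_norm f"
  by (simp_all add: sq_def l2_norm_def)

lemma l2_norm_diff:
  assumes "sq f" "sq g" shows "sq (\<lambda>p. f p - g p)" "l2_norm (\<lambda>p. f p - g p) \<le> l2_norm f + l2_norm g"
  using l2_norm_add[OF assms(1) l2_norm_minus(1)[OF assms(2)]] l2_norm_minus(2)[of g] by auto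

lemma sq_finite: assumes "finite T" "\<And>p. p \<notin> T \<Longrightarrow> f p = 0"
  shows "sq f" "l2_norm f = L2_set (\<lambda>p. cmod (f p)) T"
proof -
  have 1: "(\<lambda>p. (cmod (f p))\<^sup>2) summable_on UNIV \<longleftrightarrow> (\<lambda>p. (cmod (f p))\<^sup>2) summable_on T"
    by (rule summable_on_cong_neutral) (use assms in auto)
  then show "sq f" using assms unfolding sq_def by simp
  have "(\<Sum>\<^sub>\<infinity>p. (cmod (f p))\<^sup>2) = (\<Sum>\<^sub>\<infinity>p\<in>T. (cmod (f p))\<^sup>2)"
    by (rule infsum_cong_neutral) (use assms in auto)
  then show "l2_norm f = L2_set (\<lambda>p. cmod (f p)) T" using assms unfolding l2_norm_def L2_set_def by simp
qed

lemma l2_inner_bound: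
  assumes "sq f" "sq g"
  shows "(\<lambda>p. cnj (f p) * g p) summable_on UNIV" "cmod (l2_inner f g) \<le> l2_norm f * l2_norm g"
proof -
  have le: "(\<Sum>p\<in>S. norm (cnj (f p) * g p)) \<le> l2_norm f * l2_norm g" if "finite S" for S
  proof -
    have "(\<Sum>p\<in>S. norm (cnj (f p) * g p)) = (\<Sum>p\<in>S. \<bar>cmod (f p)\<bar> * \<bar>cmod (g p)\<bar>)"
      by (simp add: norm_mult)
    also have "\<dots> \<le> L2_set (\<lambda>p. cmod (f p)) S * L2_set (\<lambda>p. cmod (g p)) S" by (rule L2_set_mult_ineq)
    also have "\<dots> \<le> l2_norm f * l2_norm g"
      by (intro mult_mono L2_set_le_l2_norm assms that l2_norm_nonneg) auto
    finally show ?thesis .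
  qed
  have abs: "(\<lambda>p. norm (cnj (f p) * g p)) summable_on UNIV"
    unfolding abs_summable_iff_bdd_above using le by (auto intro!: bdd_aboveI2)
  then show "(\<lambda>p. cnj (f p) * g p) summable_on UNIV" by (rule abs_summable_summable)
  have "cmod (l2_inner f g) \<le> (\<Sum>\<^sub>\<infinity>p. norm (cnj (f p) * g p))"
    unfolding l2_inner_def by (rule norm_infsum_bound[OF abs])
  also have "\<dots> \<le> l2_norm f * l2_norm g" by (rule infsum_le_finite_sums[OF abs]) (use le in auto)
  finally show "cmod (l2_inner f g) \<le> l2_norm f * l2_norm g" .
qed

lemma l2_inner_diff_left:
  assumes "sq f" "sq g" "sq h" shows "l2_inner (\<lambda>p. f p - g p) h = l2_inner f h - l2_inner g h"
  using infsum_add[OF l2_inner_bound(1)[OF assms(1,3)] summable_on_uminus[THEN iffD2, OF l2_inner_bound(1)[OF assms(2,3)]]]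
  unfolding l2_inner_def by (simp add: left_diff_distrib infsum_uminus)

lemma l2_inner_diff_right:
  assumes "sq f" "sq g" "sq h" shows "l2_inner h (\<lambda>p. f p - g p) = l2_inner h f - l2_inner h g"
  using infsum_add[OF l2_inner_bound(1)[OF assms(3,1)] summable_on_uminus[THEN iffD2, OF l2_inner_bound(1)[OF assms(3,2)]]]
  unfolding l2_inner_def by (simp add: right_diff_distrib infsum_uminus)

lemma l2_inner_self: assumes "sq f" shows "cmod (l2_inner f f) = (l2_norm f)\<^sup>2"
proof -
  have "l2_inner f f = (\<Sum>\<^sub>\<infinity>p. complex_of_real ((cmod (f p))\<^sup>2))"
    unfolding l2_inner_def by (intro infsum_cong) (simp only: complex_norm_square mult.commute)
  also have "\<dots> = complex_of_real (\<Sum>\<^sub>\<infinity>p. (cmod (f p))\<^sup>2)"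
    using assms unfolding sq_def by (intro infsumI has_sum_of_real has_sum_infsum)
  finally have "cmod (l2_inner f f) = (\<Sum>\<^sub>\<infinity>p. (cmod (f p))\<^sup>2)"
    by (simp add: infsum_nonneg)
  then show ?thesis unfolding l2_norm_def by (simp add: infsum_nonneg)
qed

lemma sq_truncate:
  assumes "sq f" "e > 0"
  obtains T where "finite T" "l2_norm (\<lambda>p. f p - (if p \<in> T then f p else 0)) \<le> e"
proof -
  let ?s = "\<lambda>p. (cmod (f p))\<^sup>2"
  obtain T where T: "finite T" "dist (sum ?s T) (infsum ?s UNIV) \<le> e\<^sup>2"
    using infsum_finite_approximation[of ?s UNIV "e\<^sup>2"] assms unfolding sq_def by auto
  have "L2_set (\<lambda>p. cmod (f p - (if p \<in> T then f p else 0))) S \<le> e" if S: "finite S" for S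
  proof -
    have "(\<Sum>p\<in>S. (cmod (f p - (if p \<in> T then f p else 0)))\<^sup>2) = (\<Sum>p\<in>S - T. ?s p)"
      by (rule sum.mono_neutral_cong_right) (use S in auto)
    also have "\<dots> = sum ?s (S \<union> T) - sum ?s T"
      using sum.subset_diff[of T "S \<union> T" ?s] S T by (simp add: Un_Diff)
    also have "\<dots> \<le> infsum ?s UNIV - sum ?s T"
      using finite_sum_le_infsum[of ?s UNIV "S \<union> T"] S T assms unfolding sq_def by auto
    also have "\<dots> \<le> e\<^sup>2" using T(2) unfolding dist_real_def by linarith
    finally show ?thesis unfolding L2_set_def using assms(2) by (simp add: real_le_lsqrt)
  qed
  then show thesis using that[OF T(1)] l2_norm_leI(2) assms(2) by (metis less_imp_le)
qed

section \<open>Matrices as operators on square-summable functions\<close>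

definition app :: "'j bmat \<Rightarrow> ('j \<Rightarrow> complex) \<Rightarrow> 'j \<Rightarrow> complex" where
  "app M f p = (\<Sum>q\<in>{q. ent M p q \<noteq> 0}. ent M p q * f q)"

lemma app_sum: "finite K \<Longrightarrow> {q. ent M p q \<noteq> 0 \<and> f q \<noteq> 0} \<subseteq> K \<Longrightarrow> app M f p = (\<Sum>q\<in>K. ent M p q * f q)"
  unfolding app_def using ent_row[of M p] by (intro sum.mono_neutral_cong) auto

text \<open>Finitely many rows involve only finitely many columns, so the bound on finite sections
  extends to every square-summable function.\<close>

lemma app_bound:
  assumes "sq f" shows "sq (app M f)" "l2_norm (app M f) \<le> norm M * l2_norm f"
proof -
  have "L2_set (\<lambda>p. cmod (app M f p)) S \<le> norm M * l2_norm f" if S: "finite S" for S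
  proof -
    define T where "T = (\<Union>s\<in>S. {q. ent M s q \<noteq> 0})"
    have T: "finite T" unfolding T_def by (intro finite_UN_I S ent_row)
    have "L2_set (\<lambda>p. cmod (app M f p)) S = L2_set (\<lambda>p. cmod (\<Sum>t\<in>T. ent M p t * f t)) S"
      by (intro L2_set_cong refl arg_cong[of _ _ cmod] app_sum T) (auto simp: T_def)
    also have "\<dots> \<le> norm M * L2_set (\<lambda>t. cmod (f t)) T" by (rule mboundD[OF mbound_norm S T])
    also have "\<dots> \<le> norm M * l2_norm f" by (intro mult_left_mono L2_set_le_l2_norm assms T) auto
    finally show ?thesis .
  qed
  then show "sq (app M f)" "l2_norm (app M f) \<le> norm M * l2_norm f"
    using l2_norm_leI[of "norm M * l2_norm f" "app M f"] l2_norm_nonneg[of f] by auto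
qed

lemma app_mult: "app (M * N) f = app M (app N f)"
proof
  fix p
  define K where "K = {k. ent M p k \<noteq> 0}"
  define L where "L = (\<Union>k\<in>K. {q. ent N k q \<noteq> 0})"
  have K: "finite K" unfolding K_def by (rule ent_row)
  have L: "finite L" unfolding L_def by (intro finite_UN_I K ent_row)
  have MN: "ent (M * N) p q = (\<Sum>k\<in>K. ent M p k * ent N k q)" for q
    by (rule ent_mult_sum[OF K]) (auto simp: K_def)
  have "app (M * N) f p = (\<Sum>q\<in>L. ent (M * N) p q * f q)"
  proof (rule app_sum[OF L], rule subsetI)
    fix q assume "q \<in> {q. ent (M * N) p q \<noteq> 0 \<and> f q \<noteq> 0}"
    then have "(\<Sum>k\<in>K. ent M p k * ent N k q) \<noteq> 0" using MN by auto
    then obtain k where "k \<in> K" "ent M p k * ent N k q \<noteq> 0" by (rule sum.not_neutral_contains_not_neutral)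
    then show "q \<in> L" unfolding L_def by auto
  qed
  also have "\<dots> = (\<Sum>k\<in>K. ent M p k * (\<Sum>q\<in>L. ent N k q * f q))"
    unfolding MN by (simp add: sum_distrib_left sum_distrib_right mult.assoc) (rule sum.swap)
  also have "\<dots> = (\<Sum>k\<in>K. ent M p k * app N f k)"
    by (intro sum.cong refl arg_cong2[of _ _ _ _ "(*)"] app_sum[symmetric] L) (auto simp: L_def)
  also have "\<dots> = app M (app N f) p" by (rule app_sum[OF K, symmetric]) (auto simp: K_def)
  finally show "app (M * N) f p = app M (app N f) p" .
qed

lemma app_diff_left: "app (M - N) f p = app M f p - app N f p"
proof -
  have K: "finite ({q. ent M p q \<noteq> 0} \<union> {q. ent N p q \<noteq> 0})" by (intro finite_UnI ent_row)
  show ?thesis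
    by (subst (1 2 3) app_sum[OF K]) (auto simp: left_diff_distrib sum_subtractf)
qed

lemma app_diff_right: "app M (\<lambda>p. f p - g p) q = app M f q - app M g q"
  unfolding app_def by (simp add: right_diff_distrib sum_subtractf)

lemma app_adj_finite:
  assumes T: "finite T" "\<And>p. p \<notin> T \<Longrightarrow> u p = 0"
  shows "l2_inner (app M u) v = l2_inner u (app (adj M) v)"
proof -
  define S where "S = (\<Union>t\<in>T. {p. ent M p t \<noteq> 0})"
  have S: "finite S" unfolding S_def by (intro finite_UN_I T ent_col)
  have Mu: "app M u p = (\<Sum>t\<in>T. ent M p t * u t)" for p
    by (rule app_sum[OF T(1)]) (use T(2) in auto)
  have Mu0: "app M u p = 0" if "p \<notin> S" for p
    unfolding Mu by (rule sum.neutral) (use that in \<open>auto simp: S_def\<close>)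
  have Mv: "app (adj M) v t = (\<Sum>p\<in>S. cnj (ent M p t) * v p)" if "t \<in> T" for t
    by (subst app_sum[OF S]) (use that in \<open>auto simp: S_def\<close>)
  have "l2_inner (app M u) v = (\<Sum>\<^sub>\<infinity>p\<in>S. cnj (app M u p) * v p)"
    unfolding l2_inner_def by (rule infsum_cong_neutral) (use Mu0 in auto)
  also have "\<dots> = (\<Sum>p\<in>S. cnj (\<Sum>t\<in>T. ent M p t * u t) * v p)" using S Mu by simp
  also have "\<dots> = (\<Sum>p\<in>S. \<Sum>t\<in>T. cnj (u t) * (cnj (ent M p t) * v p))"
    by (simp add: sum_distrib_left sum_distrib_right mult_ac)
  also have "\<dots> = (\<Sum>t\<in>T. cnj (u t) * app (adj M) v t)"
    by (subst sum.swap) (simp add: sum_distrib_left Mv)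
  also have "\<dots> = (\<Sum>\<^sub>\<infinity>t\<in>T. cnj (u t) * app (adj M) v t)" using T by simp
  also have "\<dots> = l2_inner u (app (adj M) v)"
    unfolding l2_inner_def by (rule infsum_cong_neutral) (use T in auto)
  finally show ?thesis .
qed

text \<open>Both sides depend continuously on \<open>u\<close> and agree on finitely supported
  vectors, which are dense.\<close>

lemma app_adj:
  assumes u: "sq u" and v: "sq v"
  shows "l2_inner (app M u) v = l2_inner u (app (adj M) v)"
proof -
  let ?d = "l2_inner (app M u) v - l2_inner u (app (adj M) v)"
  let ?C = "norm M * l2_norm v + norm (adj M) * l2_norm v"
  have C: "?C \<ge> 0" by (intro add_nonneg_nonneg mult_nonneg_nonneg l2_norm_nonneg norm_ge_zero)
  have "cmod ?d \<le> e * ?C" if e: "e > 0" for e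
  proof -
    obtain T where T: "finite T" "l2_norm (\<lambda>p. u p - (if p \<in> T then u p else 0)) \<le> e"
      by (rule sq_truncate[OF u e])
    define w where "w = (\<lambda>p. if p \<in> T then u p else 0)"
    define z where "z = (\<lambda>p. u p - w p)"
    have w: "sq w" by (rule sq_finite[OF T(1)]) (simp add: w_def)
    have z: "sq z" unfolding z_def by (rule l2_norm_diff(1)[OF u w])
    have zn: "l2_norm z \<le> e" using T(2) unfolding z_def w_def .
    have eq: "l2_inner (app M w) v = l2_inner w (app (adj M) v)"
      by (rule app_adj_finite[OF T(1)]) (simp add: w_def)
    have 1: "l2_inner (app M z) v = l2_inner (app M u) v - l2_inner (app M w) v"
      using l2_inner_diff_left[OF app_bound(1)[OF u] app_bound(1)[OF w] v, of M M]
      unfolding z_def by (simp add: app_diff_right[abs_def])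
    have 2: "l2_inner z (app (adj M) v) = l2_inner u (app (adj M) v) - l2_inner w (app (adj M) v)"
      unfolding z_def by (rule l2_inner_diff_left[OF u w app_bound(1)[OF v]])
    have "?d = l2_inner (app M z) v - l2_inner z (app (adj M) v)" using 1 2 eq by simp
    also have "cmod \<dots> \<le> cmod (l2_inner (app M z) v) + cmod (l2_inner z (app (adj M) v))"
      by (rule norm_triangle_ineq4)
    also have "\<dots> \<le> l2_norm (app M z) * l2_norm v + l2_norm z * l2_norm (app (adj M) v)"
      by (intro add_mono l2_inner_bound(2) app_bound z v)
    also have "\<dots> \<le> (norm M * e) * l2_norm v + e * (norm (adj M) * l2_norm v)"
      by (intro add_mono mult_mono order_trans[OF app_bound(2)[OF z]] app_bound(2)[OF v] zn order_refl l2_norm_nonneg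
           mult_left_mono mult_nonneg_nonneg norm_ge_zero less_imp_le[OF e])
    finally show ?thesis by (simp add: algebra_simps)
  qed
  then have "cmod ?d \<le> 0 + e" if "e > 0" for e
  proof -
    \<comment> \<open>Adding 1 to the constant avoids a division by zero when it vanishes.\<close>
    have "cmod ?d \<le> (e / (?C + 1)) * ?C" using \<open>\<And>e. e > 0 \<Longrightarrow> cmod ?d \<le> e * ?C\<close>[of "e / (?C + 1)"] that C by simp
    also have "\<dots> \<le> e" using that C by (simp add: field_simps)
    finally show ?thesis by simp
  qed
  then have "cmod ?d \<le> 0" by (rule field_le_epsilon)
  then show ?thesis by simp
qed

section \<open>Matrices over the group algebra\<close>

locale group_matrix = group G for G :: "('g, 'm) monoid_scheme" (structure) +
  fixes n :: nat

text \<open>Left convolution operators are the matrices equivariant under right translation. There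
  are only \<open>n\<close> orbits, so \<open>Fin\<close> consists of all equivariant matrices
  supported on the index set, that is, of the \<open>n\<close> by \<open>n\<close> matrices over the
  group ring.\<close>

sublocale group_matrix \<subseteq> right_transversal G "carrier G \<times> {..<n}" "\<lambda>p h. (fst p \<otimes> h, snd p)" "{\<one>} \<times> {..<n}"
  by unfold_locales (auto simp: m_assoc)

context group_matrix
begin

abbreviation "CC \<equiv> carrier G \<times> {..<n}"

lemma FinI:
  assumes "M \<in> Eq" "\<And>p q. ent M p q \<noteq> 0 \<Longrightarrow> p \<in> CC" shows "M \<in> Fin"
  unfolding Fin_def using assms rp(1) by (auto intro!: exI[of _ "{\<one>} \<times> {..<n}"])

lemma Fin_supp: "M \<in> Fin \<Longrightarrow> ent M p q \<noteq> 0 \<Longrightarrow> p \<in> CC \<and> q \<in> CC"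
  using Fin_rows by blast

lemma tr_eq: "tr M = (\<Sum>i<n. ent M (\<one>, i) (\<one>, i))"
proof -
  have "tr M = (\<Sum>s\<in>{\<one>} \<times> {..<n}. ent M s s)" by (rule tr_sum) auto
  also have "\<dots> = (\<Sum>i<n. ent M (\<one>, i) (\<one>, i))"
    by (rule sum.reindex_bij_witness[of _ "\<lambda>i. (\<one>, i)" snd]) auto
  finally show ?thesis .
qed

lemma Fin_coef:
  assumes "M \<in> Fin" "x \<in> carrier G" "y \<in> carrier G" "i < n" "j < n"
  shows "ent M (x, i) (y, j) = ent M (x \<otimes> inv y, i) (\<one>, j)"
  using EqD(2)[OF Fin_Eq[OF assms(1)], of "(x \<otimes> inv y, i)" "(\<one>, j)" y] assms by (simp add: m_assoc)

lemma conv_op_app: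
  assumes M: "M \<in> Fin" and c: "fin_matrix G n c"
    and ent: "\<And>x y i j. x \<in> carrier G \<Longrightarrow> y \<in> carrier G \<Longrightarrow> i < n \<Longrightarrow> j < n \<Longrightarrow>
      ent M (x, i) (y, j) = c i j (x \<otimes> inv y)"
  shows "conv_op G n c f = app M f"
proof
  fix p :: "'g \<times> nat"
  obtain x i where p: "p = (x, i)" by fastforce
  show "conv_op G n c f p = app M f p"
  proof (cases "x \<in> carrier G \<and> i < n")
    case True
    then have x: "x \<in> carrier G" and i: "i < n" by auto
    let ?S = "Sigma {..<n} (\<lambda>j. {g\<in>carrier G. c i j g \<noteq> 0})"
    have q: "q \<in> CC" if "ent M (x, i) q \<noteq> 0" for q using Fin_supp[OF M that] by simp
    have "conv_op G n c f p = (\<Sum>j<n. \<Sum>g\<in>{g\<in>carrier G. c i j g \<noteq> 0}. c i j g * f (inv g \<otimes> x, j))"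
      unfolding conv_op_def p using True by simp
    also have "\<dots> = (\<Sum>(j, g)\<in>?S. c i j g * f (inv g \<otimes> x, j))"
      by (rule sum.Sigma) (use c in \<open>auto simp: fin_matrix_def\<close>)
    also have "\<dots> = (\<Sum>q\<in>{q. ent M (x, i) q \<noteq> 0}. ent M (x, i) q * f q)"
    \<comment> \<open>For row \<open>(x, i)\<close> the group element \<open>g\<close> with matrix
      index \<open>j\<close> corresponds to column \<open>(g^-1 x, j)\<close>.\<close>
    proof (rule sum.reindex_bij_witness[of _ "\<lambda>q. (snd q, x \<otimes> inv (fst q))" "\<lambda>(j, g). (inv g \<otimes> x, j)"])
      fix a assume "a \<in> ?S"
      then obtain j g where a: "a = (j, g)" "j < n" "g \<in> carrier G" "c i j g \<noteq> 0" by auto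
      have xg: "x \<otimes> inv (inv g \<otimes> x) = g" using x a by (simp add: inv_mult_group m_assoc[symmetric])
      show "(\<lambda>q. (snd q, x \<otimes> inv (fst q))) ((\<lambda>(j, g). (inv g \<otimes> x, j)) a) = a" using a xg by simp
      have e: "ent M (x, i) (inv g \<otimes> x, j) = c i j g" using ent[of x "inv g \<otimes> x" i j] x i a xg by simp
      show "(\<lambda>(j, g). (inv g \<otimes> x, j)) a \<in> {q. ent M (x, i) q \<noteq> 0}" using a e by simp
      show "ent M (x, i) ((\<lambda>(j, g). (inv g \<otimes> x, j)) a) * f ((\<lambda>(j, g). (inv g \<otimes> x, j)) a) = (case a of (j, g) \<Rightarrow> c i j g * f (inv g \<otimes> x, j))"
        using a e by simp
    next
      fix b assume b: "b \<in> {q. ent M (x, i) q \<noteq> 0}"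
      then obtain y j where y: "b = (y, j)" "y \<in> carrier G" "j < n" using q[of b] by auto
      have "inv (x \<otimes> inv y) \<otimes> x = y" using x y by (simp add: inv_mult_group m_assoc)
      then show "(\<lambda>(j, g). (inv g \<otimes> x, j)) (snd b, x \<otimes> inv (fst b)) = b" using y by simp
      show "(snd b, x \<otimes> inv (fst b)) \<in> ?S" using b y ent[of x y i j] x i by simp
    qed
    finally show ?thesis unfolding app_def p .
  next
    case False
    have e: "{q. ent M (x, i) q \<noteq> 0} = {}" using Fin_supp[OF M] False by auto
    show ?thesis unfolding conv_op_def app_def p e using False by auto
  qed
qed

lemma fin_matrix_coef:
  assumes "M \<in> Fin" shows "fin_matrix G n (\<lambda>i j g. ent M (g, i) (\<one>, j))"
  unfolding fin_matrix_def
proof (intro allI)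
  fix i j
  have "finite (fst ` {p. ent M p (\<one>, j) \<noteq> 0})" by (intro finite_imageI ent_col)
  moreover have "{g \<in> carrier G. ent M (g, i) (\<one>, j) \<noteq> 0} \<subseteq> fst ` {p. ent M p (\<one>, j) \<noteq> 0}" by force
  ultimately show "finite {g \<in> carrier G. ent M (g, i) (\<one>, j) \<noteq> 0}" by (rule finite_subset[rotated])
qed

lemma conv_op_coef:
  assumes "M \<in> Fin" shows "conv_op G n (\<lambda>i j g. ent M (g, i) (\<one>, j)) f = app M f"
  by (rule conv_op_app[OF assms fin_matrix_coef[OF assms]]) (rule Fin_coef[OF assms])

text \<open>The entry at \<open>(p, q)\<close> depends only on the two matrix indices and on
  \<open>fst p \<otimes> inv (fst q)\<close>. For fixed \<open>p\<close> this triple determines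
  \<open>q\<close>, and conversely, while nonzero entries have their triple in the finite set
  \<open>A\<close>. Hence rows and columns have at most \<open>card A\<close> nonzero entries and
  the Schur test applies.\<close>

lemma ex_bmat_conv_op:
  assumes c: "fin_matrix G n c" shows "\<exists>M\<in>Fin. \<forall>f. conv_op G n c f = app M f"
proof -
  define P where "P = (\<lambda>p q. if p \<in> CC \<and> q \<in> CC then c (snd p) (snd q) (fst p \<otimes> inv (fst q)) else 0)"
  define A where "A = (\<Union>i<n. \<Union>j<n. (\<lambda>g. (i, j, g)) ` {g\<in>carrier G. c i j g \<noteq> 0})"
  have A: "finite A" unfolding A_def using c by (auto simp: fin_matrix_def)
  have PA: "(snd p, snd q, fst p \<otimes> inv (fst q)) \<in> A \<and> p \<in> CC \<and> q \<in> CC" if "P p q \<noteq> 0" for p q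
  proof -
    have "p \<in> CC" "q \<in> CC" "c (snd p) (snd q) (fst p \<otimes> inv (fst q)) \<noteq> 0"
      using that unfolding P_def by (auto split: if_splits)
    then show ?thesis unfolding A_def mem_Times_iff
      by (intro conjI UN_I[of "snd p"] UN_I[of "snd q"] image_eqI[of _ _ "fst p \<otimes> inv (fst q)"]) simp_all
  qed
  have injr: "inj_on (\<lambda>q. (snd p, snd q, fst p \<otimes> inv (fst q))) {q. P p q \<noteq> 0}" for p
  proof (rule inj_onI)
    fix q q' assume q: "q \<in> {q. P p q \<noteq> 0}" "q' \<in> {q. P p q \<noteq> 0}"
      and eq: "(snd p, snd q, fst p \<otimes> inv (fst q)) = (snd p, snd q', fst p \<otimes> inv (fst q'))"
    have C: "p \<in> CC" "q \<in> CC" "q' \<in> CC" using PA[of p q] PA[of p q'] q by auto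
    have "inv (fst q) = inv (fst q')" using eq C by auto
    then have "fst q = fst q'" using C by (auto dest: inv_inj[THEN inj_onD])
    then show "q = q'" using eq by (simp add: prod_eq_iff)
  qed
  have injc: "inj_on (\<lambda>p. (snd p, snd q, fst p \<otimes> inv (fst q))) {p. P p q \<noteq> 0}" for q
  proof (rule inj_onI)
    fix p p' assume p: "p \<in> {p. P p q \<noteq> 0}" "p' \<in> {p. P p q \<noteq> 0}"
      and eq: "(snd p, snd q, fst p \<otimes> inv (fst q)) = (snd p', snd q, fst p' \<otimes> inv (fst q))"
    have C: "q \<in> CC" "p \<in> CC" "p' \<in> CC" using PA[of p q] PA[of p' q] p by auto
    then have "fst p = fst p'" using eq by auto
    then show "p = p'" using eq by (simp add: prod_eq_iff)
  qed
  have sr: "(\<lambda>q. (snd p, snd q, fst p \<otimes> inv (fst q))) ` {q. P p q \<noteq> 0} \<subseteq> A" for p using PA by auto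
  have sc: "(\<lambda>p. (snd p, snd q, fst p \<otimes> inv (fst q))) ` {p. P p q \<noteq> 0} \<subseteq> A" for q using PA by auto
  have row: "finite {q. P p q \<noteq> 0}" "card {q. P p q \<noteq> 0} \<le> card A" for p
    using inj_on_finite[OF injr sr A] card_inj_on_le[OF injr sr A] by auto
  have col: "finite {p. P p q \<noteq> 0}" "card {p. P p q \<noteq> 0} \<le> card A" for q
    using inj_on_finite[OF injc sc A] card_inj_on_le[OF injc sc A] by auto
  have K: "cmod (P p q) \<le> (\<Sum>(i, j, g)\<in>A. cmod (c i j g))" for p q
  proof (cases "P p q = 0")
    case True
    then show ?thesis by (auto intro!: sum_nonneg)
  next
    case False
    have "cmod (P p q) = (\<lambda>(i, j, g). cmod (c i j g)) (snd p, snd q, fst p \<otimes> inv (fst q))"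
      using PA[OF False] by (simp add: P_def)
    also have "\<dots> \<le> (\<Sum>(i, j, g)\<in>A. cmod (c i j g))"
      by (rule member_le_sum) (use PA[OF False] A in auto)
    finally show ?thesis .
  qed
  have "\<exists>c. mbound P c" using mbound_schur[OF K row col] by blast
  then have "P \<in> {M. (\<forall>s. finite {t. M s t \<noteq> 0}) \<and> (\<forall>t. finite {s. M s t \<noteq> 0}) \<and> (\<exists>c. mbound M c)}"
    unfolding mem_Collect_eq by (intro conjI allI row col)
  then have ent: "ent (Bmat P) = P" by (rule Bmat_inverse)
  have "Bmat P \<in> Eq"
  proof (rule EqI)
    fix s t assume "ent (Bmat P) s t \<noteq> 0"
    then show "(s \<in> CC) = (t \<in> CC)" unfolding ent using PA by blast
  next
    fix s t h assume st: "s \<in> CC" "t \<in> CC" and h: "h \<in> carrier G"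
    have "fst s \<otimes> h \<otimes> inv (fst t \<otimes> h) = fst s \<otimes> inv (fst t)"
    proof -
      have "fst s \<otimes> h \<otimes> inv (fst t \<otimes> h) = fst s \<otimes> (h \<otimes> (inv h \<otimes> inv (fst t)))"
        using st h by (auto simp: inv_mult_group m_assoc)
      also have "h \<otimes> (inv h \<otimes> inv (fst t)) = inv (fst t)"
        using st h by (auto simp: m_assoc[symmetric])
      finally show ?thesis .
    qed
    then show "ent (Bmat P) (fst s \<otimes> h, snd s) (fst t \<otimes> h, snd t) = ent (Bmat P) s t"
      unfolding ent unfolding P_def using st h by auto
  qed
  then have F: "Bmat P \<in> Fin" by (rule FinI) (use PA ent in auto)
  moreover have "conv_op G n c f = app (Bmat P) f" for f
    by (rule conv_op_app[OF F c], unfold ent) (simp add: P_def)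
  ultimately show ?thesis by blast
qed

lemma l2I: "sq f \<Longrightarrow> (\<And>p. f p \<noteq> 0 \<Longrightarrow> fst p \<in> carrier G \<and> snd p < n) \<Longrightarrow> f \<in> l2 G n"
  unfolding l2_def sq_def by blast

lemma app_l2: assumes "M \<in> Fin" "sq f" shows "app M f \<in> l2 G n"
proof -
  have "fst p \<in> carrier G \<and> snd p < n" if nz: "app M f p \<noteq> 0" for p
  proof -
    obtain q where "ent M p q * f q \<noteq> 0"
      using nz unfolding app_def by (rule sum.not_neutral_contains_not_neutral)
    then show ?thesis using Fin_supp[OF assms(1), of p q] unfolding mem_Times_iff by simp
  qed
  then show ?thesis by (rule l2I[OF app_bound(1)[OF assms(2)]])
qed

lemma l2_diff: assumes "f \<in> l2 G n" "g \<in> l2 G n" shows "(\<lambda>p. f p - g p) \<in> l2 G n"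
proof -
  have "sq (\<lambda>p. f p - g p)" using assms by (intro l2_norm_diff l2_sq)
  moreover have "fst p \<in> carrier G \<and> snd p < n" if "f p - g p \<noteq> 0" for p
  proof -
    have "f p \<noteq> 0 \<or> g p \<noteq> 0" using that by auto
    then show ?thesis using assms unfolding l2_def by blast
  qed
  ultimately show ?thesis by (rule l2I)
qed

text \<open>Since \<open>M\<close> vanishes outside the index set, test vectors may be cut down to
  it, where they lie in \<open>l2 G n\<close>.\<close>

lemma norm_le_app:
  assumes M: "M \<in> Fin" and c: "0 \<le> c" "\<And>f. f \<in> l2 G n \<Longrightarrow> l2_norm (app M f) \<le> c * l2_norm f"
  shows "norm M \<le> c"
proof (rule norm_bmat_le, rule mboundI[OF c(1)])
  fix S T :: "('g \<times> nat) set" and u :: "'g \<times> nat \<Rightarrow> complex" assume fin: "finite S" "finite T"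
  define f where "f = (\<lambda>p. if p \<in> T \<inter> CC then u p else 0)"
  have fT: "f p = 0" if "p \<notin> T" for p using that by (simp add: f_def)
  have sqf: "sq f" and nf: "l2_norm f = L2_set (\<lambda>p. cmod (f p)) T"
    using sq_finite[OF fin(2) fT] by auto
  have fl: "f \<in> l2 G n" using sqf unfolding l2_def sq_def by (auto simp: f_def split: if_splits)
  have eq: "app M f s = (\<Sum>t\<in>T. ent M s t * u t)" for s
  proof -
    have "app M f s = (\<Sum>t\<in>T. ent M s t * f t)" by (rule app_sum[OF fin(2)]) (use fT in auto)
    also have "\<dots> = (\<Sum>t\<in>T. ent M s t * u t)"
    proof (rule sum.cong[OF refl])
      fix t assume "t \<in> T"
      then show "ent M s t * f t = ent M s t * u t"
        using Fin_supp[OF M, of s t] by (cases "ent M s t = 0") (simp_all add: f_def)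
    qed
    finally show ?thesis .
  qed
  have "L2_set (\<lambda>s. cmod (\<Sum>t\<in>T. ent M s t * u t)) S \<le> l2_norm (app M f)"
    unfolding eq[symmetric] by (rule L2_set_le_l2_norm[OF app_bound(1)[OF sqf] fin(1)])
  also have "\<dots> \<le> c * L2_set (\<lambda>p. cmod (f p)) T" using c(2)[OF fl] nf by simp
  also have "\<dots> \<le> c * L2_set (\<lambda>t. cmod (u t)) T"
    by (intro mult_left_mono L2_set_mono c) (auto simp: f_def)
  finally show "L2_set (\<lambda>s. cmod (\<Sum>t\<in>T. ent M s t * u t)) S \<le> c * L2_set (\<lambda>t. cmod (u t)) T" .
qed

text \<open>Symmetry and idempotence give \<open><T f, T f> = <f, T f>\<close>; Cauchy-Schwarz does
  the rest.\<close>

lemma projection_contraction: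
  assumes T: "is_projection G n T" and f: "f \<in> l2 G n"
  shows "T f \<in> l2 G n" "l2_norm (T f) \<le> l2_norm f"
proof -
  show Tf: "T f \<in> l2 G n" using assms unfolding is_projection_def reduced_matrix_def by blast
  have "l2_inner (T f) (T f) = l2_inner f (T f)"
    using T f Tf unfolding is_projection_def by metis
  then have "(l2_norm (T f))\<^sup>2 \<le> l2_norm f * l2_norm (T f)"
    using l2_inner_self[OF l2_sq[OF Tf]] l2_inner_bound(2)[OF l2_sq[OF f] l2_sq[OF Tf]] by simp
  then show "l2_norm (T f) \<le> l2_norm f"
    using l2_norm_nonneg[of "T f"] l2_norm_nonneg[of f]
    by (cases "l2_norm (T f) = 0") (auto simp: power2_eq_square mult_le_cancel_right)
qed

lemma adj_Fin: assumes "M \<in> Fin" shows "adj M \<in> Fin"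
proof (rule FinI)
  show "adj M \<in> Eq"
    by (rule EqI) (use Fin_supp[OF assms] EqD(2)[OF Fin_Eq[OF assms]] in auto)
qed (use Fin_supp[OF assms] in auto)

section \<open>Self-adjoint group ring elements near a projection\<close>

definition approximates :: "('g \<times> nat) bmat \<Rightarrow> (('g \<times> nat \<Rightarrow> complex) \<Rightarrow> ('g \<times> nat \<Rightarrow> complex)) \<Rightarrow> real \<Rightarrow> bool" where
  "approximates M T e \<longleftrightarrow> M \<in> Fin \<and> (\<forall>f\<in>l2 G n. l2_norm (\<lambda>p. T f p - app M f p) \<le> e * l2_norm f)"

text \<open>The adjoint of an approximant is as good as the approximant: for
  \<open>v = T f - adj M f\<close>, symmetry of \<open>T\<close> gives
  \<open><v, v> = <f, T v - M v>\<close>, at most \<open>e\<close> times the norms of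
  \<open>f\<close> and \<open>v\<close>. Averaging the two keeps the error. Self-adjointness makes
  the later limit an orthogonal projection and confines columns together with rows.\<close>

lemma projection_approx:
  assumes T: "is_projection G n T" and e: "e > 0"
  shows "\<exists>M. approximates M T e \<and> adj M = M"
proof -
  obtain c where c: "fin_matrix G n c" "\<And>f. f \<in> l2 G n \<Longrightarrow> l2_norm (\<lambda>p. T f p - conv_op G n c f p) \<le> e * l2_norm f"
    using T e unfolding is_projection_def reduced_matrix_def by blast
  obtain M where M: "M \<in> Fin" "\<And>f. conv_op G n c f = app M f" using ex_bmat_conv_op[OF c(1)] by blast
  have 1: "l2_norm (\<lambda>p. T f p - app M f p) \<le> e * l2_norm f" if "f \<in> l2 G n" for f
    using c(2)[OF that] M(2) by simp
  have 2: "l2_norm (\<lambda>p. T f p - app (adj M) f p) \<le> e * l2_norm f" if f: "f \<in> l2 G n" for f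
  proof -
    define v where "v = (\<lambda>p. T f p - app (adj M) f p)"
    have Tf: "T f \<in> l2 G n" by (rule projection_contraction[OF T f])
    have v: "v \<in> l2 G n" unfolding v_def by (intro l2_diff Tf app_l2 adj_Fin M l2_sq[OF f])
    have Tv: "T v \<in> l2 G n" by (rule projection_contraction[OF T v])
    note s = l2_sq[OF f] l2_sq[OF v] l2_sq[OF Tf] l2_sq[OF Tv]
    have "l2_inner v v = l2_inner (T f) v - l2_inner (app (adj M) f) v"
      using l2_inner_diff_left[OF s(3) app_bound(1)[OF s(1)] s(2), of "adj M"] unfolding v_def .
    also have "\<dots> = l2_inner f (T v) - l2_inner f (app M v)"
      using app_adj[OF s(1) s(2), of "adj M"] T f v unfolding is_projection_def adj_adj by metis
    also have "\<dots> = l2_inner f (\<lambda>p. T v p - app M v p)"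
      by (rule l2_inner_diff_right[OF s(4) app_bound(1)[OF s(2)] s(1), symmetric])
    finally have "(l2_norm v)\<^sup>2 \<le> l2_norm f * l2_norm (\<lambda>p. T v p - app M v p)"
      using l2_inner_self[OF s(2)] l2_inner_bound(2)[OF s(1) l2_norm_diff(1)[OF s(4) app_bound(1)[OF s(2)]], of M] by simp
    also have "\<dots> \<le> l2_norm f * (e * l2_norm v)" by (intro mult_left_mono 1 v l2_norm_nonneg)
    finally have "l2_norm v * l2_norm v \<le> (e * l2_norm f) * l2_norm v"
      by (simp add: power2_eq_square mult_ac)
    then have "l2_norm v \<le> e * l2_norm f"
      using l2_norm_nonneg[of v] l2_norm_nonneg[of f] e
      by (cases "l2_norm v = 0") (auto simp: mult_le_cancel_right)
    then show ?thesis unfolding v_def .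
  qed
  define N where "N = (1/2) *\<^sub>R (M + adj M)"
  have MA: "M + adj M \<in> Fin" by (rule Fin_add(1)[OF M(1) adj_Fin[OF M(1)]])
  have NF: "N \<in> Fin" using mult_JE[OF MA scaleR_E[OF one_E, of "1/2"]] unfolding N_def by simp
  have Nadj: "adj N = N" unfolding N_def by (rule bmat_eqI) simp
  have appN: "app N f p = (1/2) * (app M f p + app (adj M) f p)" for f p
  proof -
    have K: "finite ({q. ent M p q \<noteq> 0} \<union> {q. ent (adj M) p q \<noteq> 0})" by (intro finite_UnI ent_row)
    have "app N f p = (\<Sum>q\<in>{q. ent M p q \<noteq> 0} \<union> {q. ent (adj M) p q \<noteq> 0}. ent N p q * f q)"
      by (rule app_sum[OF K]) (auto simp: N_def)
    moreover have "app M f p = (\<Sum>q\<in>{q. ent M p q \<noteq> 0} \<union> {q. ent (adj M) p q \<noteq> 0}. ent M p q * f q)"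
      "app (adj M) f p = (\<Sum>q\<in>{q. ent M p q \<noteq> 0} \<union> {q. ent (adj M) p q \<noteq> 0}. ent (adj M) p q * f q)"
      by (rule app_sum[OF K]; auto)+
    ultimately show ?thesis
      by (simp only: N_def ent_scaleR ent_simps sum.distrib[symmetric] sum_distrib_left)
        (simp add: algebra_simps)
  qed
  have "l2_norm (\<lambda>p. T f p - app N f p) \<le> e * l2_norm f" if f: "f \<in> l2 G n" for f
  proof -
    have sT: "sq (T f)" by (rule l2_sq[OF projection_contraction(1)[OF T f]])
    let ?a = "\<lambda>p. T f p - app M f p" and ?b = "\<lambda>p. T f p - app (adj M) f p"
    have s: "sq ?a" "sq ?b" by (intro l2_norm_diff sT app_bound l2_sq[OF f])+
    let ?z = "\<lambda>p. T f p - app N f p"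
    have z: "sq ?z" by (intro l2_norm_diff sT app_bound l2_sq[OF f])
    have "(\<lambda>p. ?z p + ?z p) = (\<lambda>p. ?a p + ?b p)" by (rule ext) (simp add: appN field_simps)
    then have "l2_norm (\<lambda>p. ?z p + ?z p) \<le> e * l2_norm f + e * l2_norm f"
      using l2_norm_add(2)[OF s] 1[OF f] 2[OF f] by simp
    moreover have "l2_norm (\<lambda>p. ?z p + ?z p) = 2 * l2_norm ?z"
    proof -
      have "(\<lambda>p. (cmod (?z p + ?z p))\<^sup>2) = (\<lambda>p. 4 * (cmod (?z p))\<^sup>2)"
        by (simp only: mult_2[symmetric] norm_mult power_mult_distrib) simp
      then show ?thesis unfolding l2_norm_def by (simp add: infsum_cmult_right' real_sqrt_mult)
    qed
    ultimately show ?thesis by simp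
  qed
  then show ?thesis using NF Nadj unfolding approximates_def by blast
qed

lemma approximates_diff:
  assumes "approximates M T a" "approximates N T b" "0 \<le> a" "0 \<le> b" "\<And>f. f \<in> l2 G n \<Longrightarrow> T f \<in> l2 G n"
  shows "norm (M - N) \<le> a + b"
proof (rule norm_le_app)
  show "M - N \<in> Fin" using assms unfolding approximates_def by (intro diff_J) auto
  fix f assume f: "f \<in> l2 G n"
  let ?a = "\<lambda>p. T f p - app M f p" and ?b = "\<lambda>p. T f p - app N f p"
  have s: "sq ?a" "sq ?b" by (intro l2_norm_diff l2_sq[OF assms(5)[OF f]] app_bound l2_sq[OF f])+
  have "app (M - N) f = (\<lambda>p. ?b p - ?a p)" by (rule ext) (simp add: app_diff_left)
  then have "l2_norm (app (M - N) f) \<le> l2_norm ?b + l2_norm ?a" using l2_norm_diff(2)[OF s(2,1)] by simp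
  also have "\<dots> \<le> b * l2_norm f + a * l2_norm f" using assms f unfolding approximates_def by (intro add_mono) auto
  finally show "l2_norm (app (M - N) f) \<le> (a + b) * l2_norm f" by (simp add: algebra_simps)
qed (use assms in auto)

lemma l2_inner_delta: "l2_inner (delta_vec G i) f = f (\<one>, i)"
proof -
  have "l2_inner (delta_vec G i) f = (\<Sum>\<^sub>\<infinity>p\<in>{(\<one>, i)}. cnj (delta_vec G i p) * f p)"
    unfolding l2_inner_def by (rule infsum_cong_neutral) (auto simp: delta_vec_def)
  then show ?thesis by (simp add: delta_vec_def)
qed

lemma delta_l2: assumes "i < n" shows "delta_vec G i \<in> l2 G n" "l2_norm (delta_vec G i) = 1"
proof -
  have 0: "delta_vec G i p = 0" if "p \<notin> {(\<one>, i)}" for p using that by (simp add: delta_vec_def)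
  have "sq (delta_vec G i)" by (rule sq_finite[of "{(\<one>, i)}", OF _ 0]) simp_all
  then show "delta_vec G i \<in> l2 G n" by (rule l2I) (use assms in \<open>auto simp: delta_vec_def split: if_splits\<close>)
  have "l2_norm (delta_vec G i) = L2_set (\<lambda>p. cmod (delta_vec G i p)) {(\<one>, i)}"
    by (rule sq_finite[of "{(\<one>, i)}", OF _ 0]) simp_all
  then show "l2_norm (delta_vec G i) = 1" by (simp add: delta_vec_def)
qed

lemma app_delta: "app M (delta_vec G i) p = ent M p (\<one>, i)"
  by (subst app_sum[of "{(\<one>, i)}"]) (auto simp: delta_vec_def)

lemma mat_trace_eq: "mat_trace G n T = (\<Sum>i<n. T (delta_vec G i) (\<one>, i))"
  unfolding mat_trace_def l2_inner_delta ..

lemma approximates_trace: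
  assumes "approximates M T e" "\<And>f. f \<in> l2 G n \<Longrightarrow> T f \<in> l2 G n"
  shows "cmod (mat_trace G n T - tr M) \<le> real n * e"
proof -
  have "cmod (T (delta_vec G i) (\<one>, i) - ent M (\<one>, i) (\<one>, i)) \<le> e" if i: "i < n" for i
  proof -
    let ?z = "\<lambda>p. T (delta_vec G i) p - app M (delta_vec G i) p"
    note d = delta_l2[OF i]
    have "sq ?z" by (intro l2_norm_diff l2_sq[OF assms(2)[OF d(1)]] app_bound l2_sq[OF d(1)])
    then have "cmod (?z (\<one>, i)) \<le> l2_norm ?z" by (rule cmod_le_l2_norm)
    also have "\<dots> \<le> e * l2_norm (delta_vec G i)" using assms(1) d(1) unfolding approximates_def by blast
    finally show ?thesis using d(2) by (simp add: app_delta)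
  qed
  then have "cmod (\<Sum>i<n. T (delta_vec G i) (\<one>, i) - ent M (\<one>, i) (\<one>, i)) \<le> (\<Sum>i<n. e)"
    by (intro sum_norm_le) auto
  then show ?thesis unfolding mat_trace_eq tr_eq by (simp add: sum_subtractf)
qed

text \<open>With \<open>z = T f - M f\<close> and \<open>y = T f - M (T f)\<close> one has
  \<open>M f - M (M f) = y - z + M z\<close>, of norm at most \<open>(3 + e) * e\<close> times that
  of \<open>f\<close>.\<close>

lemma approximates_near:
  assumes T: "is_projection G n T" and M: "approximates M T e" and e: "0 \<le> e" "100 * (4*e) \<le> 1"
  shows "near (3/2) (4*e) M"
proof -
  have MF: "M \<in> Fin" using M unfolding approximates_def by blast
  have ap: "l2_norm (\<lambda>p. T f p - app M f p) \<le> e * l2_norm f" if "f \<in> l2 G n" for f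
    using M that unfolding approximates_def by blast
  have nM: "norm M \<le> 1 + e"
  proof (rule norm_le_app[OF MF])
    fix f assume f: "f \<in> l2 G n"
    let ?z = "\<lambda>p. T f p - app M f p"
    have sT: "sq (T f)" by (rule l2_sq[OF projection_contraction(1)[OF T f]])
    have z: "sq ?z" by (intro l2_norm_diff sT app_bound l2_sq[OF f])
    have "app M f = (\<lambda>p. T f p - ?z p)" by simp
    then have "l2_norm (app M f) \<le> l2_norm (T f) + l2_norm ?z" using l2_norm_diff(2)[OF sT z] by simp
    then show "l2_norm (app M f) \<le> (1 + e) * l2_norm f"
      using ap[OF f] projection_contraction(2)[OF T f] by (simp add: algebra_simps)
  qed (use e in simp)
  have "norm (defect M) \<le> 4*e"
  proof (rule norm_le_app)
    show "defect M \<in> Fin" unfolding defect_def by (intro diff_J MF mult_JE Fin_Eq)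
    fix f assume f: "f \<in> l2 G n"
    have Tf: "T f \<in> l2 G n" and nT: "l2_norm (T f) \<le> l2_norm f" using projection_contraction[OF T f] by auto
    have TT: "T (T f) = T f" using T f unfolding is_projection_def by blast
    let ?z = "\<lambda>p. T f p - app M f p" and ?y = "\<lambda>p. T (T f) p - app M (T f) p"
    have zl: "?z \<in> l2 G n" by (intro l2_diff Tf app_l2 MF l2_sq[OF f])
    have z: "sq ?z" by (rule l2_sq[OF zl])
    have y: "sq ?y" unfolding TT by (intro l2_norm_diff app_bound l2_sq[OF Tf])
    have Mz: "sq (app M ?z)" by (rule app_bound[OF z])
    have "app (defect M) f = (\<lambda>p. (?y p - ?z p) + app M ?z p)"
      by (rule ext) (simp add: defect_def app_diff_left app_mult app_diff_right TT)
    then have "l2_norm (app (defect M) f) \<le> (l2_norm ?y + l2_norm ?z) + l2_norm (app M ?z)"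
      using l2_norm_add(2)[OF l2_norm_diff(1)[OF y z] Mz] l2_norm_diff(2)[OF y z] by simp
    also have "\<dots> \<le> (e * l2_norm f + e * l2_norm f) + (1 + e) * (e * l2_norm f)"
    proof (intro add_mono ap f)
      show "l2_norm ?y \<le> e * l2_norm f"
        using ap[OF Tf] mult_left_mono[OF nT e(1)] by linarith
      show "l2_norm (app M ?z) \<le> (1 + e) * (e * l2_norm f)"
        by (rule order_trans[OF app_bound(2)[OF z] mult_mono[OF nM ap[OF f]]])
          (use e l2_norm_nonneg in auto)
    qed
    also have "\<dots> = (3 + e) * e * l2_norm f" by (simp add: algebra_simps)
    also have "\<dots> \<le> (4 * e) * l2_norm f"
      using e l2_norm_nonneg[of f] by (intro mult_right_mono) auto
    finally show "l2_norm (app (defect M) f) \<le> (4 * e) * l2_norm f" .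
  qed (use e in simp)
  then show ?thesis using nM e Fin_Eq[OF MF] unfolding near_def by simp
qed

lemma step_Fin: "M \<in> Fin \<Longrightarrow> step M \<in> Fin"
  unfolding step_def by (intro diff_J add_J mult_JE Fin_Eq)

lemma step_pow_Fin: "M \<in> Fin \<Longrightarrow> (step^^k) M \<in> Fin"
  by (induction k) (simp_all add: step_Fin)

lemma tr_diff_le:
  assumes "norm (M - N) \<le> c" shows "cmod (tr M - tr N) \<le> real n * c"
proof -
  have "cmod (\<Sum>i<n. ent (M - N) (\<one>, i) (\<one>, i)) \<le> (\<Sum>i<n. c)"
    by (intro sum_norm_le order_trans[OF norm_ent assms])
  then show ?thesis unfolding tr_eq by (simp add: sum_subtractf)
qed

text \<open>The iterates of \<open>M\<close> approach a projection near \<open>T\<close> that may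
  differ from \<open>T\<close>, so the exact limit of the traces has to come from elsewhere. A finer
  approximant \<open>N\<close> of error \<open>b\<close> is close to \<open>M\<close> in norm, hence
  has asymptotically the same traces, and these stay within \<open>43*n*b\<close> of the trace of
  \<open>T\<close>: \<open>42 = 4*7*(3/2)\<close> for the drift and 1 for the approximation.\<close>

theorem tr_step_pow_projection:
  assumes T: "is_projection G n T" and M: "approximates M T e" and e: "0 < e" "10^4 * e \<le> 1"
  shows "(\<lambda>k. tr ((step^^k) M)) \<longlonglongrightarrow> mat_trace G n T"
proof -
  note Tl = projection_contraction(1)[OF T]
  have MF: "M \<in> Fin" using M unfolding approximates_def by blast
  have main: "\<forall>\<^sub>F k in sequentially. cmod (tr ((step^^k) M) - mat_trace G n T) < b * (1 + 43 * real n)" if b: "0 < b" "b \<le> e" for b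
  proof -
    obtain N where N: "approximates N T b" using projection_approx[OF T b(1)] by blast
    have NF: "N \<in> Fin" using N unfolding approximates_def by blast
    have nM: "near (3/2) (4*e) M" using e by (intro approximates_near[OF T M]) auto
    have nN: "near (3/2) (4*b) N" using e b by (intro approximates_near[OF T N]) auto
    then have nN': "near (3/2) (4*e) N" using nM b unfolding near_def by auto
    have "norm (M - N) \<le> e + b" using e b by (intro approximates_diff[OF M N] Tl) auto
    \<comment> \<open>The matrices themselves lie in the ideal here, so the reference idempotent is
      0.\<close>
    then have "(\<lambda>k. tr ((step^^k) M - (step^^k) N)) \<longlonglongrightarrow> 0"
      using e b MF NF closed(6) by (intro tr_step_pow_diff_tendsto_0[of 0, OF _ _ nM _ nN']) (auto intro: J_E)
    then have "\<forall>\<^sub>F k in sequentially. cmod (tr ((step^^k) M - (step^^k) N)) < b"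
      using b by (auto dest: tendstoD simp: dist_norm)
    then show ?thesis
    proof (rule eventually_mono)
      fix k assume k: "cmod (tr ((step^^k) M - (step^^k) N)) < b"
      have 1: "cmod (tr ((step^^k) M) - tr ((step^^k) N)) < b"
        using k tr_diff[OF step_pow_Fin[OF MF] step_pow_Fin[OF NF], of k k] by simp
      have 2: "cmod (tr ((step^^k) N) - tr N) \<le> real n * (42 * b)"
        using near_pow(2)[OF nN, of k] by (intro tr_diff_le) simp
      have 3: "cmod (mat_trace G n T - tr N) \<le> real n * b" by (rule approximates_trace[OF N Tl])
      have "cmod (tr ((step^^k) M) - mat_trace G n T) \<le> cmod (tr ((step^^k) M) - tr ((step^^k) N))
         + cmod (tr ((step^^k) N) - tr N) + cmod (mat_trace G n T - tr N)" by norm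
      then show "cmod (tr ((step^^k) M) - mat_trace G n T) < b * (1 + 43 * real n)"
        using 1 2 3 by (simp add: algebra_simps)
    qed
  qed
  show ?thesis
  proof (rule tendstoI)
    fix a :: real assume a: "0 < a"
    let ?b = "min e (a / (1 + 43 * real n))"
    have b: "0 < ?b" "?b \<le> e" "?b * (1 + 43 * real n) \<le> a"
    proof -
      have "?b * (1 + 43 * real n) \<le> a / (1 + 43 * real n) * (1 + 43 * real n)"
        by (intro mult_right_mono) auto
      then show "?b * (1 + 43 * real n) \<le> a" by simp
    qed (use e a in auto)
    show "\<forall>\<^sub>F k in sequentially. dist (tr ((step^^k) M)) (mat_trace G n T) < a"
      using main[OF b(1,2)] by (rule eventually_mono) (use b(3) in \<open>simp add: dist_norm\<close>)
  qed
qed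

text \<open>The sequence need not converge in the matrix type, so its limit is formed as an
  operator, one coordinate at a time. The trace is a finite sum of coordinates and therefore passes
  to the limit.\<close>

theorem projection_limit:
  fixes Z :: "nat \<Rightarrow> ('g \<times> nat) bmat"
  assumes Z: "\<And>k. Z k \<in> Fin" "\<And>k. adj (Z k) = Z k" and C: "Cauchy Z" and d: "(\<lambda>k. defect (Z k)) \<longlonglongrightarrow> 0"
  shows "\<exists>T. is_projection G n T \<and> (\<lambda>k. tr (Z k)) \<longlonglongrightarrow> mat_trace G n T"
proof -
  define T where "T = (\<lambda>f p. lim (\<lambda>k. app (Z k) f p))"
  have Cd: "\<exists>K. \<forall>j\<ge>K. \<forall>k\<ge>K. norm (Z j - Z k) \<le> e" if "e > 0" for e
    using C that unfolding Cauchy_def dist_norm by (meson less_imp_le)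
  have df: "cmod (app (Z j) f p - app (Z k) f p) \<le> norm (Z j - Z k) * l2_norm f" if "sq f" for f p j k
    using cmod_le_l2_norm[OF app_bound(1)[OF that, of "Z j - Z k"], of p] app_bound(2)[OF that, of "Z j - Z k"]
    by (simp add: app_diff_left)
  have lim: "(\<lambda>k. app (Z k) f p) \<longlonglongrightarrow> T f p" if f: "sq f" for f p
  proof -
    have "Cauchy (\<lambda>k. app (Z k) f p)"
    proof (rule metric_CauchyI)
      fix e :: real assume e: "e > 0"
      let ?e = "e / (l2_norm f + 1)"
      have n0: "0 \<le> l2_norm f" by (rule l2_norm_nonneg)
      then have "?e > 0" using e by simp
      then obtain K where K: "\<And>j k. j \<ge> K \<Longrightarrow> k \<ge> K \<Longrightarrow> norm (Z j - Z k) \<le> ?e" using Cd by blast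
      have "dist (app (Z j) f p) (app (Z k) f p) < e" if "j \<ge> K" "k \<ge> K" for j k
      proof -
        have "cmod (app (Z j) f p - app (Z k) f p) \<le> ?e * l2_norm f"
          using df[OF f, of j p k] mult_right_mono[OF K[OF that] n0] by linarith
        also have "\<dots> < e" using e n0 by (simp add: field_simps)
        finally show ?thesis by (simp add: dist_norm)
      qed
      then show "\<exists>M. \<forall>m\<ge>M. \<forall>n\<ge>M. dist (app (Z m) f p) (app (Z n) f p) < e" by blast
    qed
    then show ?thesis unfolding T_def by (simp add: Cauchy_convergent_iff convergent_LIMSEQ_iff)
  qed
  \<comment> \<open>Coordinatewise convergence carries the bound for \<open>Z k - Z j\<close> to the
    limit in \<open>k\<close> on every finite set of coordinates, which bounds the whole
    norm.\<close>
  have T1: "sq (\<lambda>p. T f p - app (Z j) f p)" "l2_norm (\<lambda>p. T f p - app (Z j) f p) \<le> e * l2_norm f"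
    if f: "sq f" and e: "0 \<le> e" and K: "\<And>k. k \<ge> j \<Longrightarrow> norm (Z k - Z j) \<le> e" for f e j
  proof -
    have "L2_set (\<lambda>p. cmod (T f p - app (Z j) f p)) S \<le> e * l2_norm f" if S: "finite S" for S
    proof -
      have "(\<lambda>k. L2_set (\<lambda>p. cmod (app (Z k) f p - app (Z j) f p)) S) \<longlonglongrightarrow> L2_set (\<lambda>p. cmod (T f p - app (Z j) f p)) S"
        unfolding L2_set_def by (intro tendsto_intros lim f)
      moreover have "L2_set (\<lambda>p. cmod (app (Z k) f p - app (Z j) f p)) S \<le> e * l2_norm f" if "k \<ge> j" for k
      proof -
        have "L2_set (\<lambda>p. cmod (app (Z k) f p - app (Z j) f p)) S \<le> l2_norm (app (Z k - Z j) f)"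
          using L2_set_le_l2_norm[OF app_bound(1)[OF f, of "Z k - Z j"] S] by (simp add: app_diff_left)
        also have "\<dots> \<le> norm (Z k - Z j) * l2_norm f" by (rule app_bound[OF f])
        also have "\<dots> \<le> e * l2_norm f" by (intro mult_right_mono K that l2_norm_nonneg)
        finally show ?thesis .
      qed
      ultimately show ?thesis by (intro LIMSEQ_le_const2) blast+
    qed
    then show "sq (\<lambda>p. T f p - app (Z j) f p)" "l2_norm (\<lambda>p. T f p - app (Z j) f p) \<le> e * l2_norm f"
      using l2_norm_leI[of "e * l2_norm f" "\<lambda>p. T f p - app (Z j) f p"] e l2_norm_nonneg[of f] by auto
  qed
  have Tsq: "sq (T f)" if f: "sq f" for f
  proof -
    obtain K where K: "\<And>j k. j \<ge> K \<Longrightarrow> k \<ge> K \<Longrightarrow> norm (Z j - Z k) \<le> 1" using Cd[of 1] by auto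
    have "sq (\<lambda>p. (T f p - app (Z K) f p) + app (Z K) f p)"
      by (intro l2_norm_add T1(1)[OF f, of 1 K] app_bound f K) auto
    then show ?thesis by simp
  qed
  have Tl: "T f \<in> l2 G n" if f: "f \<in> l2 G n" for f
  proof (rule l2I[OF Tsq[OF l2_sq[OF f]]])
    fix p assume nz: "T f p \<noteq> 0"
    show "fst p \<in> carrier G \<and> snd p < n"
    proof (rule ccontr)
      assume "\<not> (fst p \<in> carrier G \<and> snd p < n)"
      then have "app (Z k) f p = 0" for k using app_l2[OF Z(1)[of k] l2_sq[OF f]] unfolding l2_def by blast
      then have "(\<lambda>k. 0) \<longlonglongrightarrow> T f p" using lim[OF l2_sq[OF f], of p] by simp
      then show False using nz by (simp add: LIMSEQ_const_iff)
    qed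
  qed
  have Tlim: "(\<lambda>k. l2_norm (\<lambda>p. T f p - app (Z k) f p)) \<longlonglongrightarrow> 0" if f: "sq f" for f
  proof (rule LIMSEQ_I)
    fix r :: real assume r: "0 < r"
    let ?e = "r / (l2_norm f + 1)"
    have n0: "0 \<le> l2_norm f" by (rule l2_norm_nonneg)
    have e: "?e > 0" using r n0 by simp
    then obtain K where K: "\<And>j k. j \<ge> K \<Longrightarrow> k \<ge> K \<Longrightarrow> norm (Z j - Z k) \<le> ?e" using Cd by blast
    have "l2_norm (\<lambda>p. T f p - app (Z k) f p) < r" if "k \<ge> K" for k
    proof -
      have "l2_norm (\<lambda>p. T f p - app (Z k) f p) \<le> ?e * l2_norm f"
        using that e by (intro T1(2)[OF f] K) auto
      also have "\<dots> < r" using r n0 by (simp add: field_simps)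
      finally show ?thesis .
    qed
    then show "\<exists>no. \<forall>k\<ge>no. norm (l2_norm (\<lambda>p. T f p - app (Z k) f p) - 0) < r"
      using l2_norm_nonneg by (metis abs_of_nonneg diff_zero real_norm_def)
  qed
  have red: "reduced_matrix G n T"
    unfolding reduced_matrix_def
  proof (intro conjI ballI allI impI Tl)
    fix e :: real assume e: "e > 0"
    then obtain K where K: "\<And>j k. j \<ge> K \<Longrightarrow> k \<ge> K \<Longrightarrow> norm (Z j - Z k) \<le> e" using Cd by blast
    show "\<exists>c. fin_matrix G n c \<and> (\<forall>f\<in>l2 G n. l2_norm (\<lambda>p. T f p - conv_op G n c f p) \<le> e * l2_norm f)"
    proof (intro exI[of _ "\<lambda>i j g. ent (Z K) (g, i) (\<one>, j)"] conjI ballI)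
      show "fin_matrix G n (\<lambda>i j g. ent (Z K) (g, i) (\<one>, j))" by (rule fin_matrix_coef[OF Z(1)])
      fix f assume "f \<in> l2 G n"
      then show "l2_norm (\<lambda>p. T f p - conv_op G n (\<lambda>i j g. ent (Z K) (g, i) (\<one>, j)) f p) \<le> e * l2_norm f"
        unfolding conv_op_coef[OF Z(1)[of K]] using e by (intro T1(2) l2_sq K) auto
    qed
  qed
  obtain B where B: "\<And>k. norm (Z k) \<le> B" using Cauchy_Bseq[OF C] unfolding Bseq_def by blast
  have idem: "T (T f) = T f" if f: "f \<in> l2 G n" for f
  proof
    fix p
    have s: "sq f" "sq (T f)" using f by (auto intro: l2_sq Tl)
    let ?z = "\<lambda>k p. T f p - app (Z k) f p" and ?y = "\<lambda>k p. T (T f) p - app (Z k) (T f) p"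
    have z: "sq (?z k)" and y: "sq (?y k)" for k by (intro l2_norm_diff Tsq app_bound s)+
    have le: "cmod (T (T f) p - T f p) \<le> l2_norm (?y k) + B * l2_norm (?z k) + norm (defect (Z k)) * l2_norm f + l2_norm (?z k)" for k
    proof -
      have "T (T f) p - T f p = ?y k p + app (Z k) (?z k) p - app (defect (Z k)) f p - ?z k p"
        by (simp add: defect_def app_diff_left app_mult app_diff_right)
      also have "cmod \<dots> \<le> cmod (?y k p) + cmod (app (Z k) (?z k) p) + cmod (app (defect (Z k)) f p) + cmod (?z k p)"
        by norm
      also have "\<dots> \<le> l2_norm (?y k) + B * l2_norm (?z k) + norm (defect (Z k)) * l2_norm f + l2_norm (?z k)"
      proof (intro add_mono cmod_le_l2_norm z y)
        show "cmod (app (Z k) (?z k) p) \<le> B * l2_norm (?z k)"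
          by (rule order_trans[OF cmod_le_l2_norm[OF app_bound(1)[OF z]] order_trans[OF app_bound(2)[OF z] mult_right_mono[OF B l2_norm_nonneg]]])
        show "cmod (app (defect (Z k)) f p) \<le> norm (defect (Z k)) * l2_norm f"
          by (rule order_trans[OF cmod_le_l2_norm[OF app_bound(1)[OF s(1)]] app_bound(2)[OF s(1)]])
      qed
      finally show ?thesis .
    qed
    have "(\<lambda>k. l2_norm (?y k) + B * l2_norm (?z k) + norm (defect (Z k)) * l2_norm f + l2_norm (?z k)) \<longlonglongrightarrow> 0 + B * 0 + 0 * l2_norm f + 0"
      by (intro tendsto_intros Tlim s tendsto_norm_zero d)
    then have "cmod (T (T f) p - T f p) \<le> 0 + B * 0 + 0 * l2_norm f + 0"
      by (rule LIMSEQ_le_const) (use le in blast)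
    then show "T (T f) p = T f p" by simp
  qed
  have sa: "l2_inner (T f) g = l2_inner f (T g)" if f: "f \<in> l2 G n" and g: "g \<in> l2 G n" for f g
  proof -
    have s: "sq f" "sq g" "sq (T f)" "sq (T g)" using f g by (auto intro: l2_sq Tl)
    let ?z = "\<lambda>k p. T f p - app (Z k) f p" and ?y = "\<lambda>k p. T g p - app (Z k) g p"
    have z: "sq (?z k)" and y: "sq (?y k)" for k by (intro l2_norm_diff app_bound s)+
    have le: "cmod (l2_inner (T f) g - l2_inner f (T g)) \<le> l2_norm (?z k) * l2_norm g + l2_norm f * l2_norm (?y k)" for k
    proof -
      have "l2_inner (?z k) g = l2_inner (T f) g - l2_inner (app (Z k) f) g"
        by (rule l2_inner_diff_left[OF s(3) app_bound(1)[OF s(1)] s(2)])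
      moreover have "l2_inner f (?y k) = l2_inner f (T g) - l2_inner f (app (Z k) g)"
        by (rule l2_inner_diff_right[OF s(4) app_bound(1)[OF s(2)] s(1)])
      moreover have "l2_inner (app (Z k) f) g = l2_inner f (app (Z k) g)"
        using app_adj[OF s(1,2), of "Z k"] Z(2) by simp
      ultimately have "l2_inner (T f) g - l2_inner f (T g) = l2_inner (?z k) g - l2_inner f (?y k)" by simp
      also have "cmod \<dots> \<le> cmod (l2_inner (?z k) g) + cmod (l2_inner f (?y k))" by (rule norm_triangle_ineq4)
      also have "\<dots> \<le> l2_norm (?z k) * l2_norm g + l2_norm f * l2_norm (?y k)"
        by (intro add_mono l2_inner_bound z y s)
      finally show ?thesis .
    qed
    have "(\<lambda>k. l2_norm (?z k) * l2_norm g + l2_norm f * l2_norm (?y k)) \<longlonglongrightarrow> 0 * l2_norm g + l2_norm f * 0"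
      by (intro tendsto_intros Tlim s)
    then have "cmod (l2_inner (T f) g - l2_inner f (T g)) \<le> 0 * l2_norm g + l2_norm f * 0"
      by (rule LIMSEQ_le_const) (use le in blast)
    then show ?thesis by simp
  qed
  have "(\<lambda>k. tr (Z k)) \<longlonglongrightarrow> mat_trace G n T"
    unfolding mat_trace_eq tr_eq
  proof (rule tendsto_sum)
    fix i assume "i \<in> {..<n}"
    then show "(\<lambda>k. ent (Z k) (\<one>, i) (\<one>, i)) \<longlonglongrightarrow> T (delta_vec G i) (\<one>, i)"
      using lim[OF l2_sq[OF delta_l2(1)], of i "(\<one>, i)"] by (simp add: app_delta)
  qed
  then show ?thesis using red idem sa unfolding is_projection_def by blast
qed

end

section \<open>Two copies of a free right set\<close>

text \<open>The representative is chosen as a function of the orbit as a set, which makes it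
  constant on orbits; freeness makes the group coordinate unique.\<close>

lemma ex_right_transversal:
  assumes H: "group H" and a: "right_action H W act" and f: "free_right H W act"
  shows "\<exists>R. right_transversal H W act R"
proof -
  interpret H: group H by (rule H)
  have ac: "act x h \<in> W" if "x \<in> W" "h \<in> carrier H" for x h using a that unfolding right_action_def by blast
  have a1: "act x \<one>\<^bsub>H\<^esub> = x" if "x \<in> W" for x using a that unfolding right_action_def by blast
  have am: "act x (h \<otimes>\<^bsub>H\<^esub> k) = act (act x h) k" if "x \<in> W" "h \<in> carrier H" "k \<in> carrier H" for x h k
    using a that unfolding right_action_def by blast
  have inj: "h = k" if "x \<in> W" "h \<in> carrier H" "k \<in> carrier H" "act x h = act x k" for x h k
  proof -
    have "act x (h \<otimes>\<^bsub>H\<^esub> inv\<^bsub>H\<^esub> k) = act x (k \<otimes>\<^bsub>H\<^esub> inv\<^bsub>H\<^esub> k)"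
      using am[of x h "inv\<^bsub>H\<^esub> k"] am[of x k "inv\<^bsub>H\<^esub> k"] that by simp
    then have "h \<otimes>\<^bsub>H\<^esub> inv\<^bsub>H\<^esub> k = \<one>\<^bsub>H\<^esub>"
      using f[unfolded free_right_def, rule_format, of "h \<otimes>\<^bsub>H\<^esub> inv\<^bsub>H\<^esub> k" x] a1 that by simp
    then show ?thesis using H.inv_equality[of h "inv\<^bsub>H\<^esub> k"] that by simp
  qed
  define b where "b x = (SOME y. y \<in> right_orbit H act x)" for x
  have orb: "right_orbit H act (act x h) = right_orbit H act x" if "x \<in> W" "h \<in> carrier H" for x h
  proof -
    have 1: "act (act x h) k = act x (h \<otimes>\<^bsub>H\<^esub> k)" if "k \<in> carrier H" for k using am \<open>x \<in> W\<close> \<open>h \<in> carrier H\<close> that by simp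
    have 2: "act x k = act (act x h) (inv\<^bsub>H\<^esub> h \<otimes>\<^bsub>H\<^esub> k)" if "k \<in> carrier H" for k
      using am[of x h "inv\<^bsub>H\<^esub> h \<otimes>\<^bsub>H\<^esub> k"] that \<open>x \<in> W\<close> \<open>h \<in> carrier H\<close> by (simp add: H.m_assoc[symmetric])
    show ?thesis
    proof (intro equalityI subsetI)
      fix y assume "y \<in> right_orbit H act (act x h)"
      then obtain k where "k \<in> carrier H" "y = act (act x h) k" unfolding right_orbit_def by blast
      then show "y \<in> right_orbit H act x"
        unfolding right_orbit_def using 1[of k] that(2) by blast
    next
      fix y assume "y \<in> right_orbit H act x"
      then obtain k where k: "k \<in> carrier H" "y = act x k" unfolding right_orbit_def by blast
      then have "inv\<^bsub>H\<^esub> h \<otimes>\<^bsub>H\<^esub> k \<in> carrier H" using that(2) by simp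
      then show "y \<in> right_orbit H act (act x h)"
        unfolding right_orbit_def using 2[of k] k by blast
    qed
  qed
  have b: "\<exists>h\<in>carrier H. b x = act x h" if "x \<in> W" for x
  proof -
    have "x \<in> right_orbit H act x" unfolding right_orbit_def using a1[OF that] by force
    then have "b x \<in> right_orbit H act x" unfolding b_def by (rule someI)
    then show ?thesis unfolding right_orbit_def by blast
  qed
  have bW: "b x \<in> W" if "x \<in> W" for x using b[OF that] ac that by auto
  have bb: "b (act x h) = b x" if "x \<in> W" "h \<in> carrier H" for x h unfolding b_def orb[OF that] ..
  have bbb: "b (b x) = b x" if "x \<in> W" for x using b[OF that] bb[OF that] by metis
  have "right_transversal H W act (b ` W)"
  proof (unfold_locales)
    show "b ` W \<subseteq> W" using bW by blast
    fix x assume x: "x \<in> W"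
    obtain h where h: "h \<in> carrier H" "b x = act x h" using b[OF x] by blast
    have "act (b x) (inv\<^bsub>H\<^esub> h) = x" using am[of x h "inv\<^bsub>H\<^esub> h"] a1 h x by simp
    then show "\<exists>s\<in>b ` W. \<exists>h\<in>carrier H. act s h = x" using x h by blast
  next
    fix s s' h h' assume "s \<in> b ` W" "s' \<in> b ` W" and h: "h \<in> carrier H" "h' \<in> carrier H" and eq: "act s h = act s' h'"
    then have s: "s \<in> W" "s' \<in> W" "b s = s" "b s' = s'" using bW bbb by auto
    then have "s = s'" using bb[OF s(1) h(1)] bb[OF s(2) h(2)] eq by simp
    then show "s = s' \<and> h = h'" using inj[OF s(1) h] eq by simp
  qed (use ac a1 am in auto)
  then show ?thesis ..
qed

text \<open>Inversion turns the left action into a right one. The orbit label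
  \<open>\<kappa>\<close> is the representative, and \<open>\<gamma>\<close> is the inverse of the
  right coordinate, which makes it equivariant from the left.\<close>

lemma ex_left_coordinates:
  fixes S :: "'d set"
  assumes G: "group G" and a: "left_action G S act" and f: "free_left G S act"
  shows "\<exists>(\<kappa> :: 'd \<Rightarrow> 'd) \<gamma>. (\<forall>x\<in>S. \<gamma> x \<in> carrier G) \<and>
    (\<forall>x\<in>S. \<forall>g\<in>carrier G. \<kappa> (act g x) = \<kappa> x \<and> \<gamma> (act g x) = g \<otimes>\<^bsub>G\<^esub> \<gamma> x) \<and>
    (\<forall>x\<in>S. \<forall>y\<in>S. \<kappa> x = \<kappa> y \<longrightarrow> x = act (\<gamma> x \<otimes>\<^bsub>G\<^esub> inv\<^bsub>G\<^esub> (\<gamma> y)) y)"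
proof -
  interpret G: group G by (rule G)
  define ract where "ract x g = act (inv\<^bsub>G\<^esub> g) x" for x g
  have "right_action G S ract"
    using a unfolding right_action_def left_action_def ract_def by (auto simp: G.inv_mult_group)
  moreover have "free_right G S ract"
    using f unfolding free_left_def free_right_def ract_def by (metis G.inv_closed G.inv_inv G.inv_one)
  ultimately obtain R where "right_transversal G S ract R" using ex_right_transversal[OF G] by blast
  then interpret T: right_transversal G S ract R .
  let ?\<gamma> = "\<lambda>x. inv\<^bsub>G\<^esub> (T.cf x)"
  show ?thesis
  proof (intro exI[of _ T.rp] exI[of _ ?\<gamma>] conjI ballI impI)
    fix x assume x: "x \<in> S"
    note r = T.rp[OF x]
    show "?\<gamma> x \<in> carrier G" using r by simp
    { fix g assume g: "g \<in> carrier G"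
      have eq: "act g x = ract x (inv\<^bsub>G\<^esub> g)" using g by (simp add: ract_def)
      show "T.rp (act g x) = T.rp x" unfolding eq using T.rp_act_C[OF x] g by simp
      show "?\<gamma> (act g x) = g \<otimes>\<^bsub>G\<^esub> ?\<gamma> x" unfolding eq using T.rp_act_C[OF x] g r by (simp add: G.inv_mult_group) }
    { fix y assume y: "y \<in> S" and e: "T.rp x = T.rp y"
      note ry = T.rp[OF y]
      have "x = ract (T.rp y) (T.cf x)" using r(3) e by simp
      also have "T.rp y = ract y (inv\<^bsub>G\<^esub> (T.cf y))"
        using T.act_inv[OF T.rp_C[OF y] ry(2)] ry(3) by simp
      also have "ract (ract y (inv\<^bsub>G\<^esub> (T.cf y))) (T.cf x) = ract y (inv\<^bsub>G\<^esub> (T.cf y) \<otimes>\<^bsub>G\<^esub> T.cf x)"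
        using T.act_mult[OF y, of "inv\<^bsub>G\<^esub> (T.cf y)" "T.cf x"] r ry by simp
      also have "\<dots> = act (inv\<^bsub>G\<^esub> (inv\<^bsub>G\<^esub> (T.cf y) \<otimes>\<^bsub>G\<^esub> T.cf x)) y"
        by (rule ract_def)
      also have "inv\<^bsub>G\<^esub> (inv\<^bsub>G\<^esub> (T.cf y) \<otimes>\<^bsub>G\<^esub> T.cf x) = ?\<gamma> x \<otimes>\<^bsub>G\<^esub> inv\<^bsub>G\<^esub> (?\<gamma> y)"
        using r ry by (simp add: G.inv_mult_group)
      finally show "x = act (?\<gamma> x \<otimes>\<^bsub>G\<^esub> inv\<^bsub>G\<^esub> (?\<gamma> y)) y" . }
  qed
qed

section \<open>The idempotent and the flip on two copies\<close>

lift_definition corner :: "('a \<times> bool) bmat" is "\<lambda>p q. if p = q \<and> snd p then 1 else 0"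
proof -
  let ?P = "\<lambda>p q :: 'a \<times> bool. if p = q \<and> snd p then 1 else 0 :: complex"
  have r: "{q. ?P p q \<noteq> 0} \<subseteq> {p}" "{q. ?P q p \<noteq> 0} \<subseteq> {p}" for p by auto
  have f: "finite {q. ?P p q \<noteq> 0}" "finite {q. ?P q p \<noteq> 0}" for p
    using r[of p] finite_subset by blast+
  have "card {q. ?P p q \<noteq> 0} \<le> 1" "card {q. ?P q p \<noteq> 0} \<le> 1" for p
    using card_mono[OF _ r(1)[of p]] card_mono[OF _ r(2)[of p]] by auto
  then have "mbound ?P (1 * real 1)" using f by (intro mbound_schur) auto
  then show "(\<forall>s. finite {t. ?P s t \<noteq> 0}) \<and> (\<forall>t. finite {s. ?P s t \<noteq> 0}) \<and> (\<exists>c. mbound ?P c)"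
    using f by blast
qed

lift_definition swap :: "('a \<times> bool) bmat" is "\<lambda>p q. if q = (fst p, \<not> snd p) then 1 else 0"
proof -
  let ?P = "\<lambda>p q :: 'a \<times> bool. if q = (fst p, \<not> snd p) then 1 else 0 :: complex"
  have r: "{q. ?P p q \<noteq> 0} \<subseteq> {(fst p, \<not> snd p)}" "{q. ?P q p \<noteq> 0} \<subseteq> {(fst p, \<not> snd p)}" for p by auto
  have f: "finite {q. ?P p q \<noteq> 0}" "finite {q. ?P q p \<noteq> 0}" for p
    using r[of p] finite_subset by blast+
  have "card {q. ?P p q \<noteq> 0} \<le> 1" "card {q. ?P q p \<noteq> 0} \<le> 1" for p
    using card_mono[OF _ r(1)[of p]] card_mono[OF _ r(2)[of p]] by auto
  then have "mbound ?P (1 * real 1)" using f by (intro mbound_schur) auto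
  then show "(\<forall>s. finite {t. ?P s t \<noteq> 0}) \<and> (\<forall>t. finite {s. ?P s t \<noteq> 0}) \<and> (\<exists>c. mbound ?P c)"
    using f by blast
qed

lemma ent_corner: "ent corner p q = (if p = q \<and> snd p then 1 else 0)" by (simp add: corner.rep_eq)
lemma ent_swap: "ent swap p q = (if q = (fst p, \<not> snd p) then 1 else 0)" by (simp add: swap.rep_eq)

lemma norm_perm_le:
  assumes "\<And>p q. cmod (ent M p q) \<le> 1" "\<And>p q. ent M p q \<noteq> 0 \<Longrightarrow> q = f p" "\<And>p q. ent M p q \<noteq> 0 \<Longrightarrow> p = f q"
  shows "norm M \<le> 1"
proof -
  have r: "{q. ent M p q \<noteq> 0} \<subseteq> {f p}" "{q. ent M q p \<noteq> 0} \<subseteq> {f p}" for p using assms by auto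
  have "card {q. ent M p q \<noteq> 0} \<le> 1" "card {q. ent M q p \<noteq> 0} \<le> 1" for p
    using card_mono[OF _ r(1)[of p]] card_mono[OF _ r(2)[of p]] by auto
  then have "mbound (ent M) (1 * real 1)" by (intro mbound_schur assms ent_row ent_col)
  then show ?thesis using norm_bmat_le by simp
qed

lemma norm_corner: "norm corner \<le> 1"
  by (rule norm_perm_le[of _ "\<lambda>p. p"]) (auto simp: ent_corner split: if_splits)

lemma norm_swap: "norm swap \<le> 1"
  by (rule norm_perm_le[of _ "\<lambda>p. (fst p, \<not> snd p)"]) (auto simp: ent_swap split: if_splits)

lemma ent_corner_mult: "ent (corner * M) p q = (if snd p then ent M p q else 0)"
  by (subst ent_mult_sum[of "{p}"]) (auto simp: ent_corner split: if_splits)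

lemma ent_mult_corner: "ent (M * corner) p q = (if snd q then ent M p q else 0)"
  by (subst ent_mult_sum[of "{q}"]) (auto simp: ent_corner split: if_splits)

lemma ent_swap_mult: "ent (swap * M) p q = ent M (fst p, \<not> snd p) q"
  by (subst ent_mult_sum[of "{(fst p, \<not> snd p)}"]) (auto simp: ent_swap split: if_splits)

lemma ent_mult_swap: "ent (M * swap) p q = ent M p (fst q, \<not> snd q)"
  by (subst ent_mult_sum[of "{(fst q, \<not> snd q)}"]) (auto simp: ent_swap split: if_splits)

lemma corner_swap:
  "corner * corner = corner" "swap * swap = 1" "swap * corner = swap - corner * swap"
  "adj corner = corner" "adj swap = swap"
  by (rule bmat_eqI; auto simp: ent_corner_mult ent_swap_mult ent_corner ent_swap prod_eq_iff split: if_splits)+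

text \<open>The natural number is the matrix index of the projection over \<open>G\<close>; the
  boolean selects the copy, with \<open>corner\<close> the identity on the copy
  \<open>True\<close>.\<close>

locale doubled_set = right_transversal H W act R
  for H :: "('h, 'm) monoid_scheme" (structure) and W :: "'w set" and act R +
  fixes n :: nat
begin

definition W2 :: "(('w \<times> nat) \<times> bool) set" where "W2 = (W \<times> {..<n}) \<times> UNIV"
definition R2 :: "(('w \<times> nat) \<times> bool) set" where "R2 = (R \<times> {..<n}) \<times> UNIV"
definition act2 :: "('w \<times> nat) \<times> bool \<Rightarrow> 'h \<Rightarrow> ('w \<times> nat) \<times> bool" where
  "act2 p h = ((act (fst (fst p)) h, snd (fst p)), snd p)"

end

sublocale doubled_set \<subseteq> J: right_transversal H W2 act2 R2
proof
  show "\<exists>s\<in>R2. \<exists>h\<in>carrier H. act2 s h = x" if xW: "x \<in> W2" for x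
  proof -
    obtain w i b where x: "x = ((w, i), b)" "w \<in> W" "i < n" using xW unfolding W2_def by auto
    obtain s h where "s \<in> R" "h \<in> carrier H" "act s h = w" using decomp[OF x(2)] by blast
    then show ?thesis using x by (intro bexI[of _ "((s, i), b)"] bexI[of _ h]) (auto simp: act2_def R2_def)
  qed
  show "s = s' \<and> h = h'" if "s \<in> R2" "s' \<in> R2" "h \<in> carrier H" "h' \<in> carrier H" "act2 s h = act2 s' h'" for s s' h h'
    using that unique[of "fst (fst s)" "fst (fst s')" h h'] unfolding R2_def act2_def by (auto simp: prod_eq_iff)
qed (use R_C in \<open>auto simp: W2_def R2_def act2_def act_closed act_one act_mult\<close>)

context doubled_set
begin

lemma corner_Eq: "corner \<in> J.Eq"
proof (rule J.EqI)
  fix s t h assume st: "s \<in> W2" "t \<in> W2" "h \<in> carrier H"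
  have "s = t" if "act2 s h = act2 t h"
    using arg_cong[OF that, of "\<lambda>x. act2 x (inv h)"] st by (simp add: J.act_inv)
  then show "ent corner (act2 s h) (act2 t h) = ent corner s t" by (auto simp: ent_corner act2_def)
qed (auto simp: ent_corner split: if_splits)

lemma swap_Eq: "swap \<in> J.Eq"
proof (rule J.EqI)
  fix s t h assume st: "s \<in> W2" "t \<in> W2" "h \<in> carrier H"
  let ?s = "(fst s, \<not> snd s)"
  have s: "?s \<in> W2" using st unfolding W2_def by auto
  have "?s = t" if "act2 ?s h = act2 t h"
    using arg_cong[OF that, of "\<lambda>x. act2 x (inv h)"] st s by (simp add: J.act_inv)
  then show "ent swap (act2 s h) (act2 t h) = ent swap s t" by (auto simp: ent_swap act2_def)
qed (auto simp: ent_swap W2_def split: if_splits)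

lemma doubling_corner_swap: "doubling J.Eq J.Fin J.tr corner swap"
  by (rule doubling.intro[OF J.trace_ideal_axioms doubling_axioms.intro[OF corner_Eq swap_Eq
      corner_swap(1-3) norm_corner norm_swap]])

end

sublocale doubled_set \<subseteq> DB: doubling J.Eq J.Fin J.tr corner swap
  by (rule doubling_corner_swap)

section \<open>Compression to finitely many orbits\<close>

lemma Cauchy_if_geometric:
  fixes W :: "nat \<Rightarrow> 'a::real_normed_vector"
  assumes "\<And>k. norm (W (Suc k) - W k) \<le> c / 4^k" shows "Cauchy W"
proof -
  have c: "0 \<le> c" using order_trans[OF norm_ge_zero assms[of 0]] by simp
  have main: "norm (W (m + j) - W m) \<le> 2 * (c / 4^m) * (1 - 1/4^j)" for m j
  proof (induction j)
    case (Suc j)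
    have "norm (W (m + Suc j) - W m) \<le> norm (W (Suc (m + j)) - W (m + j)) + norm (W (m + j) - W m)"
      using norm_triangle_ineq[of "W (Suc (m + j)) - W (m + j)" "W (m + j) - W m"] by simp
    also have "\<dots> \<le> c / 4^(m + j) + 2 * (c / 4^m) * (1 - 1/4^j)" by (intro add_mono assms Suc)
    also have "\<dots> \<le> 2 * (c / 4^m) * (1 - 1/4^Suc j)" using c by (simp add: field_simps power_add)
    finally show ?case .
  qed simp
  have le: "norm (W k - W m) \<le> 2 * c / 4^m" if "k \<ge> m" for k m
  proof -
    have "2 * (c / 4^m) * (1 - 1/4^(k - m)) \<le> 2 * (c / 4^m) * 1" using c by (intro mult_left_mono) auto
    then show ?thesis using main[of m "k - m"] that by simp
  qed
  show ?thesis
  proof (rule metric_CauchyI)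
    fix e :: real assume e: "0 < e"
    have "(\<lambda>m. 4 * c / 4^m) \<longlonglongrightarrow> 0" by (rule LIMSEQ_divide_realpow_zero) simp
    then obtain K where "\<And>m. m \<ge> K \<Longrightarrow> norm (4 * c / 4^m - 0) < e" using LIMSEQ_D e by blast
    then have K: "4 * c / 4^K < e" by (metis abs_ge_self diff_zero le_less_trans order_refl real_norm_def)
    have "dist (W i) (W j) < e" if "i \<ge> K" "j \<ge> K" for i j
    proof -
      have "dist (W i) (W j) \<le> norm (W i - W K) + norm (W j - W K)"
        unfolding dist_norm by norm
      also have "\<dots> \<le> 2 * c / 4^K + 2 * c / 4^K" by (intro add_mono le that)
      finally show ?thesis using K by simp
    qed
    then show "\<exists>M. \<forall>m\<ge>M. \<forall>n\<ge>M. dist (W m) (W n) < e" by blast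
  qed
qed

lemma adj_step: "adj M = M \<Longrightarrow> adj (step M) = step M"
  unfolding step_def by (simp add: adj_diff adj_add adj_mult mult.assoc)

lemma adj_step_pow: "adj M = M \<Longrightarrow> adj ((step^^k) M) = (step^^k) M"
  by (induction k) (simp_all add: adj_step)

context doubled_set
begin

text \<open>All iterates coincide with \<open>corner\<close> away from the orbits in
  \<open>F\<close>. Cutting down to these orbits is therefore multiplicative along the iteration and
  yields matrices over the group ring of \<open>H\<close> that converge to a projection. Its trace
  is that of \<open>corner\<close> on \<open>F\<close> plus the limit of the relative
  traces.\<close>

lemma ex_projection_compress:
  assumes near: "J.near K d X" and adj: "adj X = X" and XJ: "X - corner \<in> J.Fin"
    and F: "finite F" "F \<subseteq> R2" "\<And>p q. ent (X - corner) p q \<noteq> 0 \<Longrightarrow> J.rp p \<in> F"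
    and L: "(\<lambda>k. J.tr ((step^^k) X - corner)) \<longlonglongrightarrow> L"
  shows "\<exists>T. is_projection H (card F) T \<and> mat_trace H (card F) T = of_nat (card {s\<in>F. snd s}) + L"
proof -
  let ?N = "card F"
  interpret HM: group_matrix H ?N by unfold_locales
  obtain i where i: "bij_betw i {..<?N} F" using ex_bij_betw_nat_finite[OF F(1)] by (auto simp: lessThan_atLeast0)
  have iF: "i k \<in> F" "i k \<in> R2" "i k \<in> W2" if "k < ?N" for k
    using i that F(2) J.R_C unfolding bij_betw_def by auto
  let ?S = "carrier H \<times> {..<?N}"
  let ?g = "\<lambda>p :: 'h \<times> nat. act2 (i (snd p)) (fst p)"
  have inj: "inj_on (\<lambda>p. ((), ?g p)) ?S"
  proof (rule inj_onI)
    fix p q assume pq: "p \<in> ?S" "q \<in> ?S" and "((), ?g p) = ((), ?g q)"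
    then have "i (snd p) = i (snd q) \<and> fst p = fst q"
      by (intro J.unique) (auto intro: iF)
    moreover then have "snd p = snd q" using i pq unfolding bij_betw_def inj_on_def by auto
    ultimately show "p = q" by (simp add: prod_eq_iff)
  qed
  \<comment> \<open>With a constant block label there is a single block, and the pullback only
    renames the indices in the orbits of \<open>F\<close>.\<close>
  define th where "th = bpull ?S (\<lambda>_. ()) ?g"
  note ent_th = ent_bpull[OF inj, folded th_def]
  define FH where "FH = {p\<in>W2. J.rp p \<in> F}"
  have gFH: "?g p \<in> FH" if "p \<in> ?S" for p
    using that J.rp_act(1)[OF iF(2)] J.act_closed[OF iF(3)] iF(1) unfolding FH_def by auto
  have FHg: "\<exists>y\<in>?S. () = () \<and> ?g y = p" if "p \<in> FH" for p
  proof -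
    have p: "p \<in> W2" "J.rp p \<in> F" using that unfolding FH_def by auto
    then have "J.rp p \<in> i ` {..<?N}" using i by (simp add: bij_betw_def)
    then obtain k where "k < ?N" "i k = J.rp p" by auto
    then show ?thesis using J.rp[OF p(1)] by (intro bexI[of _ "(J.cf p, k)"]) auto
  qed
  \<comment> \<open>Because \<open>corner\<close> is diagonal, this support condition survives
    products and makes the indices in \<open>FH\<close> invariant, which is what multiplicativity of
    the compression requires.\<close>
  define good where "good M \<longleftrightarrow> (\<forall>p q. ent (M - corner) p q \<noteq> 0 \<longrightarrow> p \<in> FH \<and> q \<in> FH)" for M
  \<comment> \<open>The bound on rows is given; self-adjointness transfers it to columns.\<close>
  have goodX: "good X"
  proof -
    have XW: "p \<in> W2 \<and> q \<in> W2" if "ent (X - corner) p q \<noteq> 0" for p q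
      using J.Fin_rows[OF XJ] that by blast
    have "ent (X - corner) q p = cnj (ent (X - corner) p q)" for p q
      using arg_cong[OF adj, of "\<lambda>M. ent M q p"] by (auto simp: ent_corner)
    then show ?thesis using XW F(3) unfolding good_def FH_def by (metis (mono_tags, lifting) complex_cnj_zero_iff mem_Collect_eq)
  qed
  have goodM: "good (M * N)" if "good M" "good N" for M N
    unfolding good_def
  proof (intro allI impI)
    fix p q assume nz: "ent (M * N - corner) p q \<noteq> 0"
    have "M * N - corner = (M - corner) * (N - corner) + corner * (N - corner) + (M - corner) * corner"
      using corner_swap(1) by (simp add: algebra_simps)
    then have "ent ((M - corner) * (N - corner)) p q \<noteq> 0 \<or> ent (N - corner) p q \<noteq> 0 \<or> ent (M - corner) p q \<noteq> 0"
      using nz by (auto simp: ent_corner_mult ent_mult_corner split: if_splits)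
    moreover have "ent ((M - corner) * (N - corner)) p q \<noteq> 0 \<Longrightarrow> \<exists>k. ent (M - corner) p k \<noteq> 0 \<and> ent (N - corner) k q \<noteq> 0"
      by (rule J.ent_mult_nonzero)
    ultimately show "p \<in> FH \<and> q \<in> FH" using that unfolding good_def by blast
  qed
  have goodS: "good (step M)" if g: "good M" for M
    unfolding good_def
  proof (intro allI impI)
    fix p q assume nz: "ent (step M - corner) p q \<noteq> 0"
    have "step M - corner = (M*M - corner) + (M*M - corner) + (M*M - corner) - ((M*M*M - corner) + (M*M*M - corner))"
      unfolding step_def by (simp add: algebra_simps)
    then have "ent (M*M - corner) p q \<noteq> 0 \<or> ent (M*M*M - corner) p q \<noteq> 0"
      using nz by (metis (no_types, lifting) ent_simps(2,4) add_0 diff_zero)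
    then show "p \<in> FH \<and> q \<in> FH" using goodM[OF g g] goodM[OF goodM[OF g g] g] unfolding good_def by blast
  qed
  have goodP: "good ((step^^k) X)" for k by (induction k) (simp_all add: goodX goodS)
  have pres: "\<exists>y\<in>?S. () = () \<and> ?g y = q" if g: "good M" and x: "x \<in> ?S" and nz: "ent M (?g x) q \<noteq> 0" for M x q
  proof (rule FHg)
    show "q \<in> FH"
    proof (cases "ent (M - corner) (?g x) q = 0")
      case True
      then have "ent corner (?g x) q \<noteq> 0" using nz by simp
      then have "q = ?g x" by (simp add: ent_corner split: if_splits)
      then show ?thesis using gFH[OF x] by simp
    next
      case False
      then show ?thesis using g unfolding good_def by blast
    qed
  qed
  have th_mult: "th (M * N) = th M * th N" if "good M" for M N
    unfolding th_def by (rule bpull_mult[OF inj]) (rule pres[OF that])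
  have th_defect: "th (defect M) = defect (th M)" if "good M" for M
    unfolding defect_def th_mult[OF that, symmetric] unfolding th_def by (rule bpull_diff[OF inj])
  define Z where "Z k = th ((step^^k) X)" for k
  have XE: "(step^^k) X \<in> J.Eq" for k using near unfolding J.near_def by (intro J.step_pow_E) simp
  have ZF: "Z k \<in> HM.Fin" for k
  proof (rule HM.FinI)
    show "Z k \<in> HM.Eq"
    proof (rule HM.EqI)
      fix s t h assume st: "s \<in> ?S" "t \<in> ?S" and h: "h \<in> carrier H"
      have "?g (fst s \<otimes> h, snd s) = act2 (?g s) h" if "s \<in> ?S" for s
        using that h iF(3) by (auto simp: J.act_mult)
      moreover have "(fst s \<otimes> h, snd s) \<in> ?S" "(fst t \<otimes> h, snd t) \<in> ?S" using st h by auto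
      moreover have "?g s \<in> W2" "?g t \<in> W2" using gFH st unfolding FH_def by auto
      ultimately show "ent (Z k) (fst s \<otimes> h, snd s) (fst t \<otimes> h, snd t) = ent (Z k) s t"
        unfolding Z_def ent_th using st J.EqD(2)[OF XE, of "?g s" "?g t" h k] h by simp
    qed (auto simp: Z_def ent_th split: if_splits)
  qed (auto simp: Z_def ent_th split: if_splits)
  have Zadj: "adj (Z k) = Z k" for k
    unfolding Z_def th_def bpull_adj[OF inj, symmetric] adj_step_pow[OF adj] ..
  have "Cauchy Z"
  proof (rule Cauchy_if_geometric)
    fix k
    have "Z (Suc k) - Z k = th ((step^^Suc k) X - (step^^k) X)"
      unfolding Z_def th_def by (rule bpull_diff[OF inj, symmetric])
    then have "norm (Z (Suc k) - Z k) \<le> norm ((step^^Suc k) X - (step^^k) X)"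
      using norm_bpull[OF inj] unfolding th_def by simp
    also have "\<dots> \<le> 5*K*d/4^k" by (rule J.near_pow(3)[OF near])
    finally show "norm (Z (Suc k) - Z k) \<le> 5*K*d/4^k" .
  qed
  moreover have "(\<lambda>k. defect (Z k)) \<longlonglongrightarrow> 0"
  proof (rule Lim_null_comparison)
    show "(\<lambda>k. d/4^k) \<longlonglongrightarrow> 0" by (rule LIMSEQ_divide_realpow_zero) simp
    show "\<forall>\<^sub>F k in sequentially. norm (defect (Z k)) \<le> d/4^k"
    proof (intro always_eventually allI)
      fix k
      have "norm (defect (Z k)) \<le> norm (defect ((step^^k) X))"
        unfolding Z_def th_defect[OF goodP, symmetric] unfolding th_def by (rule norm_bpull[OF inj])
      then show "norm (defect (Z k)) \<le> d/4^k" using J.near_pow(1)[OF near, of k] by simp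
    qed
  qed
  ultimately obtain T where T: "is_projection H ?N T" "(\<lambda>k. HM.tr (Z k)) \<longlonglongrightarrow> mat_trace H ?N T"
    using HM.projection_limit[of Z, OF ZF Zadj] by blast
  have "HM.tr (Z k) = of_nat (card {s\<in>F. snd s}) + J.tr ((step^^k) X - corner)" for k
  proof -
    let ?Y = "(step^^k) X"
    have "HM.tr (Z k) = (\<Sum>j<?N. ent ?Y (i j) (i j))"
      unfolding HM.tr_eq Z_def ent_th by (intro sum.cong) (auto simp: J.act_one iF(3))
    also have "\<dots> = (\<Sum>s\<in>F. ent ?Y s s)" by (rule sum.reindex_bij_betw[OF i])
    also have "\<dots> = (\<Sum>s\<in>F. ent corner s s) + (\<Sum>s\<in>F. ent (?Y - corner) s s)"
      by (simp add: sum.distrib[symmetric])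
    also have "(\<Sum>s\<in>F. ent corner s s) = of_nat (card {s\<in>F. snd s})"
      by (simp add: ent_corner sum.inter_filter[OF F(1), symmetric])
    also have "(\<Sum>s\<in>F. ent (?Y - corner) s s) = J.tr (?Y - corner)"
    proof (rule J.tr_sum[OF F(1,2), symmetric])
      fix s assume s: "s \<in> R2" "ent (?Y - corner) s s \<noteq> 0"
      then have "s \<in> FH" using goodP[of k] unfolding good_def by blast
      then show "s \<in> F" using J.rp_R[OF s(1)] unfolding FH_def by simp
    qed
    finally show ?thesis .
  qed
  then have "(\<lambda>k. HM.tr (Z k)) \<longlonglongrightarrow> of_nat (card {s\<in>F. snd s}) + L"
    using tendsto_add[OF tendsto_const L, of "of_nat (card {s\<in>F. snd s})"] by simp
  then show ?thesis using T LIMSEQ_unique by blast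
qed

end

section \<open>Transfer of projections\<close>

context doubled_set
begin

text \<open>The symmetry \<open>mix B\<close> is self-adjoint because \<open>B\<close> commutes with
  the flip, and \<open>(A - B) * corner\<close> because its factors commute.\<close>

lemma adj_dbl:
  assumes "adj A = A" "adj B = B" "DB.commuting A" "DB.commuting B"
  shows "adj (DB.dbl A B) = DB.dbl A B"
proof -
  note c = DB.commuting_simps[OF assms(3)] DB.commuting_simps[OF assms(4)]
  have U: "adj (DB.mix B) = DB.mix B"
    unfolding DB.mix_def adj_add adj_mult adj_diff adj_one corner_swap assms
    by (simp add: right_diff_distrib left_diff_distrib c)
  have D: "corner * (A - B) = (A - B) * corner" by (simp add: right_diff_distrib left_diff_distrib c)
  have "mix * (corner * ((A - B) * mix)) = mix * ((A - B) * corner * mix)" for mix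
    unfolding D[symmetric] mult.assoc ..
  then show ?thesis
    unfolding DB.dbl_def adj_add adj_mult U adj_diff assms(1,2) corner_swap(4) mult.assoc by simp
qed

lemma rp2: "w \<in> W \<Longrightarrow> i < n \<Longrightarrow> J.rp ((w, i), b) = ((rp w, i), b)"
  using J.rp_act(1)[of "((rp w, i), b)" "cf w"] rp[of w] by (simp add: R2_def act2_def)

end

text \<open>The label \<open>\<kappa>\<close> names a \<open>G\<close>-orbit and
  \<open>\<gamma>\<close> the position in it, so \<open>G\<close> is present only through the
  quotients \<open>\<gamma> s * (\<gamma> t)^-1\<close>. This lets two different actions of
  \<open>G\<close> be compared on one set. The group \<open>H\<close> may permute the labels;
  commuting actions mean that it preserves their equality and the quotients.\<close>

locale bimodule = doubled_set H W act R n + G: group_matrix G n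
  for G :: "('g, 'a) monoid_scheme" and H :: "('h, 'b) monoid_scheme" (structure)
    and W :: "'w set" and act R n +
  fixes S :: "'w set" and \<kappa> :: "'w \<Rightarrow> 'k" and \<gamma> :: "'w \<Rightarrow> 'g"
  assumes S_W: "S \<subseteq> W"
    and S_act: "\<And>s h. s \<in> S \<Longrightarrow> h \<in> carrier H \<Longrightarrow> act s h \<in> S"
    and \<gamma>_G: "\<And>s. s \<in> S \<Longrightarrow> \<gamma> s \<in> carrier G"
    and coord_inj: "\<And>s t. s \<in> S \<Longrightarrow> t \<in> S \<Longrightarrow> \<kappa> s = \<kappa> t \<Longrightarrow> \<gamma> s = \<gamma> t \<Longrightarrow> s = t"
    and coord_surj: "\<And>s g. s \<in> S \<Longrightarrow> g \<in> carrier G \<Longrightarrow> \<exists>t\<in>S. \<kappa> t = \<kappa> s \<and> \<gamma> t = g"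
    and coord_act: "\<And>s t h. s \<in> S \<Longrightarrow> t \<in> S \<Longrightarrow> h \<in> carrier H \<Longrightarrow> \<kappa> s = \<kappa> t \<Longrightarrow>
      \<kappa> (act s h) = \<kappa> (act t h) \<and> \<gamma> (act s h) \<otimes>\<^bsub>G\<^esub> inv\<^bsub>G\<^esub> (\<gamma> (act t h)) = \<gamma> s \<otimes>\<^bsub>G\<^esub> inv\<^bsub>G\<^esub> (\<gamma> t)"
begin

definition S2 :: "(('w \<times> nat) \<times> bool) set" where "S2 = (S \<times> {..<n}) \<times> UNIV"

text \<open>The action of the group ring of \<open>G\<close> on functions on \<open>S\<close>, one
  regular representation per \<open>G\<close>-orbit, the same on both copies and extended by
  zero.\<close>

definition rep :: "('g \<times> nat) bmat \<Rightarrow> (('w \<times> nat) \<times> bool) bmat" where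
  "rep = bpull S2 (\<lambda>p. (\<kappa> (fst (fst p)), snd p)) (\<lambda>p. (\<gamma> (fst (fst p)), snd (fst p)))"

lemma inj2: "inj_on (\<lambda>p. ((\<kappa> (fst (fst p)), snd p), (\<gamma> (fst (fst p)), snd (fst p)))) S2"
  using coord_inj unfolding inj_on_def S2_def by (auto simp: prod_eq_iff)

lemma rep_add: "rep (M + N) = rep M + rep N" and rep_diff: "rep (M - N) = rep M - rep N"
  and rep_adj: "rep (adj M) = adj (rep M)" and norm_rep: "norm (rep M) \<le> norm M"
  unfolding rep_def by (rule bpull_add[OF inj2] bpull_diff[OF inj2] bpull_adj[OF inj2] norm_bpull[OF inj2])+

lemma rep_mult: assumes M: "M \<in> G.Fin" shows "rep (M * N) = rep M * rep N"
  unfolding rep_def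
proof (rule bpull_mult[OF inj2])
  fix x q assume x: "x \<in> S2" and nz: "ent M (\<gamma> (fst (fst x)), snd (fst x)) q \<noteq> 0"
  have q: "fst q \<in> carrier G" "snd q < n" using G.Fin_supp[OF M nz] by (auto simp: mem_Times_iff)
  have xS: "fst (fst x) \<in> S" using x unfolding S2_def by auto
  obtain t where t: "t \<in> S" "\<kappa> t = \<kappa> (fst (fst x))" "\<gamma> t = fst q" using coord_surj[OF xS q(1)] by blast
  then show "\<exists>y\<in>S2. (\<kappa> (fst (fst y)), snd y) = (\<kappa> (fst (fst x)), snd x) \<and> (\<gamma> (fst (fst y)), snd (fst y)) = q"
    using q(2) by (intro bexI[of _ "((t, snd q), snd x)"]) (auto simp: S2_def)
qed

lemma rep_step: assumes M: "M \<in> G.Fin" shows "rep (step M) = step (rep M)"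
proof -
  have "M * M \<in> G.Fin" by (rule G.mult_JE[OF M G.Fin_Eq[OF M]])
  then show ?thesis unfolding step_def by (simp add: rep_add rep_diff rep_mult M)
qed

lemma rep_step_pow: "M \<in> G.Fin \<Longrightarrow> rep ((step^^k) M) = (step^^k) (rep M)"
  by (induction k) (simp_all add: rep_step G.step_pow_Fin)

lemma ent_rep:
  assumes M: "M \<in> G.Fin"
  shows "ent (rep M) p q = (if p \<in> S2 \<and> q \<in> S2 \<and> \<kappa> (fst (fst p)) = \<kappa> (fst (fst q)) \<and> snd p = snd q
     then ent M (\<gamma> (fst (fst p)) \<otimes>\<^bsub>G\<^esub> inv\<^bsub>G\<^esub> (\<gamma> (fst (fst q))), snd (fst p)) (\<one>\<^bsub>G\<^esub>, snd (fst q)) else 0)"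
proof -
  have "ent (rep M) p q = (if p \<in> S2 \<and> q \<in> S2 \<and> \<kappa> (fst (fst p)) = \<kappa> (fst (fst q)) \<and> snd p = snd q
     then ent M (\<gamma> (fst (fst p)), snd (fst p)) (\<gamma> (fst (fst q)), snd (fst q)) else 0)"
    unfolding rep_def ent_bpull[OF inj2] by simp
  moreover have "ent M (\<gamma> (fst (fst p)), snd (fst p)) (\<gamma> (fst (fst q)), snd (fst q)) =
     ent M (\<gamma> (fst (fst p)) \<otimes>\<^bsub>G\<^esub> inv\<^bsub>G\<^esub> (\<gamma> (fst (fst q))), snd (fst p)) (\<one>\<^bsub>G\<^esub>, snd (fst q))" if "p \<in> S2" "q \<in> S2"
    using that \<gamma>_G unfolding S2_def by (intro G.Fin_coef[OF M]) auto
  ultimately show ?thesis by simp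
qed

lemma S2_W2: "S2 \<subseteq> W2" using S_W unfolding S2_def W2_def by auto

text \<open>In the form \<open>ent_rep\<close> the entries depend only on equality of labels and on
  quotients of coordinates, which \<open>H\<close> preserves.\<close>

lemma rep_Eq: assumes M: "M \<in> G.Fin" shows "rep M \<in> J.Eq"
proof (rule J.EqI)
  fix s t assume "ent (rep M) s t \<noteq> 0"
  then show "s \<in> W2 \<longleftrightarrow> t \<in> W2" using S2_W2 by (auto simp: ent_rep[OF M] split: if_splits)
next
  fix s t h assume st: "s \<in> W2" "t \<in> W2" and h: "h \<in> carrier H"
  have S2act: "act2 s h \<in> S2 \<longleftrightarrow> s \<in> S2" if "s \<in> W2" for s
  proof
    assume "act2 s h \<in> S2"
    then show "s \<in> S2" using S_act[of "act (fst (fst s)) h" "inv h"] act_inv[of "fst (fst s)" h] that h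
      unfolding S2_def W2_def act2_def by auto
  qed (use S_act h in \<open>auto simp: S2_def act2_def\<close>)
  have k: "\<kappa> (act (fst (fst s)) h) = \<kappa> (act (fst (fst t)) h) \<longleftrightarrow> \<kappa> (fst (fst s)) = \<kappa> (fst (fst t))"
    if "s \<in> S2" "t \<in> S2"
  proof
    have S: "fst (fst s) \<in> S" "fst (fst t) \<in> S" using that unfolding S2_def by auto
    then have W: "fst (fst s) \<in> W" "fst (fst t) \<in> W" using S_W by auto
    show "\<kappa> (fst (fst s)) = \<kappa> (fst (fst t))" if "\<kappa> (act (fst (fst s)) h) = \<kappa> (act (fst (fst t)) h)"
      using coord_act[OF S_act[OF S(1) h] S_act[OF S(2) h] _ that, of "inv h"] h act_inv[OF W(1) h] act_inv[OF W(2) h] by simp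
    show "\<kappa> (act (fst (fst s)) h) = \<kappa> (act (fst (fst t)) h)" if "\<kappa> (fst (fst s)) = \<kappa> (fst (fst t))"
      using coord_act[OF S h that] by simp
  qed
  show "ent (rep M) (act2 s h) (act2 t h) = ent (rep M) s t"
  proof (cases "s \<in> S2 \<and> t \<in> S2 \<and> \<kappa> (fst (fst s)) = \<kappa> (fst (fst t)) \<and> snd s = snd t")
    case True
    then have S: "fst (fst s) \<in> S" "fst (fst t) \<in> S" unfolding S2_def by auto
    show ?thesis
      using True coord_act[OF S h] S2act[OF st(1)] S2act[OF st(2)] unfolding ent_rep[OF M] by (simp add: act2_def)
  next
    case False
    then show ?thesis unfolding ent_rep[OF M] using S2act[OF st(1)] S2act[OF st(2)] k by (auto simp: act2_def)
  qed
qed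

lemma rep_commuting: assumes "M \<in> G.Fin" shows "DB.commuting (rep M)"
  unfolding DB.commuting_def
  by (intro conjI; rule bmat_eqI)
    (auto simp: ent_corner_mult ent_mult_corner ent_swap_mult ent_mult_swap ent_rep[OF assms] S2_def)

lemma rep_near: assumes M: "M \<in> G.Fin" and near: "G.near K d M" shows "J.near K d (rep M)"
proof -
  have "defect (rep M) = rep (defect M)" unfolding defect_def by (simp add: rep_diff rep_mult M)
  then have "norm (defect (rep M)) \<le> d" "norm (rep M) \<le> K"
    using near norm_rep[of "defect M"] norm_rep[of M] unfolding G.near_def by auto
  then show ?thesis using near rep_Eq[OF M] unfolding G.near_def J.near_def by simp
qed

lemma rep_diag:
  assumes M: "M \<in> G.Fin"
  shows "ent (rep M) p p = (if p \<in> S2 then ent M (\<one>\<^bsub>G\<^esub>, snd (fst p)) (\<one>\<^bsub>G\<^esub>, snd (fst p)) else 0)"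
  using \<gamma>_G[of "fst (fst p)"] unfolding ent_rep[OF M] by (auto simp: S2_def)

end

text \<open>By \<open>cmp\<close> the relation "g moves v to w" is the same for both structures once
  \<open>w\<close> avoids finitely many \<open>H\<close>-orbits. Applied to the finite support of an
  approximant, this puts the difference of the two representations into the ideal. The conclusion
  holds for every finite set above \<open>F0\<close>, which lets two projections share one
  set.\<close>

lemma ex_projection_transfer:
  fixes G :: "('g, 'a) monoid_scheme" and H :: "('h, 'b) monoid_scheme" and W :: "'w set"
  assumes "bimodule G H W act R S1 k1 g1" and "bimodule G H W act R W k2 g2" and fin: "finite (R - S1)"
    and cmp: "\<And>\<Gamma>. finite \<Gamma> \<Longrightarrow> \<Gamma> \<subseteq> carrier G \<Longrightarrow> \<exists>F. finite F \<and> (\<forall>w\<in>W. right_transversal.rp H act R w \<notin> F \<longrightarrow>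
       (\<forall>v\<in>W. \<forall>g\<in>\<Gamma>. (k2 w = k2 v \<and> g2 w \<otimes>\<^bsub>G\<^esub> inv\<^bsub>G\<^esub> (g2 v) = g) \<longleftrightarrow>
          (w \<in> S1 \<and> v \<in> S1 \<and> k1 w = k1 v \<and> g1 w \<otimes>\<^bsub>G\<^esub> inv\<^bsub>G\<^esub> (g1 v) = g)))"
    and T: "is_projection G n T"
  shows "\<exists>F0. finite F0 \<and> F0 \<subseteq> doubled_set.R2 R n \<and> (\<forall>F. finite F \<longrightarrow> F \<subseteq> doubled_set.R2 R n \<longrightarrow> F0 \<subseteq> F \<longrightarrow>
     (\<exists>f. is_projection H (card F) f \<and>
       mat_trace H (card F) f = of_nat (card {s\<in>F. snd s}) - of_nat (card (R - S1)) * mat_trace G n T))"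
proof -
  interpret A: bimodule G H W act R n S1 k1 g1 by fact
  interpret B: bimodule G H W act R n W k2 g2 by fact
  \<comment> \<open>The doubling requires \<open>10^12 * d\<close> to be at most 1 for the defect
    bound \<open>d = 4*e\<close>.\<close>
  define e :: real where "e = 1 / 10^13"
  obtain M where M: "A.G.approximates M T e" "adj M = M"
    using A.G.projection_approx[OF T, of e] unfolding e_def by auto
  have MF: "M \<in> A.G.Fin" using M(1) unfolding A.G.approximates_def by blast
  have near: "A.G.near (3/2) (4*e) M" by (rule A.G.approximates_near[OF T M(1)]) (simp_all add: e_def)
  let ?A = "A.rep M" and ?B = "B.rep M"
  have small: "10^12 * (4*e) \<le> 1" by (simp add: e_def)
  define \<Gamma> where "\<Gamma> = {g \<in> carrier G. \<exists>i j. ent M (g, i) (\<one>\<^bsub>G\<^esub>, j) \<noteq> 0}"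
  have \<Gamma>: "finite \<Gamma>"
  proof (rule finite_subset)
    show "\<Gamma> \<subseteq> fst ` (\<Union>j<n. {p. ent M p (\<one>\<^bsub>G\<^esub>, j) \<noteq> 0})"
    proof
      fix g assume "g \<in> \<Gamma>"
      then obtain i j where nz: "ent M (g, i) (\<one>\<^bsub>G\<^esub>, j) \<noteq> 0" unfolding \<Gamma>_def by blast
      then have "j < n" using A.G.Fin_supp[OF MF nz] by simp
      then show "g \<in> fst ` (\<Union>j<n. {p. ent M p (\<one>\<^bsub>G\<^esub>, j) \<noteq> 0})" using nz by force
    qed
    show "finite (fst ` (\<Union>j<n. {p. ent M p (\<one>\<^bsub>G\<^esub>, j) \<noteq> 0}))" by (intro finite_imageI finite_UN_I ent_col) simp
  qed
  have \<Gamma>G: "\<Gamma> \<subseteq> carrier G" unfolding \<Gamma>_def by blast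
  from cmp[OF \<Gamma> \<Gamma>G] obtain F where FF: "finite F \<and> (\<forall>w\<in>W. A.rp w \<notin> F \<longrightarrow> (\<forall>v\<in>W. \<forall>g\<in>\<Gamma>.
      (k2 w = k2 v \<and> g2 w \<otimes>\<^bsub>G\<^esub> inv\<^bsub>G\<^esub> (g2 v) = g) \<longleftrightarrow>
          (w \<in> S1 \<and> v \<in> S1 \<and> k1 w = k1 v \<and> g1 w \<otimes>\<^bsub>G\<^esub> inv\<^bsub>G\<^esub> (g1 v) = g)))"
    by (rule exE)
  note F = conjunct1[OF FF]
  note Fw = conjunct2[OF FF, rule_format]
  have entEq: "ent ?A p q = ent ?B p q" if p: "p \<in> A.W2" and q: "q \<in> A.W2" and pF: "A.rp (fst (fst p)) \<notin> F" for p q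
  proof -
    obtain w i b where pe: "p = ((w, i), b)" "w \<in> W" "i < n" using p unfolding A.W2_def by auto
    obtain v j c where qe: "q = ((v, j), c)" "v \<in> W" "j < n" using q unfolding A.W2_def by auto
    let ?c = "\<lambda>g. ent M (g, i) (\<one>\<^bsub>G\<^esub>, j)"
    have \<Gamma>I: "g \<in> \<Gamma>" if "?c g \<noteq> 0" for g
      using that A.G.Fin_supp[OF MF that] unfolding \<Gamma>_def by blast
    let ?P = "\<lambda>g. w \<in> S1 \<and> v \<in> S1 \<and> k1 w = k1 v \<and> g1 w \<otimes>\<^bsub>G\<^esub> inv\<^bsub>G\<^esub> (g1 v) = g"
    let ?Q = "\<lambda>g. k2 w = k2 v \<and> g2 w \<otimes>\<^bsub>G\<^esub> inv\<^bsub>G\<^esub> (g2 v) = g"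
    have iff: "?P g \<longleftrightarrow> ?Q g" if "?c g \<noteq> 0" for g
      using Fw[of w v g] pF pe qe \<Gamma>I[OF that] by simp
    have a: "ent ?A p q = (if w \<in> S1 \<and> v \<in> S1 \<and> k1 w = k1 v \<and> b = c then ?c (g1 w \<otimes>\<^bsub>G\<^esub> inv\<^bsub>G\<^esub> (g1 v)) else 0)"
      using pe qe by (simp add: A.ent_rep[OF MF] A.S2_def)
    have b: "ent ?B p q = (if k2 w = k2 v \<and> b = c then ?c (g2 w \<otimes>\<^bsub>G\<^esub> inv\<^bsub>G\<^esub> (g2 v)) else 0)"
      using pe qe by (simp add: B.ent_rep[OF MF] B.S2_def)
    show ?thesis
    proof (cases "ent ?A p q = 0")
      case True
      have "ent ?B p q = 0"
      proof (rule ccontr)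
        assume nz: "ent ?B p q \<noteq> 0"
        then have "k2 w = k2 v" "b = c" and cn: "?c (g2 w \<otimes>\<^bsub>G\<^esub> inv\<^bsub>G\<^esub> (g2 v)) \<noteq> 0" using b by (auto split: if_splits)
        then have "?P (g2 w \<otimes>\<^bsub>G\<^esub> inv\<^bsub>G\<^esub> (g2 v))" using iff[OF cn] by simp
        then show False using True a cn \<open>b = c\<close> by simp
      qed
      then show ?thesis using True by simp
    next
      case False
      then have h: "w \<in> S1 \<and> v \<in> S1 \<and> k1 w = k1 v" "b = c" and cn: "?c (g1 w \<otimes>\<^bsub>G\<^esub> inv\<^bsub>G\<^esub> (g1 v)) \<noteq> 0"
        using a by (auto split: if_splits)
      then have "?Q (g1 w \<otimes>\<^bsub>G\<^esub> inv\<^bsub>G\<^esub> (g1 v))" using iff[OF cn] by simp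
      then show ?thesis using a b h by simp
    qed
  qed
  have ABJ: "?A - ?B \<in> A.J.Fin"
  proof -
    have E: "?A - ?B \<in> A.J.Eq" by (intro A.J.diff_E A.rep_Eq B.rep_Eq MF)
    have "p \<in> A.W2 \<and> A.J.rp p \<in> (F \<times> {..<n}) \<times> UNIV" if nz: "ent (?A - ?B) p q \<noteq> 0" for p q
    proof -
      have "ent ?A p q \<noteq> 0 \<or> ent ?B p q \<noteq> 0" using nz by auto
      then have W: "p \<in> A.W2" "q \<in> A.W2"
        using A.S2_W2 B.S2_W2 by (auto simp: A.ent_rep[OF MF] B.ent_rep[OF MF] split: if_splits)
      then have "A.rp (fst (fst p)) \<in> F" using entEq[OF W] nz by auto
      then show ?thesis using W A.rp2[of "fst (fst p)" "snd (fst p)" "snd p"] unfolding A.W2_def by auto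
    qed
    moreover have "finite ((F \<times> {..<n}) \<times> (UNIV :: bool set))" using F by simp
    ultimately show ?thesis unfolding A.J.Fin_def using E by blast
  qed
  have cA: "A.DB.commuting ?A" and cB: "A.DB.commuting ?B"
    by (rule A.rep_commuting[OF MF], rule B.rep_commuting[OF MF])
  have nA: "A.J.near (3/2) (4*e) ?A" and nB: "A.J.near (3/2) (4*e) ?B"
    by (rule A.rep_near[OF MF near], rule B.rep_near[OF MF near])
  let ?r = "card (R - S1)"
  \<comment> \<open>Exact for every iterate: on representatives in \<open>S1\<close> the two
    diagonals cancel, on the others only the second survives, and the factor \<open>corner\<close>
    counts one of the two copies.\<close>
  have trk: "A.J.tr (((step^^k) ?A - (step^^k) ?B) * corner) = - of_nat ?r * A.G.tr ((step^^k) M)" for k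
  proof -
    let ?M = "(step^^k) M"
    have MkF: "?M \<in> A.G.Fin" by (rule A.G.step_pow_Fin[OF MF])
    let ?D = "((step^^k) ?A - (step^^k) ?B) * corner"
    let ?m = "\<lambda>i. ent ?M (\<one>\<^bsub>G\<^esub>, i) (\<one>\<^bsub>G\<^esub>, i)"
    have d: "ent ?D ((w, i), b) ((w, i), b) = (if b \<and> w \<notin> S1 then - ?m i else 0)" if "w \<in> R" "i < n" for w i b
      using that A.R_C unfolding ent_mult_corner A.rep_step_pow[OF MF, symmetric] B.rep_step_pow[OF MF, symmetric] ent_simps
        A.rep_diag[OF MkF] B.rep_diag[OF MkF] by (auto simp: A.S2_def B.S2_def)
    have "A.J.tr ?D = (\<Sum>s\<in>((R - S1) \<times> {..<n}) \<times> {True}. ent ?D s s)"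
    proof (rule A.J.tr_sum)
      fix s assume "s \<in> A.R2" and nz: "ent ?D s s \<noteq> 0"
      then obtain w i b where s: "s = ((w, i), b)" "w \<in> R" "i < n" unfolding A.R2_def by auto
      then show "s \<in> ((R - S1) \<times> {..<n}) \<times> {True}" using nz d[of w i b] by (auto split: if_splits)
    qed (use fin in \<open>auto simp: A.R2_def\<close>)
    also have "\<dots> = (\<Sum>s\<in>((R - S1) \<times> {..<n}) \<times> {True}. - ?m (snd (fst s)))"
      by (rule sum.cong) (auto simp: d)
    also have "\<dots> = (\<Sum>p\<in>(R - S1) \<times> {..<n}. - ?m (snd p))"
      by (rule sum.reindex_bij_witness[of _ "\<lambda>p. (p, True)" fst]) auto
    also have "\<dots> = (\<Sum>w\<in>R - S1. \<Sum>i<n. - ?m i)"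
      by (subst sum.cartesian_product) (auto intro: sum.cong)
    also have "\<dots> = - of_nat ?r * A.G.tr ?M" unfolding A.G.tr_eq by (simp add: sum_negf)
    finally show ?thesis .
  qed
  have "(\<lambda>k. A.G.tr ((step^^k) M)) \<longlonglongrightarrow> mat_trace G n T"
    by (rule A.G.tr_step_pow_projection[OF T M(1)]) (simp_all add: e_def)
  then have "(\<lambda>k. A.J.tr (((step^^k) ?A - (step^^k) ?B) * corner)) \<longlonglongrightarrow> - of_nat ?r * mat_trace G n T"
    unfolding trk by (intro tendsto_intros)
  note lim = A.DB.tr_step_pow_dbl_tendsto[OF nA cA nB cB ABJ small this]
  let ?X = "A.DB.dbl ?A ?B"
  have E: "?A \<in> A.J.Eq" "?B \<in> A.J.Eq" using nA nB unfolding A.J.near_def by auto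
  have nX: "A.J.near 300 (5000*(4*e)) ?X"
    by (rule A.DB.dbl_near[OF E ABJ cA cB _ _ _ _ small]) (use nA nB in \<open>auto simp: A.J.near_def\<close>)
  have XJ: "?X - corner \<in> A.J.Fin" by (rule A.DB.dbl_J[OF E ABJ])
  have Xadj: "adj ?X = ?X"
    by (rule A.adj_dbl[OF _ _ cA cB]) (simp_all add: A.rep_adj[symmetric] B.rep_adj[symmetric] M(2))
  obtain F0 where F0: "finite F0" "F0 \<subseteq> A.R2" "\<And>p q. ent (?X - corner) p q \<noteq> 0 \<Longrightarrow> A.J.rp p \<in> F0"
    using A.J.Fin_rows[OF XJ] by blast
  show ?thesis
  proof (intro exI[of _ F0] conjI allI impI)
    fix F assume F: "finite F" "F \<subseteq> A.R2" "F0 \<subseteq> F"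
    have "\<exists>T'. is_projection H (card F) T' \<and>
       mat_trace H (card F) T' = of_nat (card {s\<in>F. snd s}) + - of_nat ?r * mat_trace G n T"
      by (rule A.ex_projection_compress[OF nX Xadj XJ F(1,2) _ lim]) (use F0(3) F(3) in blast)
    then show "\<exists>f. is_projection H (card F) f \<and>
       mat_trace H (card F) f = of_nat (card {s\<in>F. snd s}) - of_nat ?r * mat_trace G n T" by simp
  qed (use F0 in auto)
qed

text \<open>Coordinates of the free \<open>G\<close>-set \<open>S0\<close> are pulled back along
  \<open>\<psi>\<close>, which will be the identity for Omega' and the inverse of \<phi> for Delta.
  The final equivalence translates quotients of coordinates back into the action.\<close>

lemma ex_bimodule:
  fixes G :: "('g, 'a) monoid_scheme" and H :: "('h, 'b) monoid_scheme" and W :: "'w set" and S0 :: "'d set"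
  assumes DS: "right_transversal H W act R" and G: "group G"
    and l: "left_action G S0 l" "free_left G S0 l"
    and S: "S \<subseteq> W" "\<And>s h. s \<in> S \<Longrightarrow> h \<in> carrier H \<Longrightarrow> act s h \<in> S"
    and \<psi>: "bij_betw \<psi> S S0" "\<And>s h. s \<in> S \<Longrightarrow> h \<in> carrier H \<Longrightarrow> \<psi> (act s h) = r (\<psi> s) h"
    and comm: "\<And>g h x. g \<in> carrier G \<Longrightarrow> h \<in> carrier H \<Longrightarrow> x \<in> S0 \<Longrightarrow> l g (r x h) = r (l g x) h"
  shows "\<exists>(\<kappa> :: 'w \<Rightarrow> 'd) \<gamma>. bimodule G H W act R S \<kappa> \<gamma> \<and> (\<forall>s\<in>S. \<forall>t\<in>S. \<forall>g\<in>carrier G.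
     (\<kappa> s = \<kappa> t \<and> \<gamma> s \<otimes>\<^bsub>G\<^esub> inv\<^bsub>G\<^esub> (\<gamma> t) = g) \<longleftrightarrow> \<psi> s = l g (\<psi> t))"
proof -
  interpret T: right_transversal H W act R by fact
  interpret G: group G by fact
  obtain \<kappa> :: "'d \<Rightarrow> 'd" and \<gamma> where k: "\<And>x. x \<in> S0 \<Longrightarrow> \<gamma> x \<in> carrier G"
    "\<And>x g. x \<in> S0 \<Longrightarrow> g \<in> carrier G \<Longrightarrow> \<kappa> (l g x) = \<kappa> x \<and> \<gamma> (l g x) = g \<otimes>\<^bsub>G\<^esub> \<gamma> x"
    "\<And>x y. x \<in> S0 \<Longrightarrow> y \<in> S0 \<Longrightarrow> \<kappa> x = \<kappa> y \<Longrightarrow> x = l (\<gamma> x \<otimes>\<^bsub>G\<^esub> inv\<^bsub>G\<^esub> (\<gamma> y)) y"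
    using ex_left_coordinates[OF G l] by blast
  have iff: "(\<kappa> x = \<kappa> y \<and> \<gamma> x \<otimes>\<^bsub>G\<^esub> inv\<^bsub>G\<^esub> (\<gamma> y) = g) \<longleftrightarrow> x = l g y" if "x \<in> S0" "y \<in> S0" "g \<in> carrier G" for x y g
    using k(3)[OF that(1,2)] k(2)[OF that(2,3)] k(1)[OF that(2)] that(3) by (auto simp: G.m_assoc)
  have \<psi>S: "\<psi> s \<in> S0" if "s \<in> S" for s using \<psi>(1) that by (auto simp: bij_betw_def)
  have l1: "l \<one>\<^bsub>G\<^esub> x = x" "g \<in> carrier G \<Longrightarrow> l g x \<in> S0" if "x \<in> S0" for x g
    using l(1) that unfolding left_action_def by auto
  have "bimodule G H W act R S (\<lambda>s. \<kappa> (\<psi> s)) (\<lambda>s. \<gamma> (\<psi> s))"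
  proof unfold_locales
    show "\<gamma> (\<psi> s) \<in> carrier G" if "s \<in> S" for s using k(1) \<psi>S that by blast
    show "s = t" if st: "s \<in> S" "t \<in> S" "\<kappa> (\<psi> s) = \<kappa> (\<psi> t)" "\<gamma> (\<psi> s) = \<gamma> (\<psi> t)" for s t
    proof -
      have "\<psi> s = \<psi> t" using k(3)[OF \<psi>S[OF st(1)] \<psi>S[OF st(2)] st(3)] st(4) k(1)[OF \<psi>S[OF st(2)]] l1(1)[OF \<psi>S[OF st(2)]] by simp
      then show ?thesis using \<psi>(1) st(1,2) by (auto simp: bij_betw_def inj_on_def)
    qed
    show "\<exists>t\<in>S. \<kappa> (\<psi> t) = \<kappa> (\<psi> s) \<and> \<gamma> (\<psi> t) = g" if sg: "s \<in> S" "g \<in> carrier G" for s g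
    proof -
      let ?x = "\<psi> s" and ?h = "g \<otimes>\<^bsub>G\<^esub> inv\<^bsub>G\<^esub> (\<gamma> (\<psi> s))"
      have x: "?x \<in> S0" "\<gamma> ?x \<in> carrier G" using \<psi>S[OF sg(1)] k(1) by auto
      then have h: "?h \<in> carrier G" using sg by simp
      have "l ?h ?x \<in> \<psi> ` S" using l1(2)[OF x(1) h] \<psi>(1) by (simp add: bij_betw_def)
      then obtain t where t: "t \<in> S" "\<psi> t = l ?h ?x" by auto
      have "\<kappa> (\<psi> t) = \<kappa> ?x" "\<gamma> (\<psi> t) = g" using k(2)[OF x(1) h] t(2) sg x(2) by (simp_all add: G.m_assoc)
      then show ?thesis using t(1) by blast
    qed
    show "\<kappa> (\<psi> (act s h)) = \<kappa> (\<psi> (act t h)) \<and>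
        \<gamma> (\<psi> (act s h)) \<otimes>\<^bsub>G\<^esub> inv\<^bsub>G\<^esub> (\<gamma> (\<psi> (act t h))) = \<gamma> (\<psi> s) \<otimes>\<^bsub>G\<^esub> inv\<^bsub>G\<^esub> (\<gamma> (\<psi> t))"
      if st: "s \<in> S" "t \<in> S" and h: "h \<in> carrier H" and eq: "\<kappa> (\<psi> s) = \<kappa> (\<psi> t)" for s t h
    proof -
      let ?g = "\<gamma> (\<psi> s) \<otimes>\<^bsub>G\<^esub> inv\<^bsub>G\<^esub> (\<gamma> (\<psi> t))"
      have g: "?g \<in> carrier G" using k(1) \<psi>S st by simp
      have "\<psi> s = l ?g (\<psi> t)" using k(3)[OF \<psi>S[OF st(1)] \<psi>S[OF st(2)] eq] .
      then have "\<psi> (act s h) = l ?g (\<psi> (act t h))"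
        using \<psi>(2)[OF st(1) h] \<psi>(2)[OF st(2) h] comm[OF g h \<psi>S[OF st(2)]] by simp
      then show ?thesis using iff[OF \<psi>S \<psi>S g, of "act s h" "act t h"] S(2) st h by blast
    qed
  qed (use S in auto)
  then show ?thesis using iff \<psi>S by (intro exI[of _ "\<lambda>s. \<kappa> (\<psi> s)"] exI[of _ "\<lambda>s. \<gamma> (\<psi> s)"]) blast
qed

section \<open>Comparison of the two \<open>G\<close>-sets\<close>

theorem theorem1p1:
  fixes G :: "('g,'a) monoid_scheme" and H :: "('h,'b) monoid_scheme"
    and A :: "real set" and r :: nat
    and \<Omega> \<Omega>' X :: "'w set" and \<Delta> :: "'d set"
    and lO :: "'g \<Rightarrow> 'w \<Rightarrow> 'w" and rO :: "'w \<Rightarrow> 'h \<Rightarrow> 'w"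
    and lD :: "'g \<Rightarrow> 'd \<Rightarrow> 'd" and rD :: "'d \<Rightarrow> 'h \<Rightarrow> 'd"
    and \<phi> :: "'d \<Rightarrow> 'w"
  assumes "group G" and "group H"
    and "countable (carrier G)" and "countable (carrier H)"
    and "trK0 H \<subseteq> A"
    and "left_action G \<Omega> lO" and "right_action H \<Omega> rO"
    and "\<forall>g\<in>carrier G. \<forall>h\<in>carrier H. \<forall>x\<in>\<Omega>. lO g (rO x h) = rO (lO g x) h"
    and "left_action G \<Delta> lD" and "right_action H \<Delta> rD"
    and "\<forall>g\<in>carrier G. \<forall>h\<in>carrier H. \<forall>x\<in>\<Delta>. lD g (rD x h) = rD (lD g x) h"
    and "free_right H \<Omega> rO" and "free_right H \<Delta> rD"
    and "\<Omega> = \<Omega>' \<union> X" and "\<Omega>' \<inter> X = {}"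
    and "free_left G \<Delta> lD"
    and "left_action G \<Omega>' lO" and "free_left G \<Omega>' lO"
    and "right_action H X rO"
    and "card (right_orbit H rO ` X) = r" and "1 \<le> r"
    and "bij_betw \<phi> \<Delta> \<Omega>"
    and "\<forall>x\<in>\<Delta>. \<forall>h\<in>carrier H. \<phi> (rD x h) = rO (\<phi> x) h"
    and "\<forall>g\<in>carrier G. \<exists>F. finite F \<and> F \<subseteq> \<Delta> \<and>
           {x \<in> \<Delta>. \<phi> (lD g x) \<noteq> lO g (\<phi> x)} \<subseteq> (\<Union>x\<in>F. right_orbit H rD x)"
  shows "trK0 G \<subseteq> (\<lambda>a. a / real r) ` A"
proof
  fix x assume "x \<in> trK0 G"
  then obtain n p q where x: "x = Re (mat_trace G n p) - Re (mat_trace G n q)"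
    and p: "is_projection G n p" and q: "is_projection G n q" unfolding trK0_def by blast
  note GG = assms(1) and HH = assms(2)
  interpret G: group G by fact
  interpret H: group H by fact
  note lO = assms(6)[unfolded left_action_def] and rO = assms(7)[unfolded right_action_def]
  note lD = assms(9)[unfolded left_action_def] and rD = assms(10)[unfolded right_action_def]
  note rX = assms(19)[unfolded right_action_def]
  have eqv: "\<phi> (rD x h) = rO (\<phi> x) h" if "x \<in> \<Delta>" "h \<in> carrier H" for x h using assms(23) that by blast
  have cO: "lO g (rO x h) = rO (lO g x) h" if "g \<in> carrier G" "h \<in> carrier H" "x \<in> \<Omega>" for g h x
    using assms(8) that by blast
  have cD: "lD g (rD x h) = rD (lD g x) h" if "g \<in> carrier G" "h \<in> carrier H" "x \<in> \<Delta>" for g h x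
    using assms(11) that by blast
  obtain R where "right_transversal H \<Omega> rO R" using ex_right_transversal[OF HH assms(7,12)] by blast
  then interpret R: right_transversal H \<Omega> rO R .
  have XO: "X \<subseteq> \<Omega>" using assms(14) by blast
  have O'O: "\<Omega>' \<subseteq> \<Omega>" using assms(14) by blast
  have O'X: "w \<in> \<Omega>' \<longleftrightarrow> w \<notin> X" if "w \<in> \<Omega>" for w using that assms(14,15) by blast
  have X_act: "rO w h \<in> X" if "w \<in> X" "h \<in> carrier H" for w h using rX that by blast
  have O'_act: "rO w h \<in> \<Omega>'" if w: "w \<in> \<Omega>'" and h: "h \<in> carrier H" for w h
  proof -
    have wO: "w \<in> \<Omega>" using w O'O by blast
    have "rO w h \<notin> X"
    proof
      assume "rO w h \<in> X"
      then have "rO (rO w h) (inv\<^bsub>H\<^esub> h) \<in> X" using X_act h by simp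
      then show False using R.act_inv[OF wO h] w O'X[OF wO] by simp
    qed
    then show ?thesis using O'X[OF R.act_closed[OF wO h]] by simp
  qed
  have rpX: "R.rp w \<in> R \<inter> X" if w: "w \<in> X" for w
  proof -
    have wO: "w \<in> \<Omega>" using w XO by blast
    note r = R.rp[OF wO]
    have "R.rp w = rO w (inv\<^bsub>H\<^esub> (R.cf w))" using R.act_inv[OF R.rp_C[OF wO] r(2)] r(3) by simp
    then show ?thesis using X_act[OF w, of "inv\<^bsub>H\<^esub> (R.cf w)"] r by simp
  qed
  \<comment> \<open>Representatives lying in \<open>X\<close> correspond to the
    \<open>H\<close>-orbits of \<open>X\<close>, so the orbit count becomes the number of
    representatives outside \<open>\<Omega>'\<close>.\<close>
  have "bij_betw (right_orbit H rO) (R \<inter> X) (right_orbit H rO ` X)"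
  proof (rule bij_betw_imageI)
    show "inj_on (right_orbit H rO) (R \<inter> X)"
    proof (rule inj_onI)
      fix s t assume st: "s \<in> R \<inter> X" "t \<in> R \<inter> X" and eq: "right_orbit H rO s = right_orbit H rO t"
      have "s \<in> right_orbit H rO s" unfolding right_orbit_def using R.act_one[of s, symmetric] st(1) XO by blast
      then have "\<exists>h. s = rO t h \<and> h \<in> carrier H" unfolding eq by (simp add: right_orbit_def)
      then obtain h where h: "s = rO t h" "h \<in> carrier H" by (elim exE conjE)
      then show "s = t" using R.rp_act(1)[of t h] R.rp_R[of s] st by (metis IntE)
    qed
    show "right_orbit H rO ` (R \<inter> X) = right_orbit H rO ` X"
    proof (intro equalityI subsetI)
      fix Y assume "Y \<in> right_orbit H rO ` X"
      then obtain w where w: "w \<in> X" "Y = right_orbit H rO w" by blast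
      have wO: "w \<in> \<Omega>" using w XO by blast
      note r = R.rp[OF wO]
      have "right_orbit H rO w = right_orbit H rO (R.rp w)"
      proof (intro equalityI subsetI)
        fix y assume "y \<in> right_orbit H rO w"
        then obtain h where h: "h \<in> carrier H" "y = rO w h" unfolding right_orbit_def by blast
        then have "y = rO (R.rp w) (R.cf w \<otimes>\<^bsub>H\<^esub> h)" using R.act_mult[OF R.rp_C[OF wO] r(2) h(1)] r(3) by simp
        then show "y \<in> right_orbit H rO (R.rp w)" unfolding right_orbit_def using h(1) r(2) by blast
      next
        fix y assume "y \<in> right_orbit H rO (R.rp w)"
        then obtain h where h: "h \<in> carrier H" "y = rO (R.rp w) h" unfolding right_orbit_def by blast
        have "R.rp w = rO w (inv\<^bsub>H\<^esub> (R.cf w))" using R.act_inv[OF R.rp_C[OF wO] r(2)] r(3) by simp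
        then have "y = rO w (inv\<^bsub>H\<^esub> (R.cf w) \<otimes>\<^bsub>H\<^esub> h)" using R.act_mult[OF wO _ h(1), of "inv\<^bsub>H\<^esub> (R.cf w)"] r(2) h by simp
        moreover have "inv\<^bsub>H\<^esub> (R.cf w) \<otimes>\<^bsub>H\<^esub> h \<in> carrier H" using h(1) r(2) by simp
        ultimately show "y \<in> right_orbit H rO w" unfolding right_orbit_def by blast
      qed
      then show "Y \<in> right_orbit H rO ` (R \<inter> X)" using w rpX[OF w(1)] by blast
    qed blast
  qed
  then have cardX: "card (R \<inter> X) = r" using bij_betw_same_card assms(20) by blast
  \<comment> \<open>An infinite set has cardinality 0, which \<open>1 \<le> r\<close>
    excludes.\<close>
  then have finX: "finite (R \<inter> X)" using assms(21) card_ge_0_finite by force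
  have RX: "R - \<Omega>' = R \<inter> X" using R.R_C O'X by blast
  define \<psi> where "\<psi> = inv_into \<Delta> \<phi>"
  have \<psi>: "bij_betw \<psi> \<Omega> \<Delta>" unfolding \<psi>_def by (rule bij_betw_inv_into[OF assms(22)])
  have \<psi>D: "\<psi> w \<in> \<Delta>" if "w \<in> \<Omega>" for w using \<psi> that by (auto simp: bij_betw_def)
  have \<phi>\<psi>: "\<phi> (\<psi> w) = w" if "w \<in> \<Omega>" for w unfolding \<psi>_def by (rule bij_betw_inv_into_right[OF assms(22) that])
  have \<psi>\<phi>: "\<psi> (\<phi> x) = x" if "x \<in> \<Delta>" for x unfolding \<psi>_def by (rule bij_betw_inv_into_left[OF assms(22) that])
  have \<phi>O: "\<phi> x \<in> \<Omega>" if "x \<in> \<Delta>" for x using assms(22) that by (auto simp: bij_betw_def)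
  have \<psi>eqv: "\<psi> (rO w h) = rD (\<psi> w) h" if "w \<in> \<Omega>" "h \<in> carrier H" for w h
  proof -
    have "rO w h = \<phi> (rD (\<psi> w) h)" using eqv[OF \<psi>D[OF that(1)] that(2)] \<phi>\<psi>[OF that(1)] by simp
    moreover have "rD (\<psi> w) h \<in> \<Delta>" using rD \<psi>D that by blast
    ultimately show ?thesis using \<psi>\<phi> by simp
  qed
  have idb: "bij_betw (\<lambda>s. s) \<Omega>' \<Omega>'" by (simp add: bij_betw_def)
  have cO': "lO g (rO x h) = rO (lO g x) h" if "g \<in> carrier G" "h \<in> carrier H" "x \<in> \<Omega>'" for g h x
    using cO that O'O by blast
  have "\<exists>(\<kappa> :: 'w \<Rightarrow> 'w) \<gamma>. bimodule G H \<Omega> rO R \<Omega>' \<kappa> \<gamma> \<and> (\<forall>s\<in>\<Omega>'. \<forall>t\<in>\<Omega>'. \<forall>g\<in>carrier G.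
     (\<kappa> s = \<kappa> t \<and> \<gamma> s \<otimes>\<^bsub>G\<^esub> inv\<^bsub>G\<^esub> (\<gamma> t) = g) \<longleftrightarrow> s = lO g t)"
    by (rule ex_bimodule[where \<psi> = "\<lambda>s. s" and r = rO, OF R.right_transversal_axioms GG assms(17,18) O'O])
      (fact O'_act idb cO' | rule refl)+
  then obtain k1 :: "'w \<Rightarrow> 'w" and g1 where b1: "bimodule G H \<Omega> rO R \<Omega>' k1 g1"
    and i1: "\<forall>s\<in>\<Omega>'. \<forall>t\<in>\<Omega>'. \<forall>g\<in>carrier G. (k1 s = k1 t \<and> g1 s \<otimes>\<^bsub>G\<^esub> inv\<^bsub>G\<^esub> (g1 t) = g) \<longleftrightarrow> s = lO g t"
    by (elim exE conjE)
  have "\<exists>(\<kappa> :: 'w \<Rightarrow> 'd) \<gamma>. bimodule G H \<Omega> rO R \<Omega> \<kappa> \<gamma> \<and> (\<forall>s\<in>\<Omega>. \<forall>t\<in>\<Omega>. \<forall>g\<in>carrier G.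
     (\<kappa> s = \<kappa> t \<and> \<gamma> s \<otimes>\<^bsub>G\<^esub> inv\<^bsub>G\<^esub> (\<gamma> t) = g) \<longleftrightarrow> \<psi> s = lD g (\<psi> t))"
    by (rule ex_bimodule[where \<psi> = \<psi> and r = rD, OF R.right_transversal_axioms GG assms(9,16) order_refl])
      (fact R.act_closed \<psi> \<psi>eqv cD)+
  then obtain k2 :: "'w \<Rightarrow> 'd" and g2 where b2: "bimodule G H \<Omega> rO R \<Omega> k2 g2"
    and i2: "\<forall>s\<in>\<Omega>. \<forall>t\<in>\<Omega>. \<forall>g\<in>carrier G. (k2 s = k2 t \<and> g2 s \<otimes>\<^bsub>G\<^esub> inv\<^bsub>G\<^esub> (g2 t) = g) \<longleftrightarrow> \<psi> s = lD g (\<psi> t)"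
    by (elim exE conjE)
  have cmp: "\<exists>F. finite F \<and> (\<forall>w\<in>\<Omega>. R.rp w \<notin> F \<longrightarrow> (\<forall>v\<in>\<Omega>. \<forall>g\<in>\<Gamma>.
       (k2 w = k2 v \<and> g2 w \<otimes>\<^bsub>G\<^esub> inv\<^bsub>G\<^esub> (g2 v) = g) \<longleftrightarrow>
       (w \<in> \<Omega>' \<and> v \<in> \<Omega>' \<and> k1 w = k1 v \<and> g1 w \<otimes>\<^bsub>G\<^esub> inv\<^bsub>G\<^esub> (g1 v) = g)))"
    if fin: "finite \<Gamma>" and \<Gamma>: "\<Gamma> \<subseteq> carrier G" for \<Gamma>
  proof -
    have "\<forall>g\<in>\<Gamma>. \<exists>F. finite F \<and> F \<subseteq> \<Delta> \<and> {x \<in> \<Delta>. \<phi> (lD g x) \<noteq> lO g (\<phi> x)} \<subseteq> (\<Union>x\<in>F. right_orbit H rD x)"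
      using assms(24) \<Gamma> by blast
    then obtain E where E: "\<And>g. g \<in> \<Gamma> \<Longrightarrow> finite (E g)" "\<And>g. g \<in> \<Gamma> \<Longrightarrow> E g \<subseteq> \<Delta>"
      "\<And>g. g \<in> \<Gamma> \<Longrightarrow> {x \<in> \<Delta>. \<phi> (lD g x) \<noteq> lO g (\<phi> x)} \<subseteq> (\<Union>x\<in>E g. right_orbit H rD x)"
      using bchoice[of \<Gamma>] by metis
    \<comment> \<open>The orbits of rows \<open>w\<close> where the two actions may disagree:
      \<open>w\<close> in \<open>X\<close>; \<open>w = \<phi> (g y)\<close> with \<open>y\<close>
      coming from \<open>X\<close> or from an orbit covering the exceptional set of
      \<open>g\<close>; and \<open>w = g v\<close> with \<open>v\<close> the image of such an
      exceptional \<open>y\<close>.\<close>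
    define F where "F = (R \<inter> X) \<union> (\<Union>g\<in>\<Gamma>. (\<lambda>x. R.rp (\<phi> (lD g x))) ` (\<psi> ` (R \<inter> X) \<union> E g) \<union> (\<lambda>x. R.rp (lO g (\<phi> x))) ` E g)"
    have finF: "finite F" unfolding F_def using fin finX E(1) by auto
    have "(k2 w = k2 v \<and> g2 w \<otimes>\<^bsub>G\<^esub> inv\<^bsub>G\<^esub> (g2 v) = g) \<longleftrightarrow>
       (w \<in> \<Omega>' \<and> v \<in> \<Omega>' \<and> k1 w = k1 v \<and> g1 w \<otimes>\<^bsub>G\<^esub> inv\<^bsub>G\<^esub> (g1 v) = g)"
      if w: "w \<in> \<Omega>" and wF: "R.rp w \<notin> F" and v: "v \<in> \<Omega>" and g: "g \<in> \<Gamma>" for w v g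
    proof -
      have gG: "g \<in> carrier G" using g \<Gamma> by blast
      have lDc: "lD g x \<in> \<Delta>" if "x \<in> \<Delta>" for x using lD gG that by blast
      have lOc: "lO g x \<in> \<Omega>" if "x \<in> \<Omega>" for x using lO gG that by blast
      let ?y = "\<psi> v"
      have y: "?y \<in> \<Delta>" by (rule \<psi>D[OF v])
      \<comment> \<open>An exceptional \<open>?y\<close> lies in the orbit of some \<open>f\<close>
        in \<open>E g\<close>; either form of \<open>w\<close> is then an \<open>H\<close>-translate
        of a point whose representative was put into \<open>F\<close>.\<close>
      have notR: "\<phi> (lD g ?y) = lO g v" if hyp: "w = \<phi> (lD g ?y) \<or> w = lO g v"
      proof (rule ccontr)
        assume "\<phi> (lD g ?y) \<noteq> lO g v"
        then have "?y \<in> {x \<in> \<Delta>. \<phi> (lD g x) \<noteq> lO g (\<phi> x)}" using y \<phi>\<psi>[OF v] by simp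
        then obtain f h where f: "f \<in> E g" "h \<in> carrier H" "?y = rD f h"
          using E(3)[OF g] unfolding right_orbit_def by blast
        have fD: "f \<in> \<Delta>" using E(2)[OF g] f(1) by blast
        have "v = rO (\<phi> f) h" using eqv[OF fD f(2)] f(3) \<phi>\<psi>[OF v] by simp
        then have "lO g v = rO (lO g (\<phi> f)) h" using cO[OF gG f(2) \<phi>O[OF fD]] by simp
        moreover have "\<phi> (lD g ?y) = rO (\<phi> (lD g f)) h" using cD[OF gG f(2) fD] f(3) eqv[OF lDc[OF fD] f(2)] by simp
        ultimately have "R.rp w = R.rp (\<phi> (lD g f)) \<or> R.rp w = R.rp (lO g (\<phi> f))"
          using hyp R.rp_act_C(1)[OF \<phi>O[OF lDc[OF fD]] f(2)] R.rp_act_C(1)[OF lOc[OF \<phi>O[OF fD]] f(2)] by auto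
        then show False using wF g f(1) unfolding F_def by blast
      qed
      have wX: "w \<in> \<Omega>'"
      proof -
        have "w \<notin> X" using rpX[of w] wF unfolding F_def by blast
        then show ?thesis using O'X[OF w] by simp
      qed
      have vX: "v \<in> \<Omega>'" if hyp: "w = \<phi> (lD g ?y)"
      proof -
        have "v \<notin> X"
        proof
          assume vX: "v \<in> X"
          note r = R.rp[OF v] and rX = rpX[OF vX]
          have rO': "R.rp v \<in> \<Omega>" by (rule R.rp_C[OF v])
          have "?y = rD (\<psi> (R.rp v)) (R.cf v)" using \<psi>eqv[OF rO' r(2)] r(3) by simp
          then have "w = rO (\<phi> (lD g (\<psi> (R.rp v)))) (R.cf v)"
            using hyp cD[OF gG r(2) \<psi>D[OF rO']] eqv[OF lDc[OF \<psi>D[OF rO']] r(2)] by simp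
          then have "R.rp w = R.rp (\<phi> (lD g (\<psi> (R.rp v))))"
            using R.rp_act_C(1)[OF \<phi>O[OF lDc[OF \<psi>D[OF rO']]] r(2)] by simp
          then show False using wF g rX unfolding F_def by blast
        qed
        then show ?thesis using O'X[OF v] by simp
      qed
      have "\<psi> w = lD g ?y \<longleftrightarrow> w = \<phi> (lD g ?y)" using \<phi>\<psi>[OF w] \<psi>\<phi>[OF lDc[OF y]] by auto
      then have "\<psi> w = lD g ?y \<longleftrightarrow> w \<in> \<Omega>' \<and> v \<in> \<Omega>' \<and> w = lO g v" using notR wX vX by auto
      then show ?thesis using i2 w v gG i1 by blast
    qed
    then show ?thesis using finF by blast
  qed
  have fin1: "finite (R - \<Omega>')" using finX RX by simp
  obtain Fp where Fp: "finite Fp" "Fp \<subseteq> doubled_set.R2 R n"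
    "\<And>F. finite F \<Longrightarrow> F \<subseteq> doubled_set.R2 R n \<Longrightarrow> Fp \<subseteq> F \<Longrightarrow> \<exists>f. is_projection H (card F) f \<and>
       mat_trace H (card F) f = of_nat (card {s\<in>F. snd s}) - of_nat (card (R - \<Omega>')) * mat_trace G n p"
    using ex_projection_transfer[OF b1 b2 fin1 cmp p] by blast
  obtain Fq where Fq: "finite Fq" "Fq \<subseteq> doubled_set.R2 R n"
    "\<And>F. finite F \<Longrightarrow> F \<subseteq> doubled_set.R2 R n \<Longrightarrow> Fq \<subseteq> F \<Longrightarrow> \<exists>f. is_projection H (card F) f \<and>
       mat_trace H (card F) f = of_nat (card {s\<in>F. snd s}) - of_nat (card (R - \<Omega>')) * mat_trace G n q"
    using ex_projection_transfer[OF b1 b2 fin1 cmp q] by blast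
  let ?F = "Fp \<union> Fq"
  have F: "finite ?F" "?F \<subseteq> doubled_set.R2 R n" using Fp Fq by auto
  obtain f where f: "is_projection H (card ?F) f"
    "mat_trace H (card ?F) f = of_nat (card {s\<in>?F. snd s}) - of_nat (card (R - \<Omega>')) * mat_trace G n p"
    using Fp(3)[OF F] by blast
  obtain f' where f': "is_projection H (card ?F) f'"
    "mat_trace H (card ?F) f' = of_nat (card {s\<in>?F. snd s}) - of_nat (card (R - \<Omega>')) * mat_trace G n q"
    using Fq(3)[OF F] by blast
  \<comment> \<open>The order is reversed because each trace over \<open>H\<close> contains minus
    \<open>r\<close> times the trace over \<open>G\<close>; the common set \<open>?F\<close> gives
    both the same integer.\<close>
  have "Re (mat_trace H (card ?F) f') - Re (mat_trace H (card ?F) f) \<in> trK0 H"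
    unfolding trK0_def using f(1) f'(1) by blast
  moreover have "Re (mat_trace H (card ?F) f') - Re (mat_trace H (card ?F) f) = real r * x"
    unfolding f(2) f'(2) x RX cardX by (simp add: algebra_simps)
  ultimately have "real r * x \<in> A" using assms(5) by auto
  then show "x \<in> (\<lambda>a. a / real r) ` A" using assms(21) by (intro image_eqI[of _ _ "real r * x"]) auto
qed

end
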